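(* Let $a>0$ and let $\widetilde{\mathbf V}=\{u\in H^1_0(\mathbb H^2(-a^2)): d^*u=0\}$, where $d^*u$ is understood in the weak sense. Then $\mathbb V=\widetilde{\mathbf V}$.
   Context: $\mathbb H^2(-a^2)$ is the two-dimensional hyperbolic space of constant curvature $-a^2$ with metric $g$, volume form $\mathrm{Vol}$, Levi-Civita connection $\overline\nabla$, induced tensor metric $\overline g$; $d^*$ is the formal $L^2$-adjoint of $d$. $\mathrm{Def}\,u=\frac12(\overline\nabla u+(\overline\nabla u)^T)$, understood weakly for $L^2$ 1-forms. $\|u\|_{H^1}^2=\|u\|_{L^2}^2+2\|\mathrm{Def}\,u\|_{L^2}^2$; $H^1_0$ = completion of smooth compactly supported 1-forms in this norm. For an $L^2$ 1-form $u$, $d^*u=w\in L^2$ weakly means $\int w\phi\,\mathrm{Vol}=\int g(u,d\phi)\mathrm{Vol}$ for all $\phi\in C^\infty_c$. $\Lambda^1_{c,\sigma}$ = smooth compactly supported 1-forms $\theta$ with $d^*\theta=0$; $\mathbf V$ = closure of $\Lambda^1_{c,\sigma}$ in $\|\cdot\|_{H^1}$; $\mathbb F=\{dF\in L^2:F\text{ harmonic on }\mathbb H^2(-a^2)\}$; $\mathbb V=\mathbf V\oplus\mathbb F$. *)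

theory Defs
  imports "HOL-Analysis.Analysis"
begin

text \<open>Model: the Poincare disk model of the hyperbolic plane of curvature -a^2.
  Points are x in the open unit disk of real^2, with metric
  g = rho(x)^2 (dx1^2 + dx2^2), rho(x) = 2 / (a (1 - |x|^2)).
  A 1-form u = u_1 dx1 + u_2 dx2 is represented by its coefficient function
  u :: real^2 => real^2 (u x $ i = u_i(x)).  Only values on the disk matter.\<close>

definition Hdisk :: "(real^2) set" where
  "Hdisk = ball 0 1"

definition rho :: "real \<Rightarrow> real^2 \<Rightarrow> real" where
  "rho a x = 2 / (a * (1 - (norm x)\<^sup>2))"

definition pd :: "2 \<Rightarrow> (real^2 \<Rightarrow> real) \<Rightarrow> real^2 \<Rightarrow> real" where
  "pd i f x = deriv (\<lambda>t. f (x + t *\<^sub>R axis i 1)) 0"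

fun Ck_on :: "nat \<Rightarrow> (real^2) set \<Rightarrow> (real^2 \<Rightarrow> real) \<Rightarrow> bool" where
  "Ck_on 0 S f = continuous_on S f"
| "Ck_on (Suc k) S f = ((\<forall>x\<in>S. f differentiable (at x)) \<and> (\<forall>i. Ck_on k S (pd i f)))"

definition smooth_fun :: "(real^2) set \<Rightarrow> (real^2 \<Rightarrow> real) \<Rightarrow> bool" where
  "smooth_fun S f \<longleftrightarrow> (\<forall>k. Ck_on k S f)"

definition smooth_form :: "(real^2) set \<Rightarrow> (real^2 \<Rightarrow> real^2) \<Rightarrow> bool" where
  "smooth_form S u \<longleftrightarrow> (\<forall>i. smooth_fun S (\<lambda>x. u x $ i))"

definition csupp_in :: "(real^2) set \<Rightarrow> (real^2 \<Rightarrow> 'b::zero) \<Rightarrow> bool" where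
  "csupp_in S f \<longleftrightarrow> compact (closure {x. f x \<noteq> 0}) \<and> closure {x. f x \<noteq> 0} \<subseteq> S"

definition test_fun :: "(real^2 \<Rightarrow> real) \<Rightarrow> bool" where
  "test_fun \<phi> \<longleftrightarrow> smooth_fun Hdisk \<phi> \<and> csupp_in Hdisk \<phi>"

definition cc_form :: "(real^2 \<Rightarrow> real^2) \<Rightarrow> bool" where
  "cc_form \<theta> \<longleftrightarrow> smooth_form Hdisk \<theta> \<and> csupp_in Hdisk \<theta>"

definition gmet :: "real \<Rightarrow> 2 \<Rightarrow> 2 \<Rightarrow> real^2 \<Rightarrow> real" where
  "gmet a i j x = (if i = j then (rho a x)\<^sup>2 else 0)"

definition ginv :: "real \<Rightarrow> 2 \<Rightarrow> 2 \<Rightarrow> real^2 \<Rightarrow> real" where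
  "ginv a i j x = matrix_inv (\<chi> k l. gmet a k l x) $ i $ j"

definition voldens :: "real \<Rightarrow> real^2 \<Rightarrow> real" where
  "voldens a x = sqrt (det (\<chi> k l. gmet a k l x))"

definition christoffel :: "real \<Rightarrow> 2 \<Rightarrow> 2 \<Rightarrow> 2 \<Rightarrow> real^2 \<Rightarrow> real" where
  "christoffel a k i j x = (1/2) * (\<Sum>l\<in>UNIV. ginv a k l x *
      (pd i (gmet a j l) x + pd j (gmet a i l) x - pd l (gmet a i j) x))"

definition gform :: "real \<Rightarrow> real^2 \<Rightarrow> real^2 \<Rightarrow> real^2 \<Rightarrow> real" where
  "gform a x u v = (\<Sum>i\<in>UNIV. \<Sum>j\<in>UNIV. ginv a i j x * u $ i * v $ j)"

definition gtens :: "real \<Rightarrow> real^2 \<Rightarrow> real^2^2 \<Rightarrow> real^2^2 \<Rightarrow> real" where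
  "gtens a x S T = (\<Sum>i\<in>UNIV. \<Sum>j\<in>UNIV. \<Sum>k\<in>UNIV. \<Sum>l\<in>UNIV.
      ginv a i k x * ginv a j l x * S $ i $ j * T $ k $ l)"

definition hint :: "real \<Rightarrow> (real^2 \<Rightarrow> real) \<Rightarrow> real" where
  "hint a f = integral\<^sup>L (lebesgue_on Hdisk) (\<lambda>x. f x * voldens a x)"

definition L2_form :: "real \<Rightarrow> (real^2 \<Rightarrow> real^2) \<Rightarrow> bool" where
  "L2_form a u \<longleftrightarrow> (\<forall>i. (\<lambda>x. u x $ i) \<in> borel_measurable (lebesgue_on Hdisk)) \<and>
     integrable (lebesgue_on Hdisk) (\<lambda>x. gform a x (u x) (u x) * voldens a x)"

definition L2_tens :: "real \<Rightarrow> (real^2 \<Rightarrow> real^2^2) \<Rightarrow> bool" where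
  "L2_tens a T \<longleftrightarrow> (\<forall>i j. (\<lambda>x. T x $ i $ j) \<in> borel_measurable (lebesgue_on Hdisk)) \<and>
     integrable (lebesgue_on Hdisk) (\<lambda>x. gtens a x (T x) (T x) * voldens a x)"

definition L2norm2_form :: "real \<Rightarrow> (real^2 \<Rightarrow> real^2) \<Rightarrow> real" where
  "L2norm2_form a u = hint a (\<lambda>x. gform a x (u x) (u x))"

definition L2norm2_tens :: "real \<Rightarrow> (real^2 \<Rightarrow> real^2^2) \<Rightarrow> real" where
  "L2norm2_tens a T = hint a (\<lambda>x. gtens a x (T x) (T x))"

definition dfun :: "(real^2 \<Rightarrow> real) \<Rightarrow> real^2 \<Rightarrow> real^2" where
  "dfun F x = (\<chi> i. pd i F x)"

text \<open>Classical Def u = 1/2 (nabla u + (nabla u)^T), (nabla u)_ij = d_i u_j - Gamma^k_ij u_k.\<close>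
definition Def_classical :: "real \<Rightarrow> (real^2 \<Rightarrow> real^2) \<Rightarrow> real^2 \<Rightarrow> real^2^2" where
  "Def_classical a u x = (\<chi> i j. (1/2) * (pd i (\<lambda>y. u y $ j) x + pd j (\<lambda>y. u y $ i) x)
       - (\<Sum>k\<in>UNIV. christoffel a k i j x * u x $ k))"

definition weak_Def :: "real \<Rightarrow> (real^2 \<Rightarrow> real^2) \<Rightarrow> (real^2 \<Rightarrow> real^2^2) \<Rightarrow> bool" where
  "weak_Def a u T \<longleftrightarrow> (\<forall>\<phi>. test_fun \<phi> \<longrightarrow> (\<forall>i j.
      integral\<^sup>L (lebesgue_on Hdisk) (\<lambda>x. T x $ i $ j * \<phi> x) =
      integral\<^sup>L (lebesgue_on Hdisk) (\<lambda>x.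
          - (1/2) * (u x $ j * pd i \<phi> x + u x $ i * pd j \<phi> x)
          - (\<Sum>k\<in>UNIV. christoffel a k i j x * u x $ k) * \<phi> x)))"

definition codiff :: "real \<Rightarrow> (real^2 \<Rightarrow> real^2) \<Rightarrow> real^2 \<Rightarrow> real" where
  "codiff a u x = - (1 / voldens a x) *
     (\<Sum>i\<in>UNIV. pd i (\<lambda>y. voldens a y * (\<Sum>j\<in>UNIV. ginv a i j y * u y $ j)) x)"

definition weak_codiff :: "real \<Rightarrow> (real^2 \<Rightarrow> real^2) \<Rightarrow> (real^2 \<Rightarrow> real) \<Rightarrow> bool" where
  "weak_codiff a u w \<longleftrightarrow> (\<forall>\<phi>. test_fun \<phi> \<longrightarrow>
      hint a (\<lambda>x. w x * \<phi> x) = hint a (\<lambda>x. gform a x (u x) (dfun \<phi> x)))"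

definition laplace_beltrami :: "real \<Rightarrow> (real^2 \<Rightarrow> real) \<Rightarrow> real^2 \<Rightarrow> real" where
  "laplace_beltrami a F x = (1 / voldens a x) *
     (\<Sum>i\<in>UNIV. pd i (\<lambda>y. voldens a y * (\<Sum>j\<in>UNIV. ginv a i j y * pd j F y)) x)"

definition harmonic_H :: "real \<Rightarrow> (real^2 \<Rightarrow> real) \<Rightarrow> bool" where
  "harmonic_H a F \<longleftrightarrow> smooth_fun Hdisk F \<and> (\<forall>x\<in>Hdisk. laplace_beltrami a F x = 0)"

definition H1dist2 :: "real \<Rightarrow> (real^2 \<Rightarrow> real^2) \<Rightarrow> (real^2 \<Rightarrow> real^2) \<Rightarrow> (real^2 \<Rightarrow> real^2^2) \<Rightarrow> real" where
  "H1dist2 a \<theta> u T = L2norm2_form a (\<lambda>x. \<theta> x - u x)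
       + 2 * L2norm2_tens a (\<lambda>x. Def_classical a \<theta> x - T x)"

text \<open>H^1-closure (completion, realised inside L^2) of a set C of smooth compactly supported forms.\<close>
definition H1_closure :: "real \<Rightarrow> ((real^2 \<Rightarrow> real^2) \<Rightarrow> bool) \<Rightarrow> (real^2 \<Rightarrow> real^2) set" where
  "H1_closure a C = {u. L2_form a u \<and> (\<exists>T. weak_Def a u T \<and> L2_tens a T \<and>
       (\<exists>\<theta>. (\<forall>n. C (\<theta> n)) \<and> (\<lambda>n. H1dist2 a (\<theta> n) u T) \<longlonglongrightarrow> 0))}"

definition H10 :: "real \<Rightarrow> (real^2 \<Rightarrow> real^2) set" where
  "H10 a = H1_closure a cc_form"

definition Lambda_c_sigma :: "real \<Rightarrow> (real^2 \<Rightarrow> real^2) \<Rightarrow> bool" where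
  "Lambda_c_sigma a \<theta> \<longleftrightarrow> cc_form \<theta> \<and> (\<forall>x\<in>Hdisk. codiff a \<theta> x = 0)"

definition Vbold :: "real \<Rightarrow> (real^2 \<Rightarrow> real^2) set" where
  "Vbold a = H1_closure a (Lambda_c_sigma a)"

definition Fharm :: "real \<Rightarrow> (real^2 \<Rightarrow> real^2) set" where
  "Fharm a = {dfun F | F. harmonic_H a F \<and> L2_form a (dfun F)}"

definition Vbb :: "real \<Rightarrow> (real^2 \<Rightarrow> real^2) set" where
  "Vbb a = {(\<lambda>x. v x + w x) | v w. v \<in> Vbold a \<and> w \<in> Fharm a}"

definition Vtilde :: "real \<Rightarrow> (real^2 \<Rightarrow> real^2) set" where
  "Vtilde a = {u \<in> H10 a. weak_codiff a u (\<lambda>x. 0)}"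

end

(*
  In the Poincare disk the L2 inner product of 1-forms is the Euclidean one and d* vanishes exactly on
  Euclidean divergence-free fields, while Def u differs from the Euclidean symmetric gradient by a term
  of size |u| / (1 - |x|^2).  So the H1 norm is equivalent to the L2 norm of u plus the L2 norm of
  (1 - |x|^2) times the symmetric gradient of u.

  Given u in H10 with d* u = 0, let v be its L2 projection onto the closure of the rotated gradients of
  test functions.  The remainder w = u - v is weakly divergence-free and curl-free, hence by Weyl's lemma
  the gradient of a harmonic function, and Caccioppoli's inequality puts w in H10.  By the Hardy inequality
  on the disk, v is the rotated gradient of a stream function psi with psi / (1 - |x|^2) in L2, which is
  exactly what is needed to cut psi off at the boundary with an error that vanishes in the H1 norm;
  mollifying the truncations yields divergence-free test fields converging to v.
*)
theory Submission
  imports Defs "HOL-Complex_Analysis.Cauchy_Integral_Theorem" "HOL-Computational_Algebra.Polynomial"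
begin

section \<open>Calculus of partial derivatives\<close>

text \<open>The L2 projection \<open>v\<close> carries no derivatives of its own: its symmetric
  gradient is obtained by subtracting that of the harmonic remainder from that of \<open>u\<close>,
  so the remainder has to be regularised before anything is said about \<open>v\<close>. Even then
  only symmetrised derivatives of \<open>v\<close> are controlled, and the truncated field is
  therefore expanded so that derivatives of \<open>v\<close> occur only in the combination that the
  weak symmetric gradient provides. The critical term of the truncation is \<open>\<psi>\<close>
  times second derivatives of the cutoff, of size \<open>|\<psi>| / dl^2\<close> with
  \<open>dl x = 1 - |x|^2\<close>. One factor \<open>dl\<close> comes from the metric weight on
  2-tensors, the other from the Hardy inequality; together they leave a bounded multiple of an L2
  function supported ever closer to the boundary. Weyl's lemma rests on the independence of a
  mollified harmonic field from the mollification scale, so that a mollification with kernel inside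
  the disk already is the smooth representative. Since the spaces consist of functions and not of
  classes, the null set on which the remainder differs from a smooth gradient is finally moved into
  the component in \<open>Vbold\<close>.\<close>

lemma pd_eq:
  assumes "(f has_derivative D) (at x)"
  shows "pd i f x = D (axis i 1)"
proof -
  have "((\<lambda>t. x + t *\<^sub>R axis i 1) has_derivative (\<lambda>t. t *\<^sub>R axis i 1)) (at 0)"
    by (auto intro!: derivative_eq_intros)
  then have "((\<lambda>t. f (x + t *\<^sub>R axis i 1)) has_derivative (\<lambda>t. D (t *\<^sub>R axis i 1))) (at 0)"
    by (rule has_derivative_compose) (use assms in simp)
  moreover have "(\<lambda>t. D (t *\<^sub>R axis i 1)) = (*) (D (axis i 1))"
    using linear_scale[OF has_derivative_linear[OF assms]] by (auto simp: mult.commute)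
  ultimately show ?thesis
    unfolding pd_def by (intro DERIV_imp_deriv) (simp add: has_field_derivative_def)
qed

lemma has_derivative_pd:
  assumes "f differentiable (at x)"
  shows "(f has_derivative (\<lambda>h. \<Sum>i\<in>UNIV. pd i f x * h $ i)) (at x)"
proof -
  obtain D where D: "(f has_derivative D) (at x)"
    using assms by (auto simp: differentiable_def)
  have "D h = (\<Sum>i\<in>UNIV. pd i f x * h $ i)" for h
  proof -
    have "D h = D (\<Sum>i\<in>UNIV. h $ i *\<^sub>R axis i 1)"
      using basis_expansion[of h] by (simp add: scalar_mult_eq_scaleR)
    also have "\<dots> = (\<Sum>i\<in>UNIV. pd i f x * h $ i)"
      using has_derivative_linear[OF D]
      by (simp add: linear_sum linear_scale pd_eq[OF D] mult.commute)
    finally show ?thesis .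
  qed
  then have "D = (\<lambda>h. \<Sum>i\<in>UNIV. pd i f x * h $ i)" by (rule ext)
  then show ?thesis using D by simp
qed

lemma pd_line:
  assumes "f differentiable (at (x + t *\<^sub>R axis i 1))"
  shows "((\<lambda>t. f (x + t *\<^sub>R axis i 1)) has_real_derivative pd i f (x + t *\<^sub>R axis i 1)) (at t)"
proof -
  let ?y = "x + t *\<^sub>R axis i 1"
  obtain D where D: "(f has_derivative D) (at ?y)"
    using assms by (auto simp: differentiable_def)
  have "((\<lambda>t. x + t *\<^sub>R axis i 1) has_derivative (\<lambda>t. t *\<^sub>R axis i 1)) (at t)"
    by (auto intro!: derivative_eq_intros)
  then have "((\<lambda>t. f (x + t *\<^sub>R axis i 1)) has_derivative (\<lambda>t. D (t *\<^sub>R axis i 1))) (at t)"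
    by (rule has_derivative_compose) (use D in simp)
  moreover have "(\<lambda>t. D (t *\<^sub>R axis i 1)) = (*) (D (axis i 1))"
    using linear_scale[OF has_derivative_linear[OF D]] by (auto simp: mult.commute)
  ultimately show ?thesis
    unfolding pd_eq[OF D] by (simp add: has_field_derivative_def)
qed

text \<open>\<open>pd\<close> sees only the values on a short segment through the point. This
  permits formulas that are valid on \<open>Hdisk\<close> alone to be differentiated there, whatever
  happens outside.\<close>

lemma pd_cong:
  assumes "open S" "x \<in> S" "\<And>y. y \<in> S \<Longrightarrow> f y = g y"
  shows "pd i f x = pd i g x"
  unfolding pd_def
proof (rule deriv_cong_ev)
  have "open ((\<lambda>t. x + t *\<^sub>R axis i 1) -` S)"
    by (rule open_vimage[OF assms(1)]) (intro continuous_on_add continuous_on_scaleR continuous_on_const continuous_on_id)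
  then have "\<forall>\<^sub>F t in nhds 0. t \<in> (\<lambda>t. x + t *\<^sub>R axis i 1) -` S"
    by (rule eventually_nhds_in_open) (use assms(2) in simp)
  then show "\<forall>\<^sub>F t in nhds 0. f (x + t *\<^sub>R axis i 1) = g (x + t *\<^sub>R axis i 1)"
    by (rule eventually_mono) (simp add: assms(3))
qed simp

lemma differentiable_cong_open:
  assumes "open S" "x \<in> S" "\<And>y. y \<in> S \<Longrightarrow> f y = g y" "f differentiable (at x)"
  shows "g differentiable (at x)"
proof -
  obtain D where "(f has_derivative D) (at x)"
    using assms(4) by (auto simp: differentiable_def)
  then have "(g has_derivative D) (at x)"
    by (rule has_derivative_transform_within_open[OF _ assms(1-3)])
  then show ?thesis by (auto simp: differentiable_def)
qed

lemma pd_const [simp]: "pd i (\<lambda>x. c) x = 0"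
  by (simp add: pd_def)

lemma pd_add:
  assumes "f differentiable (at x)" "g differentiable (at x)"
  shows "pd i (\<lambda>x. f x + g x) x = pd i f x + pd i g x"
proof -
  obtain D E where "(f has_derivative D) (at x)" "(g has_derivative E) (at x)"
    using assms by (auto simp: differentiable_def)
  then show ?thesis
    using pd_eq[OF has_derivative_add, of f D x g E i] by (simp add: pd_eq)
qed

lemma pd_mult:
  assumes "f differentiable (at x)" "g differentiable (at x)"
  shows "pd i (\<lambda>x. f x * g x) x = f x * pd i g x + pd i f x * g x"
proof -
  obtain D E where "(f has_derivative D) (at x)" "(g has_derivative E) (at x)"
    using assms by (auto simp: differentiable_def)
  then show ?thesis
    using pd_eq[OF has_derivative_mult, of f D x g E i] by (simp add: pd_eq)
qed

lemma pd_cmult: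
  assumes "f differentiable (at x)"
  shows "pd i (\<lambda>x. c * f x) x = c * pd i f x"
  using pd_mult[of "\<lambda>_. c" x f i] assms by simp

lemma pd_minus:
  assumes "f differentiable (at x)"
  shows "pd i (\<lambda>x. - f x) x = - pd i f x"
  using pd_cmult[OF assms, of i "-1"] by simp

lemma pd_diff:
  assumes "f differentiable (at x)" "g differentiable (at x)"
  shows "pd i (\<lambda>x. f x - g x) x = pd i f x - pd i g x"
  using pd_add[of f x "\<lambda>x. - g x" i] assms by (simp add: pd_minus)

lemma pd_compose:
  assumes "f differentiable (at x)" "(b has_real_derivative b') (at (f x))"
  shows "pd i (\<lambda>x. b (f x)) x = b' * pd i f x" "(\<lambda>x. b (f x)) differentiable (at x)"
proof -
  obtain D where D: "(f has_derivative D) (at x)"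
    using assms by (auto simp: differentiable_def)
  have "((\<lambda>x. b (f x)) has_derivative (\<lambda>h. b' * D h)) (at x)"
    using has_derivative_compose[OF D, of b "(*) b'"] assms(2) by (simp add: has_field_derivative_def)
  then show "pd i (\<lambda>x. b (f x)) x = b' * pd i f x" "(\<lambda>x. b (f x)) differentiable (at x)"
    by (auto simp: pd_eq[OF D] pd_eq differentiable_def)
qed

lemma nth_differentiable [simp]: "(\<lambda>x::real^2. x $ i) differentiable (at x)"
  using bounded_linear_imp_has_derivative[OF bounded_linear_vec_nth] unfolding differentiable_def by blast

lemma pd_nth [simp]: "pd i (\<lambda>x. x $ j) x = (if i = j then 1 else 0)"
  using pd_eq[OF bounded_linear_imp_has_derivative[OF bounded_linear_vec_nth[of j]], where i = i]
  by (auto simp: axis_def)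

text \<open>Openness of \<open>S\<close> makes \<open>pd\<close> local, so the hypothesis passes to
  the partial derivatives and the induction closes. Every closure property below uses it to replace
  \<open>pd i\<close> of a composite by its formula, which is known on \<open>S\<close>
  only.\<close>

lemma Ck_on_cong:
  assumes "open S" "\<And>y. y \<in> S \<Longrightarrow> f y = g y" "Ck_on k S f"
  shows "Ck_on k S g"
  using assms(2,3)
proof (induction k arbitrary: f g)
  case 0
  then show ?case using continuous_on_cong[of S S f g] by simp
next
  case (Suc k)
  have "Ck_on k S (pd i g)" for i
  proof (rule Suc.IH)
    show "pd i f y = pd i g y" if "y \<in> S" for y
      by (rule pd_cong[OF assms(1) that Suc.prems(1)])
  qed (use Suc.prems(2) in simp)
  moreover have "g differentiable (at x)" if "x \<in> S" for x
    by (rule differentiable_cong_open[OF assms(1) that Suc.prems(1)]) (use Suc.prems(2) that in simp_all)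
  ultimately show ?case by simp
qed

lemma differentiable_continuous_on:
  "(\<And>x. x \<in> S \<Longrightarrow> f differentiable (at x)) \<Longrightarrow> continuous_on S f"
  by (meson continuous_at_imp_continuous_on differentiable_imp_continuous_within)

lemma Ck_on_decrease: "Ck_on (Suc k) S f \<Longrightarrow> Ck_on k S f"
proof (induction k arbitrary: f)
  case 0
  then show ?case by (auto intro: differentiable_continuous_on)
qed auto

lemma Ck_on_subset: "Ck_on k T f \<Longrightarrow> S \<subseteq> T \<Longrightarrow> Ck_on k S f"
  by (induction k arbitrary: f) (auto intro: continuous_on_subset)

lemma Ck_on_const: "Ck_on k S (\<lambda>x. c)"
proof (induction k arbitrary: c)
  case (Suc k)
  have "pd i (\<lambda>x. c) = (\<lambda>x. 0)" for i by auto
  then show ?case using Suc by auto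
qed auto

lemma Ck_on_add:
  assumes "open S" "Ck_on k S f" "Ck_on k S g"
  shows "Ck_on k S (\<lambda>x. f x + g x)"
  using assms(2,3)
proof (induction k arbitrary: f g)
  case 0
  then show ?case by (simp add: continuous_on_add)
next
  case (Suc k)
  have "Ck_on k S (pd i (\<lambda>x. f x + g x))" for i
  proof (rule Ck_on_cong[OF assms(1)])
    show "Ck_on k S (\<lambda>x. pd i f x + pd i g x)"
      using Suc by simp
  qed (use Suc.prems in \<open>simp add: pd_add\<close>)
  moreover have "(\<lambda>x. f x + g x) differentiable (at x)" if "x \<in> S" for x
    using Suc.prems that by (simp add: differentiable_add)
  ultimately show ?case by simp
qed

lemma Ck_on_mult:
  fixes f g :: "real^2 \<Rightarrow> real"
  assumes "open S" "Ck_on k S f" "Ck_on k S g"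
  shows "Ck_on k S (\<lambda>x. f x * g x)"
  using assms(2,3)
proof (induction k arbitrary: f g)
  case 0
  then show ?case by (simp add: continuous_on_mult)
next
  case (Suc k)
  have "Ck_on k S (pd i (\<lambda>x. f x * g x))" for i
  proof (rule Ck_on_cong[OF assms(1)])
    show "Ck_on k S (\<lambda>x. f x * pd i g x + pd i f x * g x)"
      using Suc.prems by (intro Ck_on_add[OF assms(1)] Suc.IH) (simp_all add: Ck_on_decrease)
  qed (use Suc.prems in \<open>simp add: pd_mult\<close>)
  moreover have "(\<lambda>x. f x * g x) differentiable (at x)" if "x \<in> S" for x
    using Suc.prems that by (simp add: differentiable_mult)
  ultimately show ?case by simp
qed

lemma Ck_on_nth: "Ck_on k S (\<lambda>x. x $ i)"
proof (cases k)
  case (Suc l)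
  have "pd j (\<lambda>x. x $ i) = (\<lambda>x. if j = i then 1 else 0)" for j by (rule ext) simp
  then show ?thesis using Suc by (simp add: Ck_on_const)
next
  case 0
  then show ?thesis by (simp add: continuous_on_component)
qed

lemma Ck_on_inverse:
  assumes "open S" "\<And>x. x \<in> S \<Longrightarrow> f x \<noteq> 0" "Ck_on k S f"
  shows "Ck_on k S (\<lambda>x. inverse (f x))"
  using assms(3)
proof (induction k)
  case (Suc k)
  have d: "((\<lambda>t. inverse t) has_real_derivative - (inverse (f x) * inverse (f x))) (at (f x))" if "x \<in> S" for x
    using that assms(2) by (auto intro!: derivative_eq_intros simp: power2_eq_square)
  have "Ck_on k S (pd i (\<lambda>x. inverse (f x)))" for i
  proof (rule Ck_on_cong[OF assms(1)])
    show "Ck_on k S (\<lambda>x. (-1) * (inverse (f x) * inverse (f x)) * pd i f x)"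
      using Suc.prems by (intro Ck_on_mult[OF assms(1)] Ck_on_const Suc.IH) (simp_all add: Ck_on_decrease)
    show "- 1 * (inverse (f x) * inverse (f x)) * pd i f x = pd i (\<lambda>x. inverse (f x)) x" if "x \<in> S" for x
      using pd_compose(1)[where f = f and b = inverse, OF _ d[OF that]] Suc.prems that by simp
  qed
  moreover have "(\<lambda>x. inverse (f x)) differentiable (at x)" if "x \<in> S" for x
    using pd_compose(2)[where f = f and b = inverse, OF _ d[OF that]] Suc.prems that by simp
  ultimately show ?case by simp
qed (use assms(2) in \<open>simp add: continuous_on_inverse\<close>)

text \<open>Differentiability and continuity are local on open sets. This is the gluing principle
  behind the extension by zero of test functions, the removal of the singularity of
  \<open>rad_diff\<close> at the origin and the smoothness of \<open>W\<close>.\<close>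

lemma Ck_on_Union: "(\<And>T. T \<in> \<T> \<Longrightarrow> open T \<and> Ck_on k T f) \<Longrightarrow> Ck_on k (\<Union>\<T>) f"
proof (induction k arbitrary: f)
  case 0
  then show ?case by (auto intro: continuous_on_open_Union)
qed auto

section \<open>Closure properties of smooth functions\<close>

lemma smooth_fun_cong:
  assumes "open S" "\<And>y. y \<in> S \<Longrightarrow> f y = g y" "smooth_fun S f"
  shows "smooth_fun S g"
  unfolding smooth_fun_def
proof
  show "Ck_on k S g" for k
    by (rule Ck_on_cong[OF assms(1,2)]) (use assms(3) in \<open>auto simp: smooth_fun_def\<close>)
qed

lemma smooth_fun_SucD: "smooth_fun S f \<Longrightarrow> Ck_on (Suc k) S f"
  unfolding smooth_fun_def by (rule spec)

lemma smooth_fun_pd: "smooth_fun S f \<Longrightarrow> smooth_fun S (pd i f)"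
  unfolding smooth_fun_def[of S "pd i f"] using smooth_fun_SucD[of S f] by simp

lemma smooth_fun_differentiable: "smooth_fun S f \<Longrightarrow> x \<in> S \<Longrightarrow> f differentiable (at x)"
  using smooth_fun_SucD[of S f 0] by simp

lemma smooth_fun_continuous: "smooth_fun S f \<Longrightarrow> continuous_on S f"
  unfolding smooth_fun_def by (drule spec[of _ 0]) simp

lemma smooth_fun_I:
  assumes "\<And>x. x \<in> S \<Longrightarrow> f differentiable (at x)" "\<And>i. smooth_fun S (pd i f)"
  shows "smooth_fun S f"
  unfolding smooth_fun_def
proof
  show "Ck_on k S f" for k
    by (rule Ck_on_decrease) (use assms in \<open>simp add: smooth_fun_def\<close>)
qed

lemma smooth_fun_subset: "smooth_fun T f \<Longrightarrow> S \<subseteq> T \<Longrightarrow> smooth_fun S f"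
  unfolding smooth_fun_def by (rule allI, rule Ck_on_subset[of _ T]) simp_all

lemma smooth_fun_const: "smooth_fun S (\<lambda>x. c)"
  unfolding smooth_fun_def by (simp add: Ck_on_const)

lemma smooth_fun_nth: "smooth_fun S (\<lambda>x. x $ i)"
  unfolding smooth_fun_def by (simp add: Ck_on_nth)

lemma smooth_fun_add: "open S \<Longrightarrow> smooth_fun S f \<Longrightarrow> smooth_fun S g \<Longrightarrow> smooth_fun S (\<lambda>x. f x + g x)"
  unfolding smooth_fun_def by (simp add: Ck_on_add)

lemma smooth_fun_mult: "open S \<Longrightarrow> smooth_fun S f \<Longrightarrow> smooth_fun S g \<Longrightarrow> smooth_fun S (\<lambda>x. f x * g x)"
  unfolding smooth_fun_def by (simp add: Ck_on_mult)

lemma smooth_fun_minus: "open S \<Longrightarrow> smooth_fun S f \<Longrightarrow> smooth_fun S (\<lambda>x. - f x)"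
  using smooth_fun_mult[of S "\<lambda>_. -1" f] by (simp add: smooth_fun_const)

lemma smooth_fun_diff: "open S \<Longrightarrow> smooth_fun S f \<Longrightarrow> smooth_fun S g \<Longrightarrow> smooth_fun S (\<lambda>x. f x - g x)"
  using smooth_fun_add[of S f "\<lambda>x. - g x"] by (simp add: smooth_fun_minus)

lemma smooth_fun_inverse:
  "open S \<Longrightarrow> (\<And>x. x \<in> S \<Longrightarrow> f x \<noteq> 0) \<Longrightarrow> smooth_fun S f \<Longrightarrow> smooth_fun S (\<lambda>x. inverse (f x))"
  unfolding smooth_fun_def by (simp add: Ck_on_inverse)

lemma smooth_fun_Union:
  assumes "\<And>T. T \<in> \<T> \<Longrightarrow> open T \<and> smooth_fun T f"
  shows "smooth_fun (\<Union>\<T>) f"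
  using assms unfolding smooth_fun_def by (intro allI Ck_on_Union) simp

lemma smooth_fun_Un: "open S \<Longrightarrow> open T \<Longrightarrow> smooth_fun S f \<Longrightarrow> smooth_fun T f \<Longrightarrow> smooth_fun (S \<union> T) f"
  using smooth_fun_Union[of "{S, T}" f] by auto

lemma norm_sq_vec2: "(norm (x::real^2))\<^sup>2 = x $ 1 * x $ 1 + x $ 2 * x $ 2"
  by (simp add: norm_vec_def L2_set_def sum_2 power2_eq_square)

lemma smooth_fun_norm_sq: "open S \<Longrightarrow> smooth_fun S (\<lambda>x. (norm x)\<^sup>2)"
  unfolding norm_sq_vec2 by (intro smooth_fun_add smooth_fun_mult smooth_fun_nth)

lemma pd_norm_sq: "pd i (\<lambda>x. (norm x)\<^sup>2) x = 2 * x $ i"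
  unfolding norm_sq_vec2
  using exhaust_2[of i] by (elim disjE) (simp_all add: pd_add pd_mult differentiable_mult)

lemma pd_reflect:
  assumes "f differentiable (at (x - y))"
  shows "pd i (\<lambda>y. f (x - y)) y = - pd i f (x - y)" "(\<lambda>y. f (x - y)) differentiable (at y)"
proof -
  obtain D where D: "(f has_derivative D) (at (x - y))"
    using assms by (auto simp: differentiable_def)
  have "((\<lambda>y. f (x - y)) has_derivative (\<lambda>h. D (- h))) (at y)"
    by (rule has_derivative_compose[where g = f and f = "\<lambda>y. x - y", OF _ D]) (auto intro!: derivative_eq_intros)
  then show "pd i (\<lambda>y. f (x - y)) y = - pd i f (x - y)" "(\<lambda>y. f (x - y)) differentiable (at y)"
    using linear_neg[OF has_derivative_linear[OF D]]
    by (auto simp: pd_eq[OF D] pd_eq differentiable_def)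
qed

lemma smooth_fun_reflect:
  assumes "smooth_fun UNIV f"
  shows "smooth_fun UNIV (\<lambda>y. f (x - y))"
proof -
  have "Ck_on k UNIV (\<lambda>y. f (x - y))" if "Ck_on k UNIV f" for k f
    using that
  proof (induction k arbitrary: f)
    case 0
    then show ?case by (auto intro!: continuous_on_compose2[of UNIV f] continuous_on_op_minus continuous_on_add continuous_on_mult_left continuous_on_id)
  next
    case (Suc k)
    have "Ck_on k UNIV (pd i (\<lambda>y. f (x - y)))" for i
    proof (rule Ck_on_cong[OF open_UNIV])
      show "Ck_on k UNIV (\<lambda>y. (-1) * pd i f (x - y))"
        using Suc by (intro Ck_on_mult Ck_on_const) auto
    qed (use Suc.prems in \<open>auto simp: pd_reflect\<close>)
    then show ?case using Suc.prems by (auto simp: pd_reflect)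
  qed
  then show ?thesis using assms by (auto simp: smooth_fun_def)
qed

text \<open>The mean value theorem is used twice, in direction \<open>i\<close> for the difference
  of two translates and then in direction \<open>j\<close> for the resulting difference of
  \<open>pd i f\<close>. The second difference is symmetric in \<open>i\<close> and
  \<open>j\<close>, the right-hand side is not; that is the source of
  \<open>pd_commute\<close>.\<close>

lemma second_difference_eq_pd:
  fixes f :: "real^2 \<Rightarrow> real"
  assumes h: "h > 0" "cball x (2 * h) \<subseteq> S"
    and f: "\<And>y. y \<in> S \<Longrightarrow> f differentiable (at y)" "\<And>y. y \<in> S \<Longrightarrow> pd i f differentiable (at y)"
  obtains y where "y \<in> cball x (2 * h)"
    "f (x + h *\<^sub>R axis j 1 + h *\<^sub>R axis i 1) - f (x + h *\<^sub>R axis i 1) - f (x + h *\<^sub>R axis j 1) + f x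
       = h * (h * pd j (pd i f) y)"
proof -
  have mem: "x + t *\<^sub>R axis j 1 + s *\<^sub>R axis i 1 \<in> cball x (2 * h)" if "0 \<le> t" "t \<le> h" "0 \<le> s" "s \<le> h" for s t
  proof -
    have "norm (t *\<^sub>R axis j 1 + s *\<^sub>R axis i (1::real)) \<le> norm (t *\<^sub>R axis j (1::real)) + norm (s *\<^sub>R axis i (1::real))"
      by (rule norm_triangle_ineq)
    also have "\<dots> \<le> 2 * h" using that by (simp add: norm_axis_1)
    finally show ?thesis
      unfolding mem_cball dist_norm add.assoc
      by (metis add_diff_cancel_left' norm_minus_commute)
  qed
  then have memS: "x + t *\<^sub>R axis j 1 + s *\<^sub>R axis i 1 \<in> S" if "0 \<le> t" "t \<le> h" "0 \<le> s" "s \<le> h" for s t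
    using that h(2) by blast
  let ?g = "\<lambda>s. f ((x + h *\<^sub>R axis j 1) + s *\<^sub>R axis i 1) - f (x + s *\<^sub>R axis i 1)"
  have "\<exists>s. 0 < s \<and> s < h \<and> ?g h - ?g 0 = (h - 0) *
     (pd i f ((x + h *\<^sub>R axis j 1) + s *\<^sub>R axis i 1) - pd i f (x + s *\<^sub>R axis i 1))"
    by (rule MVT2[OF h(1)], rule DERIV_diff; rule pd_line; rule f)
      (use memS[of h] memS[of 0] h(1) in \<open>simp_all\<close>)
  then obtain s where s: "0 < s" "s < h" and gs: "?g h - ?g 0 = h *
     (pd i f ((x + h *\<^sub>R axis j 1) + s *\<^sub>R axis i 1) - pd i f (x + s *\<^sub>R axis i 1))" by auto
  let ?k = "\<lambda>t. pd i f ((x + s *\<^sub>R axis i 1) + t *\<^sub>R axis j 1)"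
  have "\<exists>t. 0 < t \<and> t < h \<and> ?k h - ?k 0 = (h - 0) * pd j (pd i f) ((x + s *\<^sub>R axis i 1) + t *\<^sub>R axis j 1)"
    by (rule MVT2[OF h(1)], rule pd_line; rule f)
      (use memS[of _ s] s in \<open>simp add: add_ac\<close>)
  then obtain t where t: "0 < t" "t < h"
    and kt: "?k h - ?k 0 = h * pd j (pd i f) ((x + s *\<^sub>R axis i 1) + t *\<^sub>R axis j 1)" by auto
  show thesis
  proof (rule that)
    show "(x + s *\<^sub>R axis i 1) + t *\<^sub>R axis j 1 \<in> cball x (2 * h)"
      using mem[of t s] s t by (simp add: add_ac)
    have "?g h - ?g 0 = h * (?k h - ?k 0)"
      using gs by (simp add: add_ac)
    then show "f (x + h *\<^sub>R axis j 1 + h *\<^sub>R axis i 1) - f (x + h *\<^sub>R axis i 1) - f (x + h *\<^sub>R axis j 1) + f x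
       = h * (h * pd j (pd i f) ((x + s *\<^sub>R axis i 1) + t *\<^sub>R axis j 1))"
      unfolding kt by simp
  qed
qed

text \<open>Both mixed derivatives, each at some point near \<open>x\<close>, equal the same second
  difference divided by \<open>h^2\<close>. By continuity they are each within \<open>e\<close>,
  half of the supposed gap, of their values at \<open>x\<close>.\<close>

lemma pd_commute:
  assumes S: "open S" "x \<in> S" and f: "Ck_on 2 S f"
  shows "pd i (pd j f) x = pd j (pd i f) x"
proof (rule ccontr)
  assume ne: "pd i (pd j f) x \<noteq> pd j (pd i f) x"
  define e where "e = \<bar>pd i (pd j f) x - pd j (pd i f) x\<bar> / 2"
  have e: "e > 0" using ne by (simp add: e_def)
  have d: "\<And>y. y \<in> S \<Longrightarrow> f differentiable (at y)" "\<And>y k. y \<in> S \<Longrightarrow> pd k f differentiable (at y)"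
    and c: "\<And>k l. continuous_on S (pd k (pd l f))"
    using f by (simp_all add: numeral_2_eq_2)
  have "\<exists>d>0. \<forall>y. dist y x < d \<longrightarrow> dist (pd k (pd l f) y) (pd k (pd l f) x) < e" for k l
  proof -
    have "continuous (at x) (pd k (pd l f))"
      using c[of k l] S continuous_on_eq_continuous_at[OF S(1)] by blast
    then show ?thesis using e unfolding continuous_at_eps_delta by simp
  qed
  then obtain d1 d2 where d1: "d1 > 0" "\<And>y. dist y x < d1 \<Longrightarrow> dist (pd i (pd j f) y) (pd i (pd j f) x) < e"
    and d2: "d2 > 0" "\<And>y. dist y x < d2 \<Longrightarrow> dist (pd j (pd i f) y) (pd j (pd i f) x) < e"
    by meson
  obtain r where r: "r > 0" "cball x r \<subseteq> S"
    using S open_contains_cball by blast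
  \<comment> \<open>A third of the radii, because the intermediate points range over the ball of
    radius \<open>2 * h\<close>.\<close>
  define h where "h = min r (min d1 d2) / 3"
  have h: "h > 0" "2 * h < d1" "2 * h < d2" "cball x (2 * h) \<subseteq> S"
    using r d1(1) d2(1) by (auto simp: h_def)
  obtain y where y: "y \<in> cball x (2 * h)"
    "f (x + h *\<^sub>R axis j 1 + h *\<^sub>R axis i 1) - f (x + h *\<^sub>R axis i 1) - f (x + h *\<^sub>R axis j 1) + f x
       = h * (h * pd j (pd i f) y)"
    using second_difference_eq_pd[OF h(1,4) d] by blast
  obtain z where z: "z \<in> cball x (2 * h)"
    "f (x + h *\<^sub>R axis i 1 + h *\<^sub>R axis j 1) - f (x + h *\<^sub>R axis j 1) - f (x + h *\<^sub>R axis i 1) + f x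
       = h * (h * pd i (pd j f) z)"
    using second_difference_eq_pd[OF h(1,4) d] by blast
  have swap: "x + h *\<^sub>R axis i 1 + h *\<^sub>R axis j 1 = x + h *\<^sub>R axis j 1 + h *\<^sub>R axis i 1"
    by (simp add: add_ac)
  have "h * (h * pd j (pd i f) y) = h * (h * pd i (pd j f) z)"
    unfolding y(2)[symmetric] z(2)[symmetric] swap by simp
  then have "pd j (pd i f) y = pd i (pd j f) z" using h(1) by simp
  moreover have "dist (pd j (pd i f) y) (pd j (pd i f) x) < e"
    by (rule d2) (use y(1) h in \<open>simp add: dist_commute\<close>)
  moreover have "dist (pd i (pd j f) z) (pd i (pd j f) x) < e"
    by (rule d1) (use z(1) h in \<open>simp add: dist_commute\<close>)
  ultimately show False by (simp add: dist_real_def e_def abs_if split: if_splits)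
qed

lemma smooth_fun_pd_commute:
  "open S \<Longrightarrow> x \<in> S \<Longrightarrow> smooth_fun S f \<Longrightarrow> pd i (pd j f) x = pd j (pd i f) x"
  unfolding smooth_fun_def by (rule pd_commute) blast+

subsection \<open>Smooth functions of one variable\<close>

text \<open>The derivative is an existential witness, so closed-form derivatives such as those of
  \<open>exp_poly\<close> and \<open>step\<close> can be supplied directly.\<close>

fun C1 :: "nat \<Rightarrow> (real \<Rightarrow> real) \<Rightarrow> bool" where
  "C1 0 f = continuous_on UNIV f"
| "C1 (Suc k) f = (\<exists>f'. (\<forall>t. (f has_real_derivative f' t) (at t)) \<and> C1 k f')"

lemma C1_decrease: "C1 (Suc k) f \<Longrightarrow> C1 k f"
proof (induction k arbitrary: f)
  case 0
  then show ?case using DERIV_continuous_on by (metis C1.simps has_field_derivative_at_within)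
next
  case (Suc k)
  then obtain f' where "\<And>t. (f has_real_derivative f' t) (at t)" "C1 (Suc k) f'"
    unfolding C1.simps(2)[of "Suc k"] by blast
  then show ?case using Suc.IH unfolding C1.simps(2)[of k] by blast
qed

lemma C1_const: "C1 k (\<lambda>t. c)"
proof (induction k arbitrary: c)
  case (Suc k)
  show ?case
    unfolding C1.simps by (rule exI[of _ "\<lambda>t. 0"]) (use Suc in simp)
qed simp

lemma C1_add: "C1 k f \<Longrightarrow> C1 k g \<Longrightarrow> C1 k (\<lambda>t. f t + g t)"
proof (induction k arbitrary: f g)
  case 0
  then show ?case by (simp add: continuous_on_add)
next
  case (Suc k)
  then obtain f' g' where d: "\<And>t. (f has_real_derivative f' t) (at t)" "\<And>t. (g has_real_derivative g' t) (at t)"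
    and c: "C1 k f'" "C1 k g'" by (meson C1.simps(2))
  show ?case
    unfolding C1.simps
    by (rule exI[of _ "\<lambda>t. f' t + g' t"]) (use Suc.IH c d in \<open>simp add: DERIV_add\<close>)
qed

lemma C1_mult: "C1 k f \<Longrightarrow> C1 k g \<Longrightarrow> C1 k (\<lambda>t. f t * g t)"
proof (induction k arbitrary: f g)
  case 0
  then show ?case by (simp add: continuous_on_mult)
next
  case (Suc k)
  then obtain f' g' where d: "\<And>t. (f has_real_derivative f' t) (at t)" "\<And>t. (g has_real_derivative g' t) (at t)"
    and c: "C1 k f'" "C1 k g'" by (meson C1.simps(2))
  have "C1 k (\<lambda>t. f t * g' t + f' t * g t)"
    using Suc c C1_decrease by (intro C1_add Suc.IH) auto
  moreover have "((\<lambda>t. f t * g t) has_real_derivative f t * g' t + f' t * g t) (at t)" for t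
    using DERIV_mult[OF d(1)[of t] d(2)[of t]] by (simp add: add.commute mult.commute)
  ultimately show ?case
    unfolding C1.simps by (intro exI[of _ "\<lambda>t. f t * g' t + f' t * g t"] conjI allI)
qed

lemma C1_affine: "C1 k f \<Longrightarrow> C1 k (\<lambda>t. f (p * t + q))"
proof (induction k arbitrary: f)
  case 0
  then show ?case by (auto intro!: continuous_on_compose2[of UNIV f] continuous_on_op_minus continuous_on_add continuous_on_mult_left continuous_on_id)
next
  case (Suc k)
  then obtain f' where d: "\<And>t. (f has_real_derivative f' t) (at t)"
    and c: "C1 k f'" by (meson C1.simps(2))
  have "C1 k (\<lambda>t. f' (p * t + q) * p)"
    using Suc.IH c by (intro C1_mult C1_const) auto
  moreover have "((\<lambda>t. f (p * t + q)) has_real_derivative f' (p * t + q) * p) (at t)" for t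
    by (rule DERIV_chain2[OF d]) (auto intro!: derivative_eq_intros)
  ultimately show ?case
    unfolding C1.simps by (intro exI[of _ "\<lambda>t. f' (p * t + q) * p"] conjI allI)
qed

lemma Ck_on_compose:
  assumes "open S"
  shows "C1 k b \<Longrightarrow> Ck_on k S f \<Longrightarrow> Ck_on k S (\<lambda>x. b (f x))"
proof (induction k arbitrary: b)
  case 0
  then show ?case using continuous_on_compose2[of UNIV b S f] by simp
next
  case (Suc k)
  from Suc.prems(1) obtain b' where d: "\<And>t. (b has_real_derivative b' t) (at t)"
    and c: "C1 k b'"
    unfolding C1.simps by blast
  have "Ck_on k S (pd i (\<lambda>x. b (f x)))" for i
  proof (rule Ck_on_cong[OF assms])
    show "Ck_on k S (\<lambda>x. b' (f x) * pd i f x)"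
      by (rule Ck_on_mult[OF assms Suc.IH[OF c Ck_on_decrease[OF Suc.prems(2)]]]) (use Suc.prems(2) in simp)
  qed (use Suc.prems(2) pd_compose(1)[where f = f and b = b, OF _ d] in simp)
  then show ?case using Suc.prems(2) pd_compose(2)[where f = f and b = b, OF _ d] by simp
qed

lemma smooth_fun_compose:
  "open S \<Longrightarrow> (\<And>k. C1 k b) \<Longrightarrow> smooth_fun S f \<Longrightarrow> smooth_fun S (\<lambda>x. b (f x))"
  unfolding smooth_fun_def by (rule allI, rule Ck_on_compose) simp_all

section \<open>Bump functions\<close>

text \<open>The classical flat function is the case \<open>p = 1\<close>. The polynomial parameter
  makes the family closed under differentiation, so one derivative formula gives smoothness of every
  order.\<close>

definition exp_poly :: "real poly \<Rightarrow> real \<Rightarrow> real" where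
  "exp_poly p t = (if t > 0 then poly p (inverse t) * exp (- inverse t) else 0)"

lemma poly_times_exp_tendsto_0: "((\<lambda>y. poly p y * exp (- y :: real)) \<longlongrightarrow> 0) at_top"
proof -
  have "((\<lambda>y. \<Sum>i\<le>degree p. coeff p i * (y ^ i / exp y)) \<longlongrightarrow> (\<Sum>i\<le>degree p. coeff p i * 0)) at_top"
    by (intro tendsto_sum tendsto_mult tendsto_const tendsto_power_div_exp_0)
  moreover have "(\<lambda>y. \<Sum>i\<le>degree p. coeff p i * (y ^ i / exp y)) = (\<lambda>y. poly p y * exp (- y))"
    by (simp add: poly_altdef sum_distrib_right exp_minus divide_inverse mult.assoc)
  ultimately show ?thesis by simp
qed

text \<open>With \<open>y = 1/t\<close> one has \<open>dy/dt = - y^2\<close>, so the derivative of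
  \<open>p(y) exp(-y)\<close> is \<open>y^2 (p(y) - p'(y)) exp(-y)\<close>; the polynomial
  \<open>[:0, 0, 1:]\<close> is \<open>y^2\<close>.\<close>

lemma exp_poly_has_derivative:
  "(exp_poly p has_real_derivative exp_poly ([:0, 0, 1:] * (p - pderiv p)) t) (at t)"
proof -
  consider "t > 0" | "t = 0" | "t < 0" by linarith
  then show ?thesis
  proof cases
    case 1
    have "((\<lambda>t. poly p (inverse t) * exp (- inverse t)) has_real_derivative
       exp_poly ([:0, 0, 1:] * (p - pderiv p)) t) (at t)"
      using 1 by (auto intro!: derivative_eq_intros DERIV_chain2[OF poly_DERIV]
        simp: exp_poly_def algebra_simps power2_eq_square)
    then show ?thesis
      by (rule has_field_derivative_transform_within_open[of _ _ _ "{0<..}"]) (use 1 in \<open>auto simp: exp_poly_def\<close>)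
  next
    case 3
    have "((\<lambda>t. 0) has_real_derivative exp_poly ([:0, 0, 1:] * (p - pderiv p)) t) (at t)"
      using 3 by (simp add: exp_poly_def)
    then show ?thesis
      by (rule has_field_derivative_transform_within_open[of _ _ _ "{..<0}"]) (use 3 in \<open>auto simp: exp_poly_def\<close>)
  next
    case 2
    have "((\<lambda>h. exp_poly p h / h) \<longlongrightarrow> 0) (at_right 0)"
    proof (rule Lim_transform_eventually)
      \<comment> \<open>Dividing by \<open>h\<close> multiplies by \<open>y = 1/h\<close>, which is
        what \<open>pCons 0\<close> does to the polynomial; the exponential still wins as
        \<open>y\<close> tends to infinity.\<close>
      show "((\<lambda>h. poly (pCons 0 p) (inverse h) * exp (- inverse h)) \<longlongrightarrow> 0) (at_right 0)"
        by (rule filterlim_compose[OF poly_times_exp_tendsto_0 filterlim_inverse_at_top_right])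
      show "\<forall>\<^sub>F h in at_right 0. poly (pCons 0 p) (inverse h) * exp (- inverse h) = exp_poly p h / h"
        by (auto simp: eventually_at_filter exp_poly_def field_simps)
    qed
    moreover have "((\<lambda>h. exp_poly p h / h) \<longlongrightarrow> 0) (at_left 0)"
      by (rule Lim_transform_eventually[OF tendsto_const]) (auto simp: eventually_at_filter exp_poly_def)
    ultimately have "((\<lambda>h. exp_poly p h / h) \<longlongrightarrow> 0) (at 0)"
      by (simp add: filterlim_split_at)
    then show ?thesis
      using 2 by (simp add: DERIV_def exp_poly_def)
  qed
qed

lemma C1_exp_poly: "C1 k (exp_poly p)"
proof (induction k arbitrary: p)
  case 0
  then show ?case
    using DERIV_continuous_on[of UNIV "exp_poly p"] exp_poly_has_derivative
    by (metis C1.simps(1) has_field_derivative_at_within)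
next
  case (Suc k)
  show ?case
    unfolding C1.simps
    by (intro exI[of _ "exp_poly ([:0, 0, 1:] * (p - pderiv p))"] conjI allI exp_poly_has_derivative Suc)
qed

text \<open>Supported in \<open>[1, 2]\<close> rather than near \<open>0\<close>, so that the mollifiers built from it vanish near the origin.\<close>

definition kappa :: "real \<Rightarrow> real" where
  "kappa t = exp_poly 1 (t - 1) * exp_poly 1 (2 - t)"

lemma C1_kappa: "C1 k kappa"
  unfolding kappa_def
  using C1_mult[OF C1_affine[OF C1_exp_poly, of k 1 1 "-1"] C1_affine[OF C1_exp_poly, of k 1 "-1" 2]]
  by simp

lemma continuous_kappa: "continuous_on S kappa"
  using C1_kappa[of 0] by (auto intro: continuous_on_subset)

lemma kappa_nonneg: "kappa t \<ge> 0"
  by (simp add: kappa_def exp_poly_def)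

lemma kappa_eq_0: "t \<le> 1 \<or> t \<ge> 2 \<Longrightarrow> kappa t = 0"
  by (auto simp: kappa_def exp_poly_def)

lemma kappa_pos: "1 < t \<Longrightarrow> t < 2 \<Longrightarrow> kappa t > 0"
  by (simp add: kappa_def exp_poly_def)

lemma integral_kappa_pos: "integral {0..2} kappa > 0"
proof -
  have "integral {0..2} kappa \<noteq> 0"
  proof
    assume "integral {0..2} kappa = 0"
    then have "\<forall>t\<in>{0..2}. kappa t = 0"
      using integral_eq_0_iff[OF continuous_kappa, of 0 2] kappa_nonneg by simp
    then show False using kappa_pos[of "3/2"] by force
  qed
  moreover have "integral {0..2} kappa \<ge> 0"
    by (rule Henstock_Kurzweil_Integration.integral_nonneg)
      (auto intro: integrable_continuous_real continuous_kappa kappa_nonneg)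
  ultimately show ?thesis by simp
qed

text \<open>A smooth transition from 0 on \<open>t \<le> 1\<close> to 1 on \<open>t \<ge> 2\<close>.
  It serves twice: its derivative is the mollifier profile, and composed with multiples of
  \<open>dl\<close> it gives the boundary cutoffs.\<close>

definition step :: "real \<Rightarrow> real" where
  "step t = integral {0..t} kappa / integral {0..2} kappa"

definition dstep :: "real \<Rightarrow> real" where
  "dstep t = kappa t / integral {0..2} kappa"

lemma step_le_1: "t \<le> 1 \<Longrightarrow> step t = 0"
proof -
  assume "t \<le> 1"
  then have "integral {0..t} kappa = integral {0..t} (\<lambda>_. 0)"
    by (intro Henstock_Kurzweil_Integration.integral_cong) (auto intro: kappa_eq_0)
  then show ?thesis by (simp add: step_def)
qed

lemma step_ge_2: assumes "t \<ge> 2" shows "step t = 1"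
proof -
  have "integral {0..2} kappa + integral {2..t} kappa = integral {0..t} kappa"
    using assms
    by (intro Henstock_Kurzweil_Integration.integral_combine integrable_continuous_real continuous_kappa) auto
  moreover have "integral {2..t} kappa = integral {2..t} (\<lambda>_. 0)"
    by (intro Henstock_Kurzweil_Integration.integral_cong) (auto intro: kappa_eq_0)
  ultimately show ?thesis using integral_kappa_pos by (simp add: step_def)
qed

lemma step_has_derivative: "(step has_real_derivative dstep t) (at t)"
\<comment> \<open>For negative \<open>t\<close> the interval \<open>{0..t}\<close> is empty, so the
  fundamental theorem is invoked only for \<open>t \<ge> 1\<close>, where \<open>t\<close> is
  interior to \<open>{0..t + 1}\<close>.\<close>
proof (cases "t < 1")
  case True
  have "((\<lambda>t. 0) has_real_derivative dstep t) (at t)"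
    using True by (simp add: dstep_def kappa_eq_0)
  then show ?thesis
    by (rule has_field_derivative_transform_within_open[of _ _ _ "{..<1}"]) (use True in \<open>auto simp: step_le_1\<close>)
next
  case False
  have "((\<lambda>u. integral {0..u} kappa) has_real_derivative kappa t) (at t within {0..t + 1})"
    by (rule integral_has_real_derivative[OF continuous_kappa]) (use False in auto)
  moreover have "at t within {0..t + 1} = at t"
    by (rule at_within_interior) (use False in auto)
  ultimately show ?thesis
    unfolding step_def dstep_def by (auto intro: DERIV_cdivide)
qed

lemma C1_dstep: "C1 k dstep"
  using C1_mult[OF C1_kappa C1_const, of k "inverse (integral {0..2} kappa)"]
  by (simp add: dstep_def[abs_def] divide_inverse)

lemma C1_step: "C1 k step"
  by (rule C1_decrease, unfold C1.simps, intro exI[of _ dstep] conjI allI step_has_derivative C1_dstep)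

lemma dstep_nonneg: "dstep t \<ge> 0"
  by (simp add: dstep_def kappa_nonneg integral_kappa_pos less_imp_le)

lemma dstep_eq_0: "t \<le> 1 \<or> t \<ge> 2 \<Longrightarrow> dstep t = 0"
  by (simp add: dstep_def kappa_eq_0)

lemma dstep_pos: "1 < t \<Longrightarrow> t < 2 \<Longrightarrow> dstep t > 0"
  by (simp add: dstep_def kappa_pos integral_kappa_pos)

lemma step_mono: "s \<le> t \<Longrightarrow> step s \<le> step t"
  by (rule DERIV_nonneg_imp_nondecreasing[of s t step]) (use step_has_derivative dstep_nonneg in blast)+

lemma step_bounds: "0 \<le> step t" "step t \<le> 1"
proof -
  show "0 \<le> step t"
    using step_mono[of 0 t] step_le_1[of 0] step_le_1[of t] by (cases "t \<ge> 0") auto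
  show "step t \<le> 1"
    using step_mono[of t 2] step_ge_2[of 2] step_ge_2[of t] by (cases "t \<le> 2") auto
qed

text \<open>Continuous functions that vanish outside \<open>{1..2}\<close> are bounded. The common
  bound \<open>B\<close> becomes the scale-invariant bound on the derivatives of the cutoffs
  \<open>chi n\<close>.\<close>

lemma step_second_derivative:
  obtains ddstep B where "\<And>t. (dstep has_real_derivative ddstep t) (at t)" "\<And>k. C1 k ddstep"
    "\<And>t. \<bar>dstep t\<bar> \<le> B" "\<And>t. \<bar>ddstep t\<bar> \<le> B" "\<And>t. t < 1 \<or> t > 2 \<Longrightarrow> ddstep t = 0"
proof -
  define dd where "dd t = deriv dstep t" for t
  obtain d' where d': "\<And>t. (dstep has_real_derivative d' t) (at t)"
    using C1_dstep[of "Suc 0"] by auto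
  have dd: "(dstep has_real_derivative dd t) (at t)" for t
    using d' DERIV_imp_deriv dd_def by metis
  have C: "C1 k dd" for k
  proof -
    obtain e where e: "\<And>t. (dstep has_real_derivative e t) (at t)" "C1 k e"
      using C1_dstep[of "Suc k"] unfolding C1.simps by blast
    have "dd = e" using DERIV_unique[OF dd e(1)] by (rule ext)
    then show ?thesis using e(2) by simp
  qed
  have z: "dd t = 0" if "t < 1 \<or> t > 2" for t
  proof -
    have "((\<lambda>t. 0) has_real_derivative 0) (at t)" by simp
    then have "(dstep has_real_derivative 0) (at t)"
      by (rule has_field_derivative_transform_within_open[of _ _ _ "{..<1} \<union> {2<..}"])
        (use that in \<open>auto simp: dstep_eq_0\<close>)
    then show ?thesis using DERIV_unique[OF dd] by blast
  qed
  have bd: "\<exists>B. \<forall>t\<in>{1..2}. \<bar>f t\<bar> \<le> B" if "continuous_on UNIV f" for f :: "real \<Rightarrow> real"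
  proof -
    have "bounded (f ` {1..2})"
      by (intro compact_imp_bounded compact_continuous_image compact_Icc continuous_on_subset[OF that]) auto
    then show ?thesis by (auto simp: bounded_iff)
  qed
  obtain B1 B2 where B: "\<forall>t\<in>{1..2}. \<bar>dstep t\<bar> \<le> B1" "\<forall>t\<in>{1..2}. \<bar>dd t\<bar> \<le> B2"
    using bd[of dstep] bd[of dd] C[of 0] C1_dstep[of 0] by auto
  define B where "B = max B1 B2"
  have B0: "B \<ge> 0" using B(1) by (force simp: B_def)
  show thesis
  proof (rule that[OF dd C])
    show "\<bar>dstep t\<bar> \<le> B" for t
      using B(1) B0 dstep_eq_0[of t] by (cases "t \<in> {1..2}") (auto simp: B_def le_max_iff_disj)
    show "\<bar>dd t\<bar> \<le> B" for t
      using B(2) B0 z[of t] by (cases "t \<in> {1..2}") (auto simp: B_def le_max_iff_disj)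
  qed (use z in auto)
qed

section \<open>Integration by parts\<close>

lemma lebesgue_integral_translation:
  fixes f :: "'a::euclidean_space \<Rightarrow> real"
  assumes "f \<in> borel_measurable borel"
  shows "integral\<^sup>L lborel (\<lambda>x. f (c + x)) = integral\<^sup>L lborel f"
proof -
  have "integral\<^sup>L lborel f = integral\<^sup>L (distr lborel borel ((+) c)) f"
    by (simp add: lborel_distr_plus)
  also have "\<dots> = integral\<^sup>L lborel (\<lambda>x. f (c + x))"
    using assms by (intro integral_distr) auto
  finally show ?thesis by simp
qed

lemma integrable_lborel_bounded_support:
  fixes f :: "'a::euclidean_space \<Rightarrow> real"
  assumes "f \<in> borel_measurable borel" "\<And>x. \<bar>f x\<bar> \<le> B" "\<And>x. norm x > R \<Longrightarrow> f x = 0"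
  shows "integrable lborel f"
proof (rule Bochner_Integration.integrable_bound)
  show "integrable lborel (\<lambda>x. B * indicator (cball 0 R) x :: real)"
    by (intro integrable_mult_right integrable_real_indicator) (use emeasure_bounded_finite[OF bounded_cball] in \<open>auto simp: infinity_ennreal_def\<close>)
  show "AE x in lborel. norm (f x) \<le> norm (B * indicator (cball 0 R) x)"
  proof (rule AE_I2)
    fix x show "norm (f x) \<le> norm (B * indicator (cball 0 R) x)"
      using assms(2)[of x] assms(3)[of x] by (cases "norm x > R") auto
  qed
qed (use assms(1) in simp)

lemma continuous_bounded_support:
  fixes f :: "'a::euclidean_space \<Rightarrow> real"
  assumes "continuous_on UNIV f" "\<And>x. norm x > R \<Longrightarrow> f x = 0"
  obtains B where "\<And>x. \<bar>f x\<bar> \<le> B" "B > 0"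
proof -
  have "bounded (f ` cball 0 R)"
    by (intro compact_imp_bounded compact_continuous_image compact_cball continuous_on_subset[OF assms(1)]) auto
  then obtain B where "B > 0" "\<And>x. x \<in> cball 0 R \<Longrightarrow> \<bar>f x\<bar> \<le> B"
    unfolding bounded_pos by auto
  then have "\<bar>f x\<bar> \<le> B" for x
    using assms(2)[of x] by (cases "norm x > R") auto
  then show thesis using that \<open>B > 0\<close> by blast
qed

text \<open>The integral of a difference quotient vanishes by translation invariance.\<close>

lemma integral_pd_eq_0:
  fixes f :: "real^2 \<Rightarrow> real"
  assumes d: "\<And>x. f differentiable (at x)" and c: "continuous_on UNIV (pd i f)"
    and R: "\<And>x. norm x > R \<Longrightarrow> f x = 0"
  shows "integral\<^sup>L lborel (pd i f) = 0"
proof -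
  let ?e = "axis i 1 :: real^2"
  have cf: "continuous_on UNIV f"
    by (rule differentiable_continuous_on) (rule d)
  then have fm [measurable]: "f \<in> borel_measurable borel"
    by (rule borel_measurable_continuous_onI)
  have pm [measurable]: "pd i f \<in> borel_measurable borel"
    using c by (rule borel_measurable_continuous_onI)
  have pz: "pd i f x = 0" if "norm x > R" for x
  proof -
    have "open {x::real^2. norm x > R}"
      by (intro open_Collect_less continuous_on_const continuous_on_norm_id)
    then show ?thesis
      using pd_cong[of "{x. norm x > R}" x f "\<lambda>_. 0" i] R that by simp
  qed
  obtain B where B: "\<And>x. \<bar>pd i f x\<bar> \<le> B" "B > 0"
    using continuous_bounded_support[OF c pz] by blast
  obtain B' where B': "\<And>x. \<bar>f x\<bar> \<le> B'" "B' > 0"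
    using continuous_bounded_support[OF cf R] by blast
  have fi: "integrable lborel f"
    by (rule integrable_lborel_bounded_support[OF fm B'(1) R])
  define h where "h n = inverse (real (Suc n))" for n
  have h: "h n > 0" "h n \<le> 1" "h \<longlonglongrightarrow> 0" for n
    using LIMSEQ_inverse_real_of_nat by (auto simp: h_def[abs_def] field_simps)
  define g where "g n x = (f (h n *\<^sub>R ?e + x) - f x) / h n" for n x
  have gm [measurable]: "g n \<in> borel_measurable lborel" for n
    unfolding g_def by measurable
  \<comment> \<open>Dominated convergence: by the mean value theorem the difference quotients are
    bounded by the bound \<open>B\<close> of \<open>pd i f\<close>, and since
    \<open>h n \<le> 1\<close> they vanish beyond radius \<open>R + 1\<close>.\<close>
  have "(\<lambda>n. integral\<^sup>L lborel (g n)) \<longlonglongrightarrow> integral\<^sup>L lborel (pd i f)"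
  proof (rule integral_dominated_convergence)
    show "integrable lborel (\<lambda>x::real^2. B * indicator (cball 0 (R + 1)) x :: real)"
      by (intro integrable_mult_right integrable_real_indicator) (use emeasure_bounded_finite[OF bounded_cball] in \<open>auto simp: infinity_ennreal_def\<close>)
    show "AE x in lborel. (\<lambda>n. g n x) \<longlonglongrightarrow> pd i f x"
    proof (rule AE_I2)
      fix x
      have "((\<lambda>t. f (x + t *\<^sub>R ?e)) has_real_derivative pd i f (x + 0 *\<^sub>R ?e)) (at 0)"
        by (rule pd_line) (rule d)
      then have "((\<lambda>t. (f (x + t *\<^sub>R ?e) - f x) / t) \<longlongrightarrow> pd i f x) (at 0)"
        by (simp add: DERIV_def)
      moreover have "h n \<noteq> 0" for n using h(1)[of n] by simp
      then have "filterlim h (at 0) sequentially"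
        using h(3) by (simp add: filterlim_at)
      ultimately have "(\<lambda>n. (f (x + h n *\<^sub>R ?e) - f x) / h n) \<longlonglongrightarrow> pd i f x"
        by (rule filterlim_compose)
      then show "(\<lambda>n. g n x) \<longlonglongrightarrow> pd i f x"
        by (simp add: g_def add.commute)
    qed
    show "AE x in lborel. norm (g n x) \<le> B * indicator (cball 0 (R + 1)) x" for n
    proof (rule AE_I2)
      fix x
      show "norm (g n x) \<le> B * indicator (cball 0 (R + 1)) x"
      proof (cases "norm x > R + 1")
        case True
        have "norm x \<le> norm (h n *\<^sub>R ?e + x) + norm (h n *\<^sub>R ?e)"
          using norm_triangle_ineq4[of "h n *\<^sub>R ?e + x" "h n *\<^sub>R ?e"] by simp
        then have "norm (h n *\<^sub>R ?e + x) > R"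
          using True h(1,2)[of n] by (simp add: norm_axis_1)
        then have "g n x = 0" using True R by (simp add: g_def)
        then show ?thesis using B(2) by (simp add: indicator_def)
      next
        case False
        have "\<exists>z. 0 < z \<and> z < h n \<and> f (x + h n *\<^sub>R ?e) - f (x + 0 *\<^sub>R ?e) = (h n - 0) * pd i f (x + z *\<^sub>R ?e)"
          by (rule MVT2[OF h(1)], rule pd_line, rule d)
        then obtain z where "f (x + h n *\<^sub>R ?e) - f x = h n * pd i f (x + z *\<^sub>R ?e)" by auto
        then have "g n x = pd i f (x + z *\<^sub>R ?e)"
          using h(1)[of n] by (simp add: g_def add.commute)
        then show ?thesis using B(1) False by simp
      qed
    qed
  qed simp_all
  moreover have "integral\<^sup>L lborel (g n) = 0" for n
  proof -
    have "integrable lborel (\<lambda>x. f (h n *\<^sub>R ?e + x))"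
    proof (rule integrable_lborel_bounded_support[where R = "R + 1"])
      show "(\<lambda>x. f (h n *\<^sub>R ?e + x)) \<in> borel_measurable borel" by measurable
      show "f (h n *\<^sub>R ?e + x) = 0" if "norm x > R + 1" for x
      proof -
        have "norm x \<le> norm (h n *\<^sub>R ?e + x) + norm (h n *\<^sub>R ?e)"
          using norm_triangle_ineq4[of "h n *\<^sub>R ?e + x" "h n *\<^sub>R ?e"] by simp
        then show ?thesis
          using that h(1,2)[of n] by (intro R) (simp add: norm_axis_1)
      qed
    qed (rule B')
    then have "integral\<^sup>L lborel (g n) = (integral\<^sup>L lborel (\<lambda>x. f (h n *\<^sub>R ?e + x)) - integral\<^sup>L lborel f) / h n"
      unfolding g_def using fi by simp
    then show ?thesis by (simp add: lebesgue_integral_translation)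
  qed
  ultimately show ?thesis by (simp add: LIMSEQ_const_iff)
qed

section \<open>Test functions on the disk\<close>

text \<open>Euclidean measure, not hyperbolic volume. In dimension two the volume density cancels
  the inverse metric in the inner product of 1-forms, see \<open>gform_voldens\<close>.\<close>

abbreviation HM :: "(real^2) measure" where
  "HM \<equiv> lebesgue_on Hdisk"

lemma open_Hdisk: "open Hdisk"
  by (simp add: Hdisk_def)

lemma Hdisk_lebesgue: "Hdisk \<in> sets lebesgue"
  by (simp add: Hdisk_def)

lemma in_Hdisk_iff: "x \<in> Hdisk \<longleftrightarrow> norm x < 1"
  by (simp add: Hdisk_def dist_norm)

lemma space_HM: "space HM = Hdisk"
  by (simp add: space_restrict_space)

lemma finite_measure_HM: "finite_measure HM"
proof
  show "emeasure HM (space HM) \<noteq> \<infinity>"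
    using emeasure_bounded_finite[of "ball (0::real^2) 1"]
    by (simp add: emeasure_restrict_space Hdisk_def space_restrict_space)
qed

lemma compact_in_Hdisk:
  assumes "compact K" "K \<subseteq> Hdisk"
  obtains r where "0 < r" "r < 1" "K \<subseteq> cball 0 r"
proof (cases "K = {}")
  case True
  then show thesis using that[of "1/2"] by simp
next
  case False
  obtain y where y: "y \<in> K" "\<And>x. x \<in> K \<Longrightarrow> norm x \<le> norm y"
    using continuous_attains_sup[OF assms(1) False, of norm] continuous_on_norm_id by blast
  have "norm y < 1" using y(1) assms(2) in_Hdisk_iff by blast
  moreover have "norm x \<le> max (norm y) (1/2)" if "x \<in> K" for x
    using y(2)[OF that] by simp
  ultimately show thesis
    by (intro that[of "max (norm y) (1/2)"]) (auto simp: dist_norm)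
qed

lemma csupp_inI:
  fixes f :: "real^2 \<Rightarrow> 'b::zero"
  assumes "r < 1" "\<And>x. norm x > r \<Longrightarrow> f x = 0"
  shows "csupp_in Hdisk f"
proof -
  have "closure {x. f x \<noteq> 0} \<subseteq> cball 0 r"
  proof (rule closure_minimal)
    show "{x. f x \<noteq> 0} \<subseteq> cball 0 r"
      using assms(2) by (force simp: not_less dist_norm)
  qed simp
  moreover have "cball 0 r \<subseteq> Hdisk" using assms(1) by (auto simp: Hdisk_def)
  ultimately show ?thesis
    unfolding csupp_in_def by (meson bounded_cball bounded_subset closed_closure compact_eq_bounded_closed order_trans)
qed

lemma csupp_inE:
  fixes f :: "real^2 \<Rightarrow> 'b::zero"
  assumes "csupp_in Hdisk f"
  obtains r where "0 < r" "r < 1" "\<And>x. norm x > r \<Longrightarrow> f x = 0"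
proof -
  obtain r where r: "0 < r" "r < 1" "closure {x. f x \<noteq> 0} \<subseteq> cball 0 r"
    using compact_in_Hdisk[of "closure {x. f x \<noteq> 0}"] assms unfolding csupp_in_def by (elim conjE) blast
  have "f x = 0" if "norm x > r" for x
  proof (rule ccontr)
    assume "f x \<noteq> 0"
    then have "x \<in> closure {x. f x \<noteq> 0}" by (intro subsetD[OF closure_subset]) simp
    then have "x \<in> cball 0 r" using r(3) by (rule subsetD[rotated])
    then show False using that by simp
  qed
  then show thesis using that r by blast
qed

text \<open>Smoothness is given on the disk only, but \<open>f\<close> vanishes on the open set
  \<open>norm x > r\<close>, and the two open sets cover the plane. Hence test functions may be
  treated as smooth on all of \<open>real^2\<close>.\<close>

lemma smooth_fun_extend:
  assumes "smooth_fun Hdisk f" "r < 1" "\<And>x. norm x > r \<Longrightarrow> f x = 0"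
  shows "smooth_fun UNIV f"
proof -
  have o: "open {x::real^2. norm x > r}"
    by (intro open_Collect_less continuous_on_const continuous_on_norm_id)
  have "smooth_fun {x. norm x > r} f"
    by (rule smooth_fun_cong[OF o _ smooth_fun_const[of _ 0]]) (use assms(3) in simp)
  then have "smooth_fun (Hdisk \<union> {x. norm x > r}) f"
    by (intro smooth_fun_Un open_Hdisk o assms(1))
  moreover have "Hdisk \<union> {x. norm x > r} = UNIV"
    using assms(2) by (auto simp: in_Hdisk_iff)
  ultimately show ?thesis by simp
qed

lemma test_funI:
  assumes "smooth_fun Hdisk f" "r < 1" "\<And>x. norm x > r \<Longrightarrow> f x = 0"
  shows "test_fun f"
  unfolding test_fun_def by (intro conjI assms(1) csupp_inI[OF assms(2,3)])

lemma test_funD: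
  assumes "test_fun f"
  shows "\<exists>r. 0 < r \<and> r < 1 \<and> (\<forall>x. norm x > r \<longrightarrow> f x = 0) \<and> smooth_fun UNIV f"
proof -
  have c: "csupp_in Hdisk f" and s: "smooth_fun Hdisk f" using assms by (auto simp: test_fun_def)
  show ?thesis
  proof (rule csupp_inE[OF c])
    fix r assume r: "0 < r" "r < 1" "\<And>x. norm x > r \<Longrightarrow> f x = 0"
    show ?thesis
      using r smooth_fun_extend[OF s r(2,3)] by (intro exI[of _ r] conjI allI impI)
  qed
qed

lemma pd_support:
  assumes "\<And>x. norm x > r \<Longrightarrow> f x = 0" "norm x > r"
  shows "pd i f x = 0"
proof -
  have "open {x::real^2. norm x > r}"
    by (intro open_Collect_less continuous_on_const continuous_on_norm_id)
  then show ?thesis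
    using pd_cong[of "{x. norm x > r}" x f "\<lambda>_. 0" i] assms by simp
qed

lemma test_fun_pd: "test_fun f \<Longrightarrow> test_fun (pd i f)"
proof -
  assume "test_fun f"
  then obtain r where r: "0 < r" "r < 1" "\<And>x. norm x > r \<Longrightarrow> f x = 0" "smooth_fun UNIV f"
    using test_funD[OF \<open>test_fun f\<close>] by auto
  show ?thesis
    by (rule test_funI[OF smooth_fun_subset[OF smooth_fun_pd[OF r(4)]] r(2)])
      (simp_all add: pd_support[OF r(3)])
qed

lemma test_fun_mult:
  assumes "smooth_fun Hdisk f" "test_fun \<phi>"
  shows "test_fun (\<lambda>x. f x * \<phi> x)"
proof -
  obtain r where r: "0 < r" "r < 1" "\<And>x. norm x > r \<Longrightarrow> \<phi> x = 0" "smooth_fun UNIV \<phi>"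
    using test_funD[OF assms(2)] by auto
  show ?thesis
    by (rule test_funI[OF smooth_fun_mult[OF open_Hdisk assms(1) smooth_fun_subset[OF r(4)]] r(2)])
      (simp_all add: r(3))
qed

lemma test_fun_smooth:
  assumes "test_fun f"
  shows "smooth_fun S f"
proof -
  have "smooth_fun UNIV f" using test_funD[OF assms] by auto
  then show ?thesis by (rule smooth_fun_subset) simp
qed

lemma test_fun_add: "test_fun f \<Longrightarrow> test_fun g \<Longrightarrow> test_fun (\<lambda>x. f x + g x)"
proof -
  assume f: "test_fun f" and g: "test_fun g"
  obtain r where r: "0 < r" "r < 1" "\<And>x. norm x > r \<Longrightarrow> f x = 0" using test_funD[OF f] by auto
  obtain s where s: "0 < s" "s < 1" "\<And>x. norm x > s \<Longrightarrow> g x = 0" using test_funD[OF g] by auto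
  show ?thesis
    by (rule test_funI[of _ "max r s"])
      (use r s in \<open>simp_all add: smooth_fun_add[OF open_Hdisk test_fun_smooth[OF f] test_fun_smooth[OF g]]\<close>)
qed

lemma test_fun_cmult: "test_fun f \<Longrightarrow> test_fun (\<lambda>x. c * f x)"
  by (rule test_fun_mult[OF smooth_fun_const])

lemma continuous_HM_measurable:
  fixes f :: "real^2 \<Rightarrow> 'b::euclidean_space"
  shows "continuous_on Hdisk f \<Longrightarrow> f \<in> borel_measurable HM"
  by (rule continuous_imp_measurable_on_sets_lebesgue[OF _ Hdisk_lebesgue])

lemma integrable_HM_bounded:
  fixes f :: "real^2 \<Rightarrow> 'b::euclidean_space"
  assumes "f \<in> borel_measurable HM" "\<And>x. x \<in> Hdisk \<Longrightarrow> norm (f x) \<le> B"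
  shows "integrable HM f"
  by (rule finite_measure.integrable_const_bound[OF finite_measure_HM, of _ B])
    (use assms in \<open>auto intro!: AE_I2 simp: space_HM\<close>)

lemma bounded_compact_support:
  fixes f :: "real^2 \<Rightarrow> 'b::euclidean_space"
  assumes "continuous_on Hdisk f" "r < 1" "\<And>x. norm x > r \<Longrightarrow> f x = 0"
  obtains B where "B > 0" "\<And>x. x \<in> Hdisk \<Longrightarrow> norm (f x) \<le> B"
proof -
  have "cball 0 r \<subseteq> Hdisk" using assms(2) by (auto simp: in_Hdisk_iff)
  then have "bounded (f ` cball 0 r)"
    by (intro compact_imp_bounded compact_continuous_image compact_cball continuous_on_subset[OF assms(1)])
  then obtain B where B: "B > 0" "\<And>x. x \<in> cball 0 r \<Longrightarrow> norm (f x) \<le> B"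
    unfolding bounded_pos by auto
  then have "norm (f x) \<le> B" for x
    using assms(3)[of x] by (cases "norm x > r") auto
  then show thesis using that B(1) by blast
qed

lemma integrable_HM_compact_support:
  fixes f :: "real^2 \<Rightarrow> 'b::euclidean_space"
  assumes "continuous_on Hdisk f" "r < 1" "\<And>x. norm x > r \<Longrightarrow> f x = 0"
  shows "integrable HM f"
proof -
  obtain B where "\<And>x. x \<in> Hdisk \<Longrightarrow> norm (f x) \<le> B"
    using bounded_compact_support[OF assms] by blast
  then show ?thesis by (rule integrable_HM_bounded[OF continuous_HM_measurable[OF assms(1)]])
qed

lemma integrable_mult_test_fun:
  assumes "continuous_on Hdisk f" "test_fun \<phi>"
  shows "integrable HM (\<lambda>x. f x * \<phi> x)"
proof -
  obtain r where r: "0 < r" "r < 1" "\<And>x. norm x > r \<Longrightarrow> \<phi> x = 0"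
    using test_funD[OF assms(2)] by auto
  show ?thesis
    by (rule integrable_HM_compact_support[OF _ r(2)])
      (use r in \<open>simp_all add: continuous_on_mult[OF assms(1) smooth_fun_continuous[OF test_fun_smooth[OF assms(2)]]]\<close>)
qed

lemma integral_HM_eq_lborel:
  assumes "f \<in> borel_measurable borel" "\<And>x. x \<notin> Hdisk \<Longrightarrow> f x = 0"
  shows "integral\<^sup>L HM f = integral\<^sup>L lborel (f :: real^2 \<Rightarrow> real)"
proof -
  have "integral\<^sup>L HM f = integral\<^sup>L lebesgue (\<lambda>x. indicator Hdisk x *\<^sub>R f x)"
    by (rule integral_restrict_space) (simp add: Hdisk_lebesgue)
  also have "(\<lambda>x. indicator Hdisk x *\<^sub>R f x) = f"
    using assms(2) by (auto simp: fun_eq_iff indicator_def)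
  also have "integral\<^sup>L lebesgue f = integral\<^sup>L lborel f"
    using assms(1) by (intro integral_completion) simp
  finally show ?thesis .
qed

lemma integral_pd_test_fun:
  assumes "test_fun \<phi>"
  shows "integral\<^sup>L HM (pd i \<phi>) = 0"
proof -
  obtain r where r: "0 < r" "r < 1" "\<And>x. norm x > r \<Longrightarrow> \<phi> x = 0" "smooth_fun UNIV \<phi>"
    using test_funD[OF assms] by auto
  have c: "continuous_on UNIV (pd i \<phi>)"
    by (rule smooth_fun_continuous[OF smooth_fun_pd[OF r(4)]])
  have "integral\<^sup>L HM (pd i \<phi>) = integral\<^sup>L lborel (pd i \<phi>)"
    by (rule integral_HM_eq_lborel[OF borel_measurable_continuous_onI[OF c]])
      (use pd_support[of r \<phi>] r in \<open>auto simp: in_Hdisk_iff\<close>)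
  then show ?thesis
    using integral_pd_eq_0[OF smooth_fun_differentiable[OF r(4)] c r(3)] by simp
qed

text \<open>\<open>f\<close> may blow up at the boundary circle; the product with a test function is
  again a test function, and the integral of its derivative is zero.\<close>

lemma integration_by_parts:
  assumes "smooth_fun Hdisk f" "test_fun \<phi>"
  shows "(LINT x|HM. f x * pd i \<phi> x) = - (LINT x|HM. pd i f x * \<phi> x)"
proof -
  have "(LINT x|HM. f x * pd i \<phi> x + pd i f x * \<phi> x) = integral\<^sup>L HM (pd i (\<lambda>x. f x * \<phi> x))"
    by (rule Bochner_Integration.integral_cong)
      (use assms test_fun_smooth[OF assms(2), of Hdisk] in \<open>auto simp: space_HM pd_mult smooth_fun_differentiable\<close>)
  also have "\<dots> = 0"
    by (rule integral_pd_test_fun[OF test_fun_mult[OF assms]])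
  also have "(LINT x|HM. f x * pd i \<phi> x + pd i f x * \<phi> x) =
      (LINT x|HM. f x * pd i \<phi> x) + (LINT x|HM. pd i f x * \<phi> x)"
    by (intro Bochner_Integration.integral_add integrable_mult_test_fun test_fun_pd assms
        smooth_fun_continuous smooth_fun_pd)
  finally show ?thesis by simp
qed

section \<open>Square integrable functions on the disk\<close>

text \<open>Membership in Euclidean L2 of the disk, for functions rather than classes. The value
  type is general so that scalars, 1-forms and 2-tensors share one theory; \<open>nsq\<close> is the
  squared norm.\<close>

definition sqint :: "(real^2 \<Rightarrow> 'b::euclidean_space) \<Rightarrow> bool" where
  "sqint u \<longleftrightarrow> u \<in> borel_measurable HM \<and> integrable HM (\<lambda>x. (norm (u x))\<^sup>2)"

definition nsq :: "(real^2 \<Rightarrow> 'b::euclidean_space) \<Rightarrow> real" where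
  "nsq u = (LINT x|HM. (norm (u x))\<^sup>2)"

lemma sqint_measurable: "sqint u \<Longrightarrow> u \<in> borel_measurable HM"
  by (simp add: sqint_def)

lemma sqint_integrable_sq: "sqint u \<Longrightarrow> integrable HM (\<lambda>x. (norm (u x))\<^sup>2)"
  by (simp add: sqint_def)

lemma nsq_nonneg: "nsq u \<ge> 0"
  unfolding nsq_def by (rule integral_nonneg_AE) simp

lemma sqint_dominated:
  fixes u :: "real^2 \<Rightarrow> 'b::euclidean_space"
  assumes "u \<in> borel_measurable HM" "integrable HM g" "\<And>x. x \<in> Hdisk \<Longrightarrow> (norm (u x))\<^sup>2 \<le> g x"
  shows "sqint u"
  unfolding sqint_def
proof (intro conjI assms(1) Bochner_Integration.integrable_bound[OF assms(2)])
  show "(\<lambda>x. (norm (u x))\<^sup>2) \<in> borel_measurable HM"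
    using assms(1) by measurable
  show "AE x in HM. norm ((norm (u x))\<^sup>2) \<le> norm (g x)"
    using assms(3) by (intro AE_I2) (force simp: space_HM)
qed

lemma nsq_le:
  assumes "integrable HM g" "\<And>x. x \<in> Hdisk \<Longrightarrow> (norm (u x))\<^sup>2 \<le> g x"
  shows "nsq u \<le> integral\<^sup>L HM g"
  unfolding nsq_def
proof (cases "integrable HM (\<lambda>x. (norm (u x))\<^sup>2)")
  case True
  then show "(LINT x|HM. (norm (u x))\<^sup>2) \<le> integral\<^sup>L HM g"
    using assms by (intro integral_mono) (auto simp: space_HM)
next
  \<comment> \<open>A non-integrable integrand has integral 0 by convention, so the bound survives
    because \<open>g\<close> is nonnegative.\<close>
  case False
  moreover have "0 \<le> integral\<^sup>L HM g"
  proof (rule Bochner_Integration.integral_nonneg)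
    fix x assume "x \<in> space HM"
    then show "0 \<le> g x" using order_trans[OF zero_le_power2 assms(2)] by (simp add: space_HM)
  qed
  ultimately show "(LINT x|HM. (norm (u x))\<^sup>2) \<le> integral\<^sup>L HM g"
    by (simp add: not_integrable_integral_eq)
qed

lemma norm_add_sq_le: "(norm (x + y))\<^sup>2 \<le> 2 * (norm x)\<^sup>2 + 2 * (norm (y :: 'b::real_inner))\<^sup>2"
proof -
  have "0 \<le> (norm (x - y))\<^sup>2" by simp
  then show ?thesis
    unfolding power2_norm_eq_inner by (simp add: inner_add inner_diff inner_commute)
qed

lemma sqint_add:
  assumes "sqint u" "sqint v"
  shows "sqint (\<lambda>x. u x + v x)" "nsq (\<lambda>x. u x + v x) \<le> 2 * nsq u + 2 * nsq v"
proof -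
  have i: "integrable HM (\<lambda>x. 2 * (norm (u x))\<^sup>2 + 2 * (norm (v x))\<^sup>2)"
    using assms by (simp add: sqint_def)
  show "sqint (\<lambda>x. u x + v x)"
    by (rule sqint_dominated[OF _ i]) (use assms in \<open>auto simp: sqint_def norm_add_sq_le\<close>)
  have "nsq (\<lambda>x. u x + v x) \<le> (LINT x|HM. 2 * (norm (u x))\<^sup>2 + 2 * (norm (v x))\<^sup>2)"
    by (rule nsq_le[OF i]) (rule norm_add_sq_le)
  also have "\<dots> = 2 * nsq u + 2 * nsq v"
    using assms by (simp add: sqint_def nsq_def)
  finally show "nsq (\<lambda>x. u x + v x) \<le> 2 * nsq u + 2 * nsq v" .
qed

lemma sqint_bound:
  fixes u :: "real^2 \<Rightarrow> 'b::euclidean_space" and v :: "real^2 \<Rightarrow> 'c::euclidean_space"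
  assumes "sqint u" "v \<in> borel_measurable HM" "\<And>x. x \<in> Hdisk \<Longrightarrow> norm (v x) \<le> c * norm (u x)"
  shows "sqint v" "nsq v \<le> c\<^sup>2 * nsq u"
proof -
  have i: "integrable HM (\<lambda>x. c\<^sup>2 * (norm (u x))\<^sup>2)"
    using assms by (simp add: sqint_def)
  have b: "(norm (v x))\<^sup>2 \<le> c\<^sup>2 * (norm (u x))\<^sup>2" if "x \<in> Hdisk" for x
    using power_mono[OF assms(3)[OF that], of 2] by (simp add: power_mult_distrib)
  show "sqint v" by (rule sqint_dominated[OF assms(2) i b])
  have "nsq v \<le> (LINT x|HM. c\<^sup>2 * (norm (u x))\<^sup>2)" by (rule nsq_le[OF i b])
  then show "nsq v \<le> c\<^sup>2 * nsq u" by (simp add: nsq_def)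
qed

lemma sqint_cong:
  assumes "\<And>x. x \<in> Hdisk \<Longrightarrow> u x = v x"
  shows "sqint u \<longleftrightarrow> sqint v" "nsq u = nsq v"
proof -
  have "u \<in> borel_measurable HM \<longleftrightarrow> v \<in> borel_measurable HM"
    by (rule measurable_cong) (use assms in \<open>simp add: space_HM\<close>)
  moreover have "integrable HM (\<lambda>x. (norm (u x))\<^sup>2) \<longleftrightarrow> integrable HM (\<lambda>x. (norm (v x))\<^sup>2)"
    by (rule Bochner_Integration.integrable_cong) (use assms in \<open>simp_all add: space_HM\<close>)
  ultimately show "sqint u \<longleftrightarrow> sqint v" by (simp add: sqint_def)
  show "nsq u = nsq v"
    unfolding nsq_def by (rule Bochner_Integration.integral_cong) (use assms in \<open>simp_all add: space_HM\<close>)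
qed

lemma sqint_scaleR:
  assumes "sqint u"
  shows "sqint (\<lambda>x. c *\<^sub>R u x)" "nsq (\<lambda>x. c *\<^sub>R u x) = c\<^sup>2 * nsq u"
  using assms by (auto simp: sqint_def nsq_def power_mult_distrib)

lemma sqint_uminus:
  assumes "sqint u"
  shows "sqint (\<lambda>x. - u x)" "nsq (\<lambda>x. - u x) = nsq u"
  using assms by (auto simp: sqint_def nsq_def)

lemma sqint_diff:
  assumes "sqint u" "sqint v"
  shows "sqint (\<lambda>x. u x - v x)" "nsq (\<lambda>x. u x - v x) \<le> 2 * nsq u + 2 * nsq v"
  using sqint_add[OF assms(1) sqint_uminus(1)[OF assms(2)]] by (simp_all add: sqint_uminus(2)[OF assms(2)])

lemma nsq_minus_commute: "nsq (\<lambda>x. u x - v x) = nsq (\<lambda>x. v x - u x)"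
  by (simp add: nsq_def norm_minus_commute)

lemma sqint_bounded:
  fixes u :: "real^2 \<Rightarrow> 'b::euclidean_space"
  assumes "u \<in> borel_measurable HM" "\<And>x. x \<in> Hdisk \<Longrightarrow> norm (u x) \<le> B"
  shows "sqint u"
proof (rule sqint_dominated[OF assms(1)])
  show "integrable HM (\<lambda>x. B\<^sup>2)"
    by (rule finite_measure.integrable_const[OF finite_measure_HM])
  show "(norm (u x))\<^sup>2 \<le> B\<^sup>2" if "x \<in> Hdisk" for x
    using power_mono[OF assms(2)[OF that], of 2] by simp
qed

lemma sqint_compact_support:
  fixes u :: "real^2 \<Rightarrow> 'b::euclidean_space"
  assumes "continuous_on Hdisk u" "r < 1" "\<And>x. norm x > r \<Longrightarrow> u x = 0"
  shows "sqint u"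
proof -
  obtain B where "\<And>x. x \<in> Hdisk \<Longrightarrow> norm (u x) \<le> B"
    using bounded_compact_support[OF assms] by blast
  then show ?thesis by (rule sqint_bounded[OF continuous_HM_measurable[OF assms(1)]])
qed

lemma sqint_test_fun: "test_fun \<phi> \<Longrightarrow> sqint \<phi>"
proof -
  assume t: "test_fun \<phi>"
  obtain r where r: "r < 1" "\<And>x. norm x > r \<Longrightarrow> \<phi> x = 0"
    using test_funD[OF t] by auto
  show ?thesis
    by (rule sqint_compact_support[OF smooth_fun_continuous[OF test_fun_smooth[OF t]] r])
qed

lemma sqint_mult_bounded:
  fixes u :: "real^2 \<Rightarrow> 'b::euclidean_space"
  assumes "sqint u" "f \<in> borel_measurable HM" "\<And>x. x \<in> Hdisk \<Longrightarrow> \<bar>f x\<bar> \<le> B"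
  shows "sqint (\<lambda>x. f x *\<^sub>R u x)" "nsq (\<lambda>x. f x *\<^sub>R u x) \<le> B\<^sup>2 * nsq u"
proof -
  have m: "(\<lambda>x. f x *\<^sub>R u x) \<in> borel_measurable HM"
    by (rule borel_measurable_scaleR[OF assms(2) sqint_measurable[OF assms(1)]])
  have b: "norm (f x *\<^sub>R u x) \<le> B * norm (u x)" if "x \<in> Hdisk" for x
    using assms(3)[OF that] by (simp add: mult_right_mono)
  show "sqint (\<lambda>x. f x *\<^sub>R u x)" "nsq (\<lambda>x. f x *\<^sub>R u x) \<le> B\<^sup>2 * nsq u"
    using sqint_bound[OF assms(1) m b] by auto
qed

lemma sqint_inner:
  assumes "sqint u" "sqint v"
  shows "integrable HM (\<lambda>x. u x \<bullet> v x)"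
proof (rule Bochner_Integration.integrable_bound)
  show "integrable HM (\<lambda>x. (norm (u x))\<^sup>2 + (norm (v x))\<^sup>2)"
    using assms by (simp add: sqint_def)
  show "(\<lambda>x. u x \<bullet> v x) \<in> borel_measurable HM"
    using assms by (simp add: sqint_def borel_measurable_inner)
  have "norm (u x \<bullet> v x) \<le> norm ((norm (u x))\<^sup>2 + (norm (v x))\<^sup>2)" for x
  proof -
    have "norm (u x \<bullet> v x) \<le> norm (u x) * norm (v x)"
      by (simp add: Cauchy_Schwarz_ineq2)
    also have "\<dots> \<le> (norm (u x))\<^sup>2 + (norm (v x))\<^sup>2"
      using sum_squares_bound[of "norm (u x)" "norm (v x)"] mult_nonneg_nonneg[OF norm_ge_zero norm_ge_zero, of "u x" "v x"]
      by linarith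
    finally show ?thesis by simp
  qed
  then show "AE x in HM. norm (u x \<bullet> v x) \<le> norm ((norm (u x))\<^sup>2 + (norm (v x))\<^sup>2)" by simp
qed

lemma sqint_mult:
  fixes u v :: "real^2 \<Rightarrow> real"
  shows "sqint u \<Longrightarrow> sqint v \<Longrightarrow> integrable HM (\<lambda>x. u x * v x)"
  using sqint_inner[of u v] by simp

lemma sqint_integrable:
  fixes u :: "real^2 \<Rightarrow> real"
  assumes "sqint u"
  shows "integrable HM u"
  using sqint_mult[OF assms sqint_bounded[of "\<lambda>_. 1" 1]] by simp

section \<open>Hilbert space geometry of L2: Cauchy-Schwarz, completeness and projection\<close>

lemma nsq_expand:
  assumes "sqint u" "sqint v"
  shows "nsq (\<lambda>x. u x + c *\<^sub>R v x) = nsq u + 2 * c * (LINT x|HM. u x \<bullet> v x) + c\<^sup>2 * nsq v"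
proof -
  have "nsq (\<lambda>x. u x + c *\<^sub>R v x) =
     (LINT x|HM. (norm (u x))\<^sup>2 + 2 * c * (u x \<bullet> v x) + c\<^sup>2 * (norm (v x))\<^sup>2)"
    unfolding nsq_def power2_norm_eq_inner
    by (rule Bochner_Integration.integral_cong)
      (auto simp: inner_add inner_commute power2_eq_square algebra_simps)
  also have "\<dots> = nsq u + 2 * c * (LINT x|HM. u x \<bullet> v x) + c\<^sup>2 * nsq v"
    using assms sqint_inner[OF assms] by (simp add: sqint_def nsq_def)
  finally show ?thesis .
qed

lemma nsq_Cauchy_Schwarz:
  assumes "sqint u" "sqint v"
  shows "((LINT x|HM. u x \<bullet> v x))\<^sup>2 \<le> nsq u * nsq v"
proof -
  define B where "B = (LINT x|HM. u x \<bullet> v x)"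
  have *: "0 \<le> nsq u + 2 * c * B + c\<^sup>2 * nsq v" for c
    using nsq_expand[OF assms, of c] nsq_nonneg[of "\<lambda>x. u x + c *\<^sub>R v x"] by (simp add: B_def)
  show ?thesis
  proof (cases "nsq v = 0")
    case True
    have "B = 0"
    proof (rule ccontr)
      assume "B \<noteq> 0"
      \<comment> \<open>If \<open>nsq v = 0\<close> the quadratic in \<open>c\<close> degenerates to
        an affine function with nonzero slope; at this \<open>c\<close> it takes the value
        \<open>-1\<close>.\<close>
      then show False using *[of "- (nsq u + 1) / (2 * B)"] True by (simp add: field_simps)
    qed
    then show ?thesis using True by (simp add: B_def)
  next
    case False
    then have p: "nsq v > 0" using nsq_nonneg[of v] by linarith
    have "0 \<le> nsq v * (nsq u + 2 * (- B / nsq v) * B + (- B / nsq v)\<^sup>2 * nsq v)"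
      using p *[of "- B / nsq v"] by simp
    also have "\<dots> = nsq u * nsq v - B\<^sup>2"
      using p by (simp add: field_simps power2_eq_square)
    finally show ?thesis by (simp add: B_def)
  qed
qed

lemma integral_inner_tendsto:
  assumes "\<And>n. sqint (s n)" "sqint v" "sqint g" "(\<lambda>n. nsq (\<lambda>x. s n x - v x)) \<longlonglongrightarrow> 0"
  shows "(\<lambda>n. (LINT x|HM. s n x \<bullet> g x)) \<longlonglongrightarrow> (LINT x|HM. v x \<bullet> g x)"
proof -
  have "(\<lambda>n. (LINT x|HM. s n x \<bullet> g x) - (LINT x|HM. v x \<bullet> g x)) \<longlonglongrightarrow> 0"
  proof (rule Lim_null_comparison)
    show "\<forall>\<^sub>F n in sequentially. norm ((LINT x|HM. s n x \<bullet> g x) - (LINT x|HM. v x \<bullet> g x))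
         \<le> sqrt (nsq (\<lambda>x. s n x - v x)) * sqrt (nsq g)"
    proof (rule always_eventually, rule allI)
      fix n
      have "(LINT x|HM. s n x \<bullet> g x) - (LINT x|HM. v x \<bullet> g x)
          = (LINT x|HM. (s n x - v x) \<bullet> g x)"
        using assms(1-3) by (simp add: inner_diff_left sqint_inner)
      moreover have "\<bar>(LINT x|HM. (s n x - v x) \<bullet> g x)\<bar> \<le> sqrt (nsq (\<lambda>x. s n x - v x) * nsq g)"
        by (rule real_le_rsqrt) (use nsq_Cauchy_Schwarz[OF sqint_diff(1)[OF assms(1,2)] assms(3)] in simp)
      ultimately show "norm ((LINT x|HM. s n x \<bullet> g x) - (LINT x|HM. v x \<bullet> g x))
         \<le> sqrt (nsq (\<lambda>x. s n x - v x)) * sqrt (nsq g)"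
        by (simp add: real_sqrt_mult)
    qed
    have "(\<lambda>n. sqrt (nsq (\<lambda>x. s n x - v x)) * sqrt (nsq g)) \<longlonglongrightarrow> sqrt 0 * sqrt (nsq g)"
      by (intro tendsto_mult tendsto_real_sqrt assms(4) tendsto_const)
    then show "(\<lambda>n. sqrt (nsq (\<lambda>x. s n x - v x)) * sqrt (nsq g)) \<longlonglongrightarrow> 0" by simp
  qed
  then show ?thesis by (simp add: LIM_zero_iff)
qed

text \<open>Fatou's lemma for squared norms. It supplies membership in L2 of limits that are known
  only almost everywhere, in the completeness proof and in Caccioppoli's inequality.\<close>

lemma sqint_Fatou:
  fixes g :: "real^2 \<Rightarrow> 'b::euclidean_space"
  assumes m [measurable]: "g \<in> borel_measurable HM" and gn: "\<And>n. sqint (gn n)"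
    and K: "\<forall>\<^sub>F n in sequentially. nsq (gn n) \<le> K" "K \<ge> 0"
    and lim: "AE x in HM. (\<lambda>n. gn n x) \<longlonglongrightarrow> g x"
  shows "sqint g" "nsq g \<le> K"
proof -
  have gm [measurable]: "gn n \<in> borel_measurable HM" for n by (rule sqint_measurable[OF gn])
  have "(\<integral>\<^sup>+x. ennreal ((norm (g x))\<^sup>2) \<partial>HM) = (\<integral>\<^sup>+x. liminf (\<lambda>n. ennreal ((norm (gn n x))\<^sup>2)) \<partial>HM)"
  proof (rule nn_integral_cong_AE)
    show "AE x in HM. ennreal ((norm (g x))\<^sup>2) = liminf (\<lambda>n. ennreal ((norm (gn n x))\<^sup>2))"
      using lim
    proof eventually_elim
      case (elim x)
      then have "(\<lambda>n. ennreal ((norm (gn n x))\<^sup>2)) \<longlonglongrightarrow> ennreal ((norm (g x))\<^sup>2)"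
        by (intro tendsto_ennrealI tendsto_power tendsto_norm)
      from lim_imp_Liminf[OF _ this] show ?case by simp
    qed
  qed
  also have "\<dots> \<le> liminf (\<lambda>n. \<integral>\<^sup>+x. ennreal ((norm (gn n x))\<^sup>2) \<partial>HM)"
    by (rule nn_integral_liminf) measurable
  also have "\<dots> \<le> limsup (\<lambda>n. \<integral>\<^sup>+x. ennreal ((norm (gn n x))\<^sup>2) \<partial>HM)"
    by (rule Liminf_le_Limsup) simp
  also have "\<dots> \<le> ennreal K"
  proof (rule Limsup_bounded, rule eventually_mono[OF K(1)])
    fix n assume "nsq (gn n) \<le> K"
    moreover have "(\<integral>\<^sup>+x. ennreal ((norm (gn n x))\<^sup>2) \<partial>HM) = ennreal (nsq (gn n))"
      unfolding nsq_def by (rule nn_integral_eq_integral[OF sqint_integrable_sq[OF gn]]) simp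
    ultimately show "(\<integral>\<^sup>+x. ennreal ((norm (gn n x))\<^sup>2) \<partial>HM) \<le> ennreal K" by (simp add: ennreal_leI)
  qed
  finally have fin: "(\<integral>\<^sup>+x. ennreal ((norm (g x))\<^sup>2) \<partial>HM) \<le> ennreal K" .
  have i: "integrable HM (\<lambda>x. (norm (g x))\<^sup>2)"
    by (rule integrableI_bounded) (use fin in \<open>auto intro: le_less_trans\<close>)
  then show "sqint g" using m by (simp add: sqint_def)
  have "ennreal (nsq g) \<le> ennreal K"
    using fin unfolding nsq_def by (subst nn_integral_eq_integral[symmetric, OF i]) auto
  then show "nsq g \<le> K" using K(2) by (simp add: ennreal_le_iff)
qed

text \<open>Riesz-Fischer. The disk has finite measure, so an L2-Cauchy sequence is L1-Cauchy and
  has a subsequence converging almost everywhere; Fatou along that subsequence, with the other index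
  fixed, returns to the L2 norm.\<close>

lemma sqint_complete:
  fixes s :: "nat \<Rightarrow> real^2 \<Rightarrow> 'b::euclidean_space"
  assumes s: "\<And>n. sqint (s n)"
    and cauchy: "\<And>e. e > 0 \<Longrightarrow> \<exists>N. \<forall>i\<ge>N. \<forall>j\<ge>N. nsq (\<lambda>x. s i x - s j x) < e"
  obtains v where "sqint v" "(\<lambda>n. nsq (\<lambda>x. s n x - v x)) \<longlonglongrightarrow> 0"
proof -
  have m [measurable]: "s n \<in> borel_measurable HM" for n
    by (rule sqint_measurable[OF s])
  have 1: "integrable HM (s n)" for n
  proof -
    have "sqint (\<lambda>x. norm (s n x))" using s[of n] by (simp add: sqint_def)
    then show ?thesis
      using integrable_norm_iff[OF m[of n]] sqint_integrable by blast
  qed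
  have L1: "\<exists>N. \<forall>i\<ge>N. \<forall>j\<ge>N. (LINT x|HM. norm (s i x - s j x)) < e" if "e > 0" for e
  proof -
    \<comment> \<open>The area of the disk, enlarged by one to make positivity immediate.\<close>
    define V where "V = nsq (\<lambda>x::real^2. 1::real) + 1"
    have V: "V > 0" using nsq_nonneg[of "\<lambda>x::real^2. 1::real"] by (simp add: V_def)
    have "e\<^sup>2 / V > 0" using V that by simp
    from cauchy[OF this] obtain N
      where N: "\<forall>i\<ge>N. \<forall>j\<ge>N. nsq (\<lambda>x. s i x - s j x) < e\<^sup>2 / V" by blast
    have "(LINT x|HM. norm (s i x - s j x)) < e" if ij: "i \<ge> N" "j \<ge> N" for i j
    proof -
      have "(LINT x|HM. norm (s i x - s j x) \<bullet> 1)\<^sup>2 \<le> nsq (\<lambda>x. norm (s i x - s j x)) * nsq (\<lambda>x::real^2. 1::real)"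
        by (rule nsq_Cauchy_Schwarz) (use sqint_diff(1)[OF s s, of i j] sqint_bounded[of "\<lambda>_. 1::real" 1] in \<open>auto simp: sqint_def\<close>)
      also have "nsq (\<lambda>x. norm (s i x - s j x)) = nsq (\<lambda>x. s i x - s j x)" by (simp add: nsq_def)
      also have "nsq (\<lambda>x. s i x - s j x) * nsq (\<lambda>x::real^2. 1::real) \<le> nsq (\<lambda>x. s i x - s j x) * V"
        by (intro mult_left_mono nsq_nonneg) (simp add: V_def)
      also have "\<dots> < e\<^sup>2"
        using N[rule_format, OF ij] V by (simp add: field_simps)
      finally show ?thesis using \<open>e > 0\<close> by (simp add: power2_less_imp_less)
    qed
    then show ?thesis by blast
  qed
  obtain r where r: "strict_mono r" "AE x in HM. Cauchy (\<lambda>i. s (r i) x)"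
    using cauchy_L1_AE_cauchy_subseq[OF 1 L1] by blast
  define v where "v x = lim (\<lambda>i. s (r i) x)" for x
  have vm [measurable]: "v \<in> borel_measurable HM"
    unfolding v_def by (rule borel_measurable_lim_metric) (rule m)
  have lim: "AE x in HM. (\<lambda>i. s (r i) x) \<longlonglongrightarrow> v x"
    using r(2) by eventually_elim (simp add: v_def Cauchy_convergent_iff convergent_LIMSEQ_iff)
  have key: "sqint (\<lambda>x. s n x - v x)" "nsq (\<lambda>x. s n x - v x) \<le> e"
    if "e > 0" and N: "\<And>i j. i \<ge> N \<Longrightarrow> j \<ge> N \<Longrightarrow> nsq (\<lambda>x. s i x - s j x) < e" and n: "n \<ge> N" for e N n
  proof -
    have m': "(\<lambda>x. s n x - v x) \<in> borel_measurable HM" by measurable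
    have d: "sqint (\<lambda>x. s n x - s (r i) x)" for i by (rule sqint_diff(1)[OF s s])
    have e: "\<forall>\<^sub>F i in sequentially. nsq (\<lambda>x. s n x - s (r i) x) \<le> e"
    proof (rule eventually_sequentiallyI[of N])
      fix i assume "i \<ge> N"
      then have "r i \<ge> N" using seq_suble[OF r(1), of i] by simp
      then show "nsq (\<lambda>x. s n x - s (r i) x) \<le> e" using N[OF n, of "r i"] by simp
    qed
    have l: "AE x in HM. (\<lambda>i. s n x - s (r i) x) \<longlonglongrightarrow> s n x - v x"
      using lim by eventually_elim (intro tendsto_diff tendsto_const)
    show "sqint (\<lambda>x. s n x - v x)" "nsq (\<lambda>x. s n x - v x) \<le> e"
      using sqint_Fatou[OF m' d e less_imp_le[OF that(1)] l] by auto
  qed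
  obtain N1 where N1: "\<And>i j. i \<ge> N1 \<Longrightarrow> j \<ge> N1 \<Longrightarrow> nsq (\<lambda>x. s i x - s j x) < 1"
    using cauchy[OF zero_less_one] by blast
  have "sqint (\<lambda>x. s N1 x - v x)" by (rule key(1)[OF zero_less_one N1 order_refl])
  from sqint_diff(1)[OF s[of N1] this] have "sqint v" by simp
  moreover have "(\<lambda>n. nsq (\<lambda>x. s n x - v x)) \<longlonglongrightarrow> 0"
  proof (rule LIMSEQ_I)
    fix e :: real assume "e > 0"
    then obtain N where N: "\<And>i j. i \<ge> N \<Longrightarrow> j \<ge> N \<Longrightarrow> nsq (\<lambda>x. s i x - s j x) < e / 2"
      using cauchy[OF half_gt_zero] by blast
    have "norm (nsq (\<lambda>x. s n x - v x) - 0) < e" if "n \<ge> N" for n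
      using key(2)[OF _ N that] \<open>e > 0\<close> nsq_nonneg[of "\<lambda>x. s n x - v x"] by simp
    then show "\<exists>no. \<forall>n\<ge>no. norm (nsq (\<lambda>x. s n x - v x) - 0) < e" by blast
  qed
  ultimately show thesis using that by blast
qed

text \<open>\<open>P\<close> describes a linear subspace that need not be closed. The projection
  \<open>v\<close> is delivered with a sequence from \<open>P\<close> converging to it, because the
  concrete approximants (rotated gradients of test functions) are what the construction of the
  stream function starts from.\<close>

lemma sqint_projection:
  fixes P :: "(real^2 \<Rightarrow> 'b::euclidean_space) \<Rightarrow> bool"
  assumes u: "sqint u" and P: "\<And>s. P s \<Longrightarrow> sqint s" "P (\<lambda>x. 0)"
    and lin: "\<And>s t c. P s \<Longrightarrow> P t \<Longrightarrow> P (\<lambda>x. s x + c *\<^sub>R t x)"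
  obtains s v where "\<And>n. P (s n)" "sqint v" "(\<lambda>n. nsq (\<lambda>x. s n x - v x)) \<longlonglongrightarrow> 0"
    "\<And>t. P t \<Longrightarrow> (LINT x|HM. (u x - v x) \<bullet> t x) = 0"
proof -
  define E where "E s = nsq (\<lambda>x. u x - s x)" for s
  define I where "I = Inf (E ` {s. P s})"
  have bdd: "bdd_below (E ` {s. P s})"
    by (intro bdd_belowI[of _ 0]) (auto simp: E_def nsq_nonneg)
  have I_le: "I \<le> E s" if "P s" for s
    unfolding I_def by (rule cInf_lower[OF _ bdd]) (use that in auto)
  have "\<exists>s. P s \<and> E s < I + inverse (real (Suc n))" for n
  proof -
    have "I < I + inverse (real (Suc n))" by simp
    then have "\<exists>y\<in>E ` {s. P s}. y < I + inverse (real (Suc n))"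
      unfolding I_def by (intro cInf_lessD) (use P(2) in auto)
    then show ?thesis by auto
  qed
  then obtain s where s: "\<And>n. P (s n)" "\<And>n. E (s n) < I + inverse (real (Suc n))" by metis
  have sq: "sqint (s n)" for n by (rule P(1)[OF s(1)])
  have lim: "(\<lambda>n. E (s n)) \<longlonglongrightarrow> I"
  proof (rule real_tendsto_sandwich)
    show "\<forall>\<^sub>F n in sequentially. I \<le> E (s n)"
      by (simp add: I_le s(1))
    show "\<forall>\<^sub>F n in sequentially. E (s n) \<le> I + inverse (real (Suc n))"
      using s(2) less_imp_le by (intro always_eventually allI) blast
    show "(\<lambda>n. I) \<longlonglongrightarrow> I" by simp
    show "(\<lambda>n. I + inverse (real (Suc n))) \<longlonglongrightarrow> I"
      using tendsto_add[OF tendsto_const LIMSEQ_inverse_real_of_nat, of I] by simp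
  qed
  \<comment> \<open>The midpoint of \<open>s i\<close> and \<open>s j\<close> belongs to
    \<open>P\<close>, so its squared distance is at least \<open>I\<close>. Eliminating the cross
    term \<open>B\<close> from the two expansions gives the parallelogram estimate.\<close>
  have par: "nsq (\<lambda>x. s i x - s j x) \<le> 2 * (E (s i) - I) + 2 * (E (s j) - I)" for i j
  proof -
    let ?d = "\<lambda>x. s j x - s i x" and ?w = "\<lambda>x. u x - s i x"
    have w: "sqint ?w" and d: "sqint ?d" by (intro sqint_diff u sq)+
    define B where "B = (LINT x|HM. ?w x \<bullet> ?d x)"
    have "P (\<lambda>x. s i x + (1/2) *\<^sub>R (s j x + (-1) *\<^sub>R s i x))"
      by (intro lin s(1))
    then have "I \<le> E (\<lambda>x. s i x + (1/2) *\<^sub>R (s j x + (-1) *\<^sub>R s i x))" by (rule I_le)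
    also have "\<dots> = nsq (\<lambda>x. ?w x + (- (1/2)) *\<^sub>R ?d x)"
      unfolding E_def by (rule arg_cong[where f = nsq]) (auto simp: algebra_simps)
    also have "\<dots> = nsq ?w - B + (1/4) * nsq ?d"
      using nsq_expand[OF w d, of "-(1/2)"] by (simp add: B_def power2_eq_square)
    finally have 1: "I \<le> nsq ?w - B + (1/4) * nsq ?d" .
    have "E (s j) = nsq (\<lambda>x. ?w x + (- 1) *\<^sub>R ?d x)"
      unfolding E_def by (rule arg_cong[where f = nsq]) (auto simp: algebra_simps)
    also have "\<dots> = nsq ?w - 2 * B + nsq ?d"
      using nsq_expand[OF w d, of "-1"] by (simp add: B_def)
    finally have "E (s j) = nsq ?w - 2 * B + nsq ?d" .
    moreover have "E (s i) = nsq ?w" by (simp add: E_def)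
    moreover have "nsq ?d = nsq (\<lambda>x. s i x - s j x)" by (rule nsq_minus_commute)
    ultimately show ?thesis using 1 by (simp add: field_simps)
  qed
  have "\<exists>N. \<forall>i\<ge>N. \<forall>j\<ge>N. nsq (\<lambda>x. s i x - s j x) < e" if e: "e > 0" for e
  proof -
    obtain N where N: "\<forall>n\<ge>N. norm (E (s n) - I) < e / 4"
      using LIMSEQ_D[OF lim, of "e / 4"] e by auto
    have "nsq (\<lambda>x. s i x - s j x) < e" if "i \<ge> N" "j \<ge> N" for i j
      using par[of i j] N[rule_format, OF that(1)] N[rule_format, OF that(2)] by (simp add: abs_if split: if_splits)
    then show ?thesis by blast
  qed
  then obtain v where v: "sqint v" "(\<lambda>n. nsq (\<lambda>x. s n x - v x)) \<longlonglongrightarrow> 0"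
    using sqint_complete[of s, OF sq] by blast
  have orth: "(LINT x|HM. (u x - v x) \<bullet> t x) = 0" if "P t" for t
  proof -
    have t: "sqint t" by (rule P(1)[OF that])
    define B where "B = (LINT x|HM. (u x - v x) \<bullet> t x)"
    have "(\<lambda>n. (LINT x|HM. (u x - s n x) \<bullet> t x)) \<longlonglongrightarrow> B"
      unfolding B_def
    proof (rule integral_inner_tendsto[OF sqint_diff(1)[OF u sq] sqint_diff(1)[OF u v(1)] t])
      have "(\<lambda>x. u x - s n x - (u x - v x)) = (\<lambda>x. v x - s n x)" for n by auto
      then show "(\<lambda>n. nsq (\<lambda>x. u x - s n x - (u x - v x))) \<longlonglongrightarrow> 0"
        using v(2) nsq_minus_commute[of v] by simp
    qed
    then have "(\<lambda>n. E (s n) - 2 * c * (LINT x|HM. (u x - s n x) \<bullet> t x) + c\<^sup>2 * nsq t)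
        \<longlonglongrightarrow> I - 2 * c * B + c\<^sup>2 * nsq t" for c
      by (intro tendsto_add tendsto_diff tendsto_mult tendsto_const lim)
    moreover have "I \<le> E (s n) - 2 * c * (LINT x|HM. (u x - s n x) \<bullet> t x) + c\<^sup>2 * nsq t" for n c
    proof -
      have "I \<le> E (\<lambda>x. s n x + c *\<^sub>R t x)"
        by (intro I_le lin s(1) that)
      also have "\<dots> = nsq (\<lambda>x. (u x - s n x) + (- c) *\<^sub>R t x)"
        unfolding E_def by (rule arg_cong[where f = nsq]) (auto simp: algebra_simps)
      also have "\<dots> = E (s n) - 2 * c * (LINT x|HM. (u x - s n x) \<bullet> t x) + c\<^sup>2 * nsq t"
        using nsq_expand[OF sqint_diff(1)[OF u sq] t, of n "- c"] by (simp add: E_def)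
      finally show ?thesis .
    qed
    ultimately have *: "I \<le> I - 2 * c * B + c\<^sup>2 * nsq t" for c
      by (meson LIMSEQ_le_const)
    show ?thesis
    proof (rule ccontr)
      assume "(LINT x|HM. (u x - v x) \<bullet> t x) \<noteq> 0"
      then have B: "B \<noteq> 0" by (simp add: B_def)
      \<comment> \<open>The first variation of the distance must vanish: the competitor
        \<open>c = B / n\<close> beats the minimum unless \<open>B = 0\<close>. Adding one keeps the
        denominator positive when \<open>t\<close> is null.\<close>
      define n where "n = nsq t + 1"
      have n: "n > 0" using nsq_nonneg[of t] by (simp add: n_def)
      have "2 * (B / n) * B \<le> (B / n)\<^sup>2 * nsq t" using *[of "B / n"] by simp
      also have "\<dots> \<le> (B / n)\<^sup>2 * n" by (intro mult_left_mono) (auto simp: n_def)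
      also have "\<dots> = (B / n) * B" using n by (simp add: power2_eq_square)
      finally have "(B / n) * B \<le> 0" by simp
      moreover have "(B / n) * B > 0" using B n by (auto simp: zero_less_mult_iff zero_less_divide_iff linorder_neq_iff)
      ultimately show False by simp
    qed
  qed
  show thesis by (rule that[OF s(1) v orth])
qed

section \<open>Mollification\<close>

text \<open>The integral runs over the disk, which amounts to extending \<open>f\<close> by zero. A
  weak equation on the disk is therefore inherited only at points where the translated kernel is
  supported inside the disk, unless \<open>f\<close> has compact support.\<close>

definition conv :: "(real^2 \<Rightarrow> real) \<Rightarrow> (real^2 \<Rightarrow> real) \<Rightarrow> real^2 \<Rightarrow> real" where
  "conv \<eta> f x = (LINT y|HM. \<eta> (x - y) * f y)"

lemma pd_line_dir:
  assumes "f differentiable (at (z + t *\<^sub>R h))"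
  shows "((\<lambda>t. f (z + t *\<^sub>R h)) has_real_derivative (\<Sum>i\<in>UNIV. pd i f (z + t *\<^sub>R h) * h $ i)) (at t)"
proof -
  have "((\<lambda>t. z + t *\<^sub>R h) has_derivative (\<lambda>t. t *\<^sub>R h)) (at t)"
    by (auto intro!: derivative_eq_intros)
  then have "((\<lambda>t. f (z + t *\<^sub>R h)) has_derivative (\<lambda>s. \<Sum>i\<in>UNIV. pd i f (z + t *\<^sub>R h) * (s *\<^sub>R h) $ i)) (at t)"
    by (rule has_derivative_compose[where g = f and f = "\<lambda>t. z + t *\<^sub>R h", OF _ has_derivative_pd[OF assms]])
  moreover have "(\<lambda>s. \<Sum>i\<in>UNIV. pd i f (z + t *\<^sub>R h) * (s *\<^sub>R h) $ i) = (*) (\<Sum>i\<in>UNIV. pd i f (z + t *\<^sub>R h) * h $ i)"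
    by (rule ext) (simp add: sum_distrib_left algebra_simps)
  ultimately show ?thesis by (simp add: has_field_derivative_def)
qed

lemma uniformly_continuous_bounded_support:
  fixes f :: "real^2 \<Rightarrow> real"
  assumes c: "continuous_on UNIV f" and R: "\<And>x. norm x > R \<Longrightarrow> f x = 0" and e: "e > 0"
  obtains d where "d > 0" "\<And>x y. norm (x - y) < d \<Longrightarrow> \<bar>f x - f y\<bar> < e"
proof -
  have "uniformly_continuous_on (cball 0 (R + 1)) f"
    by (intro compact_uniformly_continuous continuous_on_subset[OF c] compact_cball) auto
  then obtain d where d: "d > 0" "\<And>x y. x \<in> cball 0 (R + 1) \<Longrightarrow> y \<in> cball 0 (R + 1) \<Longrightarrow> dist y x < d \<Longrightarrow> dist (f y) (f x) < e"
    unfolding uniformly_continuous_on_def using e by blast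
  show thesis
  proof (rule that[of "min d 1"])
    fix x y :: "real^2" assume xy: "norm (x - y) < min d 1"
    show "\<bar>f x - f y\<bar> < e"
    proof (cases "norm x \<le> R + 1 \<and> norm y \<le> R + 1")
      case True
      then show ?thesis using d(2)[of y x] xy by (simp add: dist_norm)
    next
      case False
      have "norm x \<le> norm y + norm (x - y)" "norm y \<le> norm x + norm (x - y)"
        using norm_triangle_sub[of x y] norm_triangle_sub[of y x] by (simp_all add: norm_minus_commute)
      then have "norm x > R" "norm y > R" using False xy by auto
      then show ?thesis using R e by simp
    qed
  qed (use d in simp)
qed

text \<open>Uniform continuity of the partial derivatives makes the first-order Taylor error uniform
  in the base point \<open>z\<close>; this is what justifies differentiating \<open>conv\<close>
  under the integral sign.\<close>

lemma uniform_differentiability: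
  fixes f :: "real^2 \<Rightarrow> real"
  assumes f: "smooth_fun UNIV f" and R: "\<And>x. norm x > R \<Longrightarrow> f x = 0" and e: "e > 0"
  obtains d where "d > 0"
    "\<And>z h. norm h < d \<Longrightarrow> \<bar>f (z + h) - f z - (\<Sum>i\<in>UNIV. pd i f z * h $ i)\<bar> \<le> e * norm h"
proof -
  have dd: "\<exists>d>0. \<forall>x y. norm (x - y) < d \<longrightarrow> \<bar>pd i f x - pd i f y\<bar> < e / 2" for i
  proof -
    have c: "continuous_on UNIV (pd i f)" by (rule smooth_fun_continuous[OF smooth_fun_pd[OF f]])
    have z: "\<And>x. norm x > R \<Longrightarrow> pd i f x = 0" by (rule pd_support[OF R])
    show ?thesis
    proof (rule uniformly_continuous_bounded_support[OF c z half_gt_zero[OF e]])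
      fix d assume "d > 0" "\<And>x y. norm (x - y) < d \<Longrightarrow> \<bar>pd i f x - pd i f y\<bar> < e / 2"
      then show ?thesis by (intro exI[of _ d] conjI allI impI)
    qed
  qed
  have "\<exists>d. \<forall>i. d i > 0 \<and> (\<forall>x y. norm (x - y) < d i \<longrightarrow> \<bar>pd i f x - pd i f y\<bar> < e / 2)"
    by (rule choice) (use dd in simp)
  then obtain d where d': "\<forall>i. d i > 0 \<and> (\<forall>x y. norm (x - y) < d i \<longrightarrow> \<bar>pd i f x - pd i f y\<bar> < e / 2)" ..
  then have d: "\<And>i. d i > 0" "\<And>i x y. norm (x - y) < d i \<Longrightarrow> \<bar>pd i f x - pd i f y\<bar> < e / 2"
    by simp_all
  show thesis
  proof (rule that[of "min (d 1) (d 2)"])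
    fix z h :: "real^2" assume h: "norm h < min (d 1) (d 2)"
    have hd: "norm h < d i" for i using h exhaust_2[of i] by auto
    have "\<exists>t. 0 < t \<and> t < 1 \<and> f (z + 1 *\<^sub>R h) - f (z + 0 *\<^sub>R h) = (1 - 0) * (\<Sum>i\<in>UNIV. pd i f (z + t *\<^sub>R h) * h $ i)"
      by (rule MVT2[OF zero_less_one], rule pd_line_dir, rule smooth_fun_differentiable[OF f]) simp
    then obtain t where t: "0 < t" "t < 1" "f (z + h) - f z = (\<Sum>i\<in>UNIV. pd i f (z + t *\<^sub>R h) * h $ i)"
      by auto
    have "\<bar>f (z + h) - f z - (\<Sum>i\<in>UNIV. pd i f z * h $ i)\<bar> = \<bar>\<Sum>i\<in>UNIV. (pd i f (z + t *\<^sub>R h) - pd i f z) * h $ i\<bar>"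
      unfolding t(3) by (simp add: sum_subtractf left_diff_distrib)
    also have "\<dots> \<le> (\<Sum>i\<in>UNIV. \<bar>(pd i f (z + t *\<^sub>R h) - pd i f z) * h $ i\<bar>)"
      by (rule sum_abs)
    also have "\<dots> \<le> (\<Sum>i\<in>(UNIV::2 set). e / 2 * norm h)"
    proof (rule sum_mono)
      fix i :: 2
      have "norm (t *\<^sub>R h) \<le> norm h" using t mult_right_mono[of t 1 "norm h"] by simp
      then have "\<bar>pd i f (z + t *\<^sub>R h) - pd i f z\<bar> \<le> e / 2"
        using d(2)[of "z + t *\<^sub>R h" z i] hd[of i] by simp
      then show "\<bar>(pd i f (z + t *\<^sub>R h) - pd i f z) * h $ i\<bar> \<le> e / 2 * norm h"
        unfolding abs_mult by (intro mult_mono component_le_norm_cart) (use e in auto)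
    qed
    also have "\<dots> = e * norm h" by (simp add: sum_2)
    finally show "\<bar>f (z + h) - f z - (\<Sum>i\<in>UNIV. pd i f z * h $ i)\<bar> \<le> e * norm h" .
  qed (use d in simp)
qed

locale kernel =
  fixes \<eta> :: "real^2 \<Rightarrow> real" and R :: real
  assumes smooth: "smooth_fun UNIV \<eta>" and support: "\<And>x. norm x > R \<Longrightarrow> \<eta> x = 0"
begin

lemma kernel_pd: "kernel (pd i \<eta>) R"
  by unfold_locales (auto intro: smooth_fun_pd[OF smooth] pd_support[OF support])

lemma bounded: obtains B where "B > 0" "\<And>z. \<bar>\<eta> z\<bar> \<le> B"
  using continuous_bounded_support[OF smooth_fun_continuous[OF smooth] support] by blast

lemma measurable_translate: "(\<lambda>y. \<eta> (x - y)) \<in> borel_measurable HM"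
  by (rule continuous_HM_measurable, rule smooth_fun_continuous,
      rule smooth_fun_subset[OF smooth_fun_reflect[OF smooth]]) simp

lemma sqint_translate_mult:
  assumes "sqint f"
  shows "sqint (\<lambda>y. \<eta> (x - y) * f y)"
proof -
  obtain B where "\<And>z. \<bar>\<eta> z\<bar> \<le> B" using bounded by blast
  then show ?thesis
    using sqint_mult_bounded(1)[OF assms measurable_translate, of x B] by simp
qed

lemma integrable_translate_mult: "sqint f \<Longrightarrow> integrable HM (\<lambda>y. \<eta> (x - y) * f y)"
  by (intro sqint_integrable sqint_translate_mult)

lemma conv_has_derivative:
  assumes f: "sqint f"
  shows "(conv \<eta> f has_derivative (\<lambda>h. \<Sum>i\<in>UNIV. conv (pd i \<eta>) f x * h $ i)) (at x)"
  unfolding has_derivative_at_alt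
proof (intro conjI allI impI)
  show "bounded_linear (\<lambda>h. \<Sum>i\<in>UNIV. conv (pd i \<eta>) f x * h $ i)"
    by (intro bounded_linear_sum bounded_linear_const_mult bounded_linear_vec_nth)
  fix e :: real assume e: "e > 0"
  \<comment> \<open>The L1 norm of \<open>f\<close> plus one, so that a Taylor error of at most
    \<open>e / A * norm h\<close> integrates to at most \<open>e * norm h\<close>, also when
    \<open>f\<close> is null.\<close>
  define A where "A = (LINT y|HM. \<bar>f y\<bar>) + 1"
  have A: "A > 0" by (simp add: A_def add_nonneg_pos)
  obtain d where d: "d > 0"
    "\<And>z h. norm h < d \<Longrightarrow> \<bar>\<eta> (z + h) - \<eta> z - (\<Sum>i\<in>UNIV. pd i \<eta> z * h $ i)\<bar> \<le> e / A * norm h"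
    using uniform_differentiability[OF smooth support divide_pos_pos[OF e A]] by blast
  have int: "integrable HM (\<lambda>y. \<eta> (z - y) * f y)" "integrable HM (\<lambda>y. pd i \<eta> (z - y) * f y)" for z i
    using integrable_translate_mult[OF f] kernel.integrable_translate_mult[OF kernel_pd f] by auto
  have "norm (conv \<eta> f y - conv \<eta> f x - (\<Sum>i\<in>UNIV. conv (pd i \<eta>) f x * (y - x) $ i)) \<le> e * norm (y - x)"
    if y: "norm (y - x) < d" for y
  proof -
    define h where "h = y - x"
    let ?g = "\<lambda>z. \<eta> (y - z) * f z - \<eta> (x - z) * f z - (\<Sum>i\<in>UNIV. pd i \<eta> (x - z) * f z * h $ i)"
    have gi: "integrable HM ?g" by (intro Bochner_Integration.integrable_diff Bochner_Integration.integrable_sum integrable_mult_left int)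
    have "conv \<eta> f y - conv \<eta> f x - (\<Sum>i\<in>UNIV. conv (pd i \<eta>) f x * (y - x) $ i) = integral\<^sup>L HM ?g"
      unfolding conv_def h_def using int by (simp add: Bochner_Integration.integral_sum)
    also have "norm \<dots> \<le> (LINT z|HM. e / A * norm h * \<bar>f z\<bar>)"
    proof (rule Bochner_Integration.integral_norm_bound_integral[OF gi])
      show "integrable HM (\<lambda>z. e / A * norm h * \<bar>f z\<bar>)"
        using sqint_integrable[OF f] by simp
      fix z
      have "?g z = (\<eta> ((x - z) + h) - \<eta> (x - z) - (\<Sum>i\<in>UNIV. pd i \<eta> (x - z) * h $ i)) * f z"
        by (simp add: h_def sum_2 algebra_simps)
      then have "norm (?g z) = \<bar>\<eta> ((x - z) + h) - \<eta> (x - z) - (\<Sum>i\<in>UNIV. pd i \<eta> (x - z) * h $ i)\<bar> * \<bar>f z\<bar>"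
        by (simp add: abs_mult)
      also have "\<dots> \<le> e / A * norm h * \<bar>f z\<bar>"
        by (intro mult_right_mono d(2)) (use y in \<open>auto simp: h_def\<close>)
      finally show "norm (?g z) \<le> e / A * norm h * \<bar>f z\<bar>" .
    qed
    also have "\<dots> = e * norm h * ((LINT y|HM. \<bar>f y\<bar>) / A)" by simp
    also have "\<dots> \<le> e * norm h * 1"
      using A e by (intro mult_left_mono) (auto simp: A_def)
    finally show ?thesis by (simp add: h_def)
  qed
  then show "\<exists>d>0. \<forall>y. norm (y - x) < d \<longrightarrow>
       norm (conv \<eta> f y - conv \<eta> f x - (\<Sum>i\<in>UNIV. conv (pd i \<eta>) f x * (y - x) $ i)) \<le> e * norm (y - x)"
    using d(1) by blast
qed

lemma pd_conv: assumes "sqint f" shows "pd i (conv \<eta> f) = conv (pd i \<eta>) f"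
proof
  fix x
  show "pd i (conv \<eta> f) x = conv (pd i \<eta>) f x"
    using exhaust_2[of i] by (auto simp: pd_eq[OF conv_has_derivative[OF assms]] sum_2 axis_def)
qed

end

text \<open>All derivatives fall on the kernel, and partial derivatives of a kernel are kernels of
  the same radius, so the induction generalises over the kernel.\<close>

lemma smooth_conv:
  assumes "kernel \<eta> R" "sqint f"
  shows "smooth_fun UNIV (conv \<eta> f)"
proof -
  have "Ck_on k UNIV (conv \<eta> f)" if "kernel \<eta> R" for k \<eta>
    using that
  proof (induction k arbitrary: \<eta>)
    case 0
    have "continuous_on UNIV (conv \<eta> f)"
      by (rule differentiable_continuous_on)
        (use kernel.conv_has_derivative[OF 0 assms(2)] in \<open>auto simp: differentiable_def\<close>)
    then show ?case by simp
  next
    case (Suc k)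
    have "conv \<eta> f differentiable (at x)" for x
      using kernel.conv_has_derivative[OF Suc.prems assms(2)] unfolding differentiable_def by blast
    moreover have "Ck_on k UNIV (pd i (conv \<eta> f))" for i
      unfolding kernel.pd_conv[OF Suc.prems assms(2)]
      by (rule Suc.IH[OF kernel.kernel_pd[OF Suc.prems]])
    ultimately show ?case by simp
  qed
  then show ?thesis using assms(1) by (simp add: smooth_fun_def)
qed

subsection \<open>A family of mollifiers\<close>

definition radial_const :: real where
  "radial_const = integral\<^sup>L lborel (\<lambda>z::real^2. dstep ((norm z)\<^sup>2))"

text \<open>The parameter is an inverse scale: the kernel lives on the annulus
  \<open>1 \<le> k^2 |z|^2 \<le> 2\<close>, and \<open>2 / k\<close> is used as a convenient upper
  bound for its radius.\<close>

definition mol :: "real \<Rightarrow> real^2 \<Rightarrow> real" where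
  "mol k z = k\<^sup>2 * dstep (k\<^sup>2 * (norm z)\<^sup>2) / radial_const"

text \<open>The field \<open>z / |z|^2\<close> is divergence-free off the origin, so the divergence
  of \<open>step (k^2 |z|^2)\<close> times it is \<open>2 k^2 dstep (k^2 |z|^2)\<close>, a multiple
  of \<open>mol k\<close>. In the difference of two scales the far fields cancel as well.\<close>

definition rad_diff :: "real \<Rightarrow> real \<Rightarrow> real^2 \<Rightarrow> real" where
  "rad_diff k l z = (step (k\<^sup>2 * (norm z)\<^sup>2) - step (l\<^sup>2 * (norm z)\<^sup>2)) * inverse ((norm z)\<^sup>2)"

lemma smooth_norm_sq_scaled: "open S \<Longrightarrow> smooth_fun S (\<lambda>z. k * (norm z)\<^sup>2)"
  by (intro smooth_fun_mult smooth_fun_const smooth_fun_norm_sq)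

lemma pd_norm_sq_scaled: "pd i (\<lambda>z. k * (norm z)\<^sup>2) x = k * (2 * x $ i)"
  using pd_cmult[OF smooth_fun_differentiable[OF smooth_fun_norm_sq[OF open_UNIV] UNIV_I]]
  by (simp add: pd_norm_sq)

lemma norm_gt_scaled: "k > 0 \<Longrightarrow> norm z > 2 / k \<Longrightarrow> k\<^sup>2 * (norm (z::real^2))\<^sup>2 \<ge> 2"
proof -
  assume "k > 0" "norm z > 2 / k"
  then have "2 \<le> k * norm z" by (simp add: field_simps)
  then have "2\<^sup>2 \<le> (k * norm z)\<^sup>2" by (intro power_mono) auto
  then show ?thesis by (simp add: power_mult_distrib)
qed

lemma norm_le_scaled: "k > 0 \<Longrightarrow> norm z < 1 / k \<Longrightarrow> k\<^sup>2 * (norm (z::real^2))\<^sup>2 \<le> 1"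
proof -
  assume "k > 0" "norm z < 1 / k"
  then have "k * norm z \<le> 1" by (simp add: field_simps)
  then have "(k * norm z)\<^sup>2 \<le> 1\<^sup>2" by (intro power_mono) (use \<open>k > 0\<close> in auto)
  then show ?thesis by (simp add: power_mult_distrib)
qed

lemma smooth_radial: "smooth_fun UNIV (\<lambda>z::real^2. dstep (k * (norm z)\<^sup>2))"
  by (rule smooth_fun_compose[OF open_UNIV C1_dstep smooth_norm_sq_scaled[OF open_UNIV]])

lemma radial_const_pos: "radial_const > 0"
proof -
  let ?f = "\<lambda>z::real^2. dstep ((norm z)\<^sup>2)"
  have c: "continuous_on UNIV ?f"
    using smooth_fun_continuous[OF smooth_radial[of 1]] by simp
  have z: "?f z = 0" if "norm z > 2" for z
    using norm_gt_scaled[of 1 z] that by (simp add: dstep_eq_0)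
  obtain B where B: "\<And>z. \<bar>?f z\<bar> \<le> B"
    using continuous_bounded_support[OF c z] by blast
  have i: "integrable lborel ?f"
    by (rule integrable_lborel_bounded_support[OF borel_measurable_continuous_onI[OF c] B z])
  have "radial_const \<noteq> 0"
  proof
    assume "radial_const = 0"
    then have "AE z in lborel. ?f z = 0"
      unfolding radial_const_def using integral_nonneg_eq_0_iff_AE[OF i] dstep_nonneg by simp
    moreover have o: "open {z. ?f z \<noteq> 0}"
      using continuous_open_preimage[OF c open_UNIV open_Compl[OF closed_singleton[of 0]]] by (simp add: vimage_def)
    ultimately have "{z. ?f z \<noteq> 0} \<in> null_sets lborel"
      using AE_iff_measurable[of "{z. ?f z \<noteq> 0}" lborel "\<lambda>z. ?f z = 0"] by (simp add: null_sets_def)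
    then have "negligible {z. ?f z \<noteq> 0}"
      unfolding negligible_iff_null_sets by (rule null_sets_completionI)
    \<comment> \<open>A point with squared norm \<open>3/2\<close>, the middle of the support: the
      open set where the integrand is nonzero is inhabited and so cannot be null.\<close>
    moreover have "sqrt (3/2) *\<^sub>R axis 1 1 \<in> {z. ?f z \<noteq> 0}"
      using dstep_pos[of "3/2"] by (simp add: norm_axis_1)
    ultimately show False using o open_not_negligible by blast
  qed
  moreover have "radial_const \<ge> 0"
    unfolding radial_const_def by (rule Bochner_Integration.integral_nonneg) (rule dstep_nonneg)
  ultimately show ?thesis by simp
qed

lemma kernel_mol: "k > 0 \<Longrightarrow> kernel (mol k) (2 / k)"
proof
  assume "k > 0"
  have "smooth_fun UNIV (\<lambda>z::real^2. (k\<^sup>2 / radial_const) * dstep (k\<^sup>2 * (norm z)\<^sup>2))"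
    by (intro smooth_fun_mult open_UNIV smooth_fun_const smooth_radial)
  then show "smooth_fun UNIV (mol k)" by (simp add: mol_def[abs_def])
  show "mol k z = 0" if "norm z > 2 / k" for z
    using norm_gt_scaled[OF \<open>k > 0\<close> that] by (simp add: mol_def dstep_eq_0)
qed

lemma mol_nonneg: "mol k z \<ge> 0"
  using radial_const_pos by (simp add: mol_def dstep_nonneg)

lemma integral_mol_1: "integral\<^sup>L lborel (mol 1) = 1"
  using radial_const_pos by (simp add: mol_def[abs_def] radial_const_def)

text \<open>The mollifiers at two scales differ by the divergence of a compactly supported gradient field, because
  they vanish near the origin and so does the difference of the two potentials.\<close>

lemma rad_diff_field:
  assumes "k > 0" "l > 0"
  shows smooth_rad_diff: "smooth_fun UNIV (\<lambda>z. z $ i * rad_diff k l z)"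
    and rad_diff_far: "norm z > max (2 / k) (2 / l) \<Longrightarrow> rad_diff k l z = 0"
    and rad_diff_div: "pd 1 (\<lambda>z. z $ 1 * rad_diff k l z) z + pd 2 (\<lambda>z. z $ 2 * rad_diff k l z) z
        = 2 * radial_const * (mol k z - mol l z)"
    and rad_diff_curl: "pd 1 (\<lambda>z. z $ 2 * rad_diff k l z) z = pd 2 (\<lambda>z. z $ 1 * rad_diff k l z) z"
proof -
  let ?K = "rad_diff k l"
  define d where "d = min (1 / k) (1 / l)"
  have d: "d > 0" using assms by (simp add: d_def)
  have near: "?K z = 0" "mol k z = 0" "mol l z = 0" if "z \<in> ball 0 d" for z
    using norm_le_scaled[of k z] norm_le_scaled[of l z] assms that
    by (auto simp: rad_diff_def d_def step_le_1 mol_def dstep_eq_0)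
  have far: "?K z = 0" if "norm z > max (2 / k) (2 / l)" for z
    using norm_gt_scaled[of k z] norm_gt_scaled[of l z] assms that by (simp add: rad_diff_def step_ge_2)
  have o: "open (- {0 :: real^2})" by auto
  have sst: "smooth_fun (- {0}) (\<lambda>z::real^2. step (k\<^sup>2 * (norm z)\<^sup>2) - step (l\<^sup>2 * (norm z)\<^sup>2))"
    by (intro smooth_fun_diff smooth_fun_compose[OF o C1_step] smooth_norm_sq_scaled o)
  have sinv: "smooth_fun (- {0}) (\<lambda>z::real^2. inverse ((norm z)\<^sup>2))"
    by (intro smooth_fun_inverse smooth_fun_norm_sq o) auto
  have sK: "smooth_fun (- {0}) ?K"
    unfolding rad_diff_def[abs_def] by (intro smooth_fun_mult o sst sinv)
  \<comment> \<open>Near the origin both steps vanish, so the singular factor is multiplied by zero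
    on a whole ball and the two pieces glue.\<close>
  have sKU: "smooth_fun UNIV ?K"
  proof -
    have "smooth_fun (ball 0 d) ?K"
      by (rule smooth_fun_cong[OF open_ball _ smooth_fun_const[of _ 0]]) (simp add: near)
    then have "smooth_fun (- {0} \<union> ball 0 d) ?K"
      by (intro smooth_fun_Un o open_ball sK)
    moreover have eq: "- {0} \<union> ball 0 d = UNIV" using d by auto
    ultimately show ?thesis unfolding eq by blast
  qed
  have sP: "smooth_fun UNIV (\<lambda>z. z $ i * ?K z)" for i
    by (intro smooth_fun_mult open_UNIV smooth_fun_nth sKU)
  have pP: "pd i (\<lambda>z. z $ j * ?K z) z = z $ j * pd i ?K z + (if i = j then ?K z else 0)" for i j z
    using pd_mult[OF nth_differentiable smooth_fun_differentiable[OF sKU UNIV_I]] by simp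
  \<comment> \<open>\<open>Q\<close> is the derivative of
    \<open>(step (k^2 s) - step (l^2 s)) / s\<close> at \<open>s = |z|^2\<close>. The gradient of
    the radial factor is then \<open>2 z Q\<close>, parallel to \<open>z\<close>, which makes the
    field curl-free.\<close>
  define Q where "Q z = (dstep (k\<^sup>2 * (norm z)\<^sup>2) * k\<^sup>2 - dstep (l\<^sup>2 * (norm z)\<^sup>2) * l\<^sup>2) * inverse ((norm z)\<^sup>2)
     - ?K z * inverse ((norm z)\<^sup>2)" for z :: "real^2"
  have pK: "pd i ?K z = 2 * z $ i * Q z" for i z
  proof (cases "z = 0")
    case True
    have "pd i ?K z = pd i (\<lambda>_. 0) z"
      by (rule pd_cong[OF open_ball[of 0 d]]) (use near d True in auto)
    then show ?thesis using True by simp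
  next
    case False
    have ds: "(\<lambda>z::real^2. m * (norm z)\<^sup>2) differentiable (at z)" for m
      by (rule smooth_fun_differentiable[OF smooth_norm_sq_scaled[OF open_UNIV] UNIV_I])
    have p: "pd i (\<lambda>z::real^2. step (m * (norm z)\<^sup>2)) z = dstep (m * (norm z)\<^sup>2) * (m * (2 * z $ i))" for m
      unfolding pd_compose(1)[OF ds step_has_derivative] pd_norm_sq_scaled ..
    have q: "(\<lambda>z::real^2. step (m * (norm z)\<^sup>2)) differentiable (at z)" for m
      by (rule pd_compose(2)[OF ds step_has_derivative])
    have dn: "(\<lambda>z::real^2. (norm z)\<^sup>2) differentiable (at z)" using ds[of 1] by simp
    have der: "(inverse has_real_derivative - (inverse ((norm z)\<^sup>2) * inverse ((norm z)\<^sup>2))) (at ((norm z)\<^sup>2))"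
      using False by (auto intro!: derivative_eq_intros simp: power2_eq_square)
    have inv: "pd i (\<lambda>z::real^2. inverse ((norm z)\<^sup>2)) z = - (inverse ((norm z)\<^sup>2) * inverse ((norm z)\<^sup>2)) * (2 * z $ i)"
      using pd_compose(1)[where f = "\<lambda>z::real^2. (norm z)\<^sup>2" and b = inverse, OF dn der] by (simp add: pd_norm_sq)
    have "pd i ?K z = (step (k\<^sup>2 * (norm z)\<^sup>2) - step (l\<^sup>2 * (norm z)\<^sup>2)) * pd i (\<lambda>z. inverse ((norm z)\<^sup>2)) z
       + pd i (\<lambda>z. step (k\<^sup>2 * (norm z)\<^sup>2) - step (l\<^sup>2 * (norm z)\<^sup>2)) z * inverse ((norm z)\<^sup>2)"
      unfolding rad_diff_def[abs_def]
      using False smooth_fun_differentiable[OF sst] smooth_fun_differentiable[OF sinv] by (intro pd_mult) auto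
    also have "\<dots> = 2 * z $ i * Q z"
      unfolding inv pd_diff[OF q q] p Q_def rad_diff_def by (simp add: algebra_simps)
    finally show ?thesis .
  qed
  show "smooth_fun UNIV (\<lambda>z. z $ i * ?K z)" by (rule sP)
  show "?K z = 0" if "norm z > max (2 / k) (2 / l)" by (rule far[OF that])
  show "pd 1 (\<lambda>z. z $ 2 * ?K z) z = pd 2 (\<lambda>z. z $ 1 * ?K z) z"
    by (simp add: pP pK)
  show "pd 1 (\<lambda>z. z $ 1 * ?K z) z + pd 2 (\<lambda>z. z $ 2 * ?K z) z = 2 * radial_const * (mol k z - mol l z)"
  proof (cases "z \<in> ball 0 d")
    case True
    have "pd i ?K z = pd i (\<lambda>_. 0) z" for i
      by (rule pd_cong[OF open_ball[of 0 d] _ near(1)]) (use True in auto)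
    then show ?thesis using near[OF True] by (simp add: pP)
  next
    case False
    then have nz: "(norm z)\<^sup>2 \<noteq> 0" using d by auto
    \<comment> \<open>The summand \<open>2 * ?K z\<close> is the divergence of \<open>z\<close> in
      dimension two times the radial factor; it cancels against the last term of
      \<open>Q\<close>.\<close>
    have "pd 1 (\<lambda>z. z $ 1 * ?K z) z + pd 2 (\<lambda>z. z $ 2 * ?K z) z = 2 * (norm z)\<^sup>2 * Q z + 2 * ?K z"
      unfolding pP pK norm_sq_vec2 by (simp add: algebra_simps)
    also have "(norm z)\<^sup>2 * Q z = dstep (k\<^sup>2 * (norm z)\<^sup>2) * k\<^sup>2 - dstep (l\<^sup>2 * (norm z)\<^sup>2) * l\<^sup>2 - ?K z"
      using nz by (simp add: Q_def field_simps)
    then have "2 * (norm z)\<^sup>2 * Q z + 2 * ?K z = 2 * (dstep (k\<^sup>2 * (norm z)\<^sup>2) * k\<^sup>2 - dstep (l\<^sup>2 * (norm z)\<^sup>2) * l\<^sup>2)"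
      by (simp add: mult.assoc)
    also have "\<dots> = 2 * radial_const * (mol k z - mol l z)"
      using radial_const_pos by (simp add: mol_def algebra_simps)
    finally show ?thesis .
  qed
qed

lemma kernel_integrable: "kernel \<eta> R \<Longrightarrow> integrable lborel \<eta>"
proof -
  assume k: "kernel \<eta> R"
  obtain B where "\<And>z. \<bar>\<eta> z\<bar> \<le> B" using kernel.bounded[OF k] by blast
  then show ?thesis
    by (rule integrable_lborel_bounded_support[OF borel_measurable_continuous_onI[OF smooth_fun_continuous[OF kernel.smooth[OF k]]]])
      (rule kernel.support[OF k])
qed

text \<open>By \<open>rad_diff_div\<close> the kernels of scales \<open>k\<close> and 1 differ by a
  compactly supported divergence, whose integral is zero; the normalisation at scale 1 thus carries
  over.\<close>

lemma integral_mol: assumes "k > 0" shows "integral\<^sup>L lborel (mol k) = 1"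
proof -
  note sP = smooth_rad_diff[OF assms zero_less_one] and far = rad_diff_far[OF assms zero_less_one]
    and div = rad_diff_div[OF assms zero_less_one]
  have ker: "kernel (\<lambda>z. z $ i * rad_diff k 1 z) (max (2 / k) 2)" for i
    by unfold_locales (use sP far in auto)
  have int: "integrable lborel (pd j (\<lambda>z. z $ i * rad_diff k 1 z))" for i j
    by (rule kernel_integrable[OF kernel.kernel_pd[OF ker]])
  have z: "integral\<^sup>L lborel (pd j (\<lambda>z. z $ i * rad_diff k 1 z)) = 0" for i j
    by (rule integral_pd_eq_0[OF smooth_fun_differentiable[OF sP UNIV_I] smooth_fun_continuous[OF smooth_fun_pd[OF sP]]])
      (rule kernel.support[OF ker])
  have "integral\<^sup>L lborel (\<lambda>z. 2 * radial_const * (mol k z - mol 1 z)) = 0"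
    unfolding div[symmetric] using int z by simp
  then have "integral\<^sup>L lborel (mol k) = integral\<^sup>L lborel (mol 1)"
    using radial_const_pos kernel_integrable[OF kernel_mol[OF assms]] kernel_integrable[OF kernel_mol[OF zero_less_one]]
    by simp
  then show ?thesis by (simp add: integral_mol_1)
qed

lemma integral_reflect_translate:
  fixes f :: "real^2 \<Rightarrow> real"
  assumes "f \<in> borel_measurable borel"
  shows "integral\<^sup>L lborel (\<lambda>y. f (x - y)) = integral\<^sup>L lborel f"
    "integrable lborel f \<Longrightarrow> integrable lborel (\<lambda>y. f (x - y))"
proof -
  have eq: "(lborel :: (real^2) measure) = distr lborel borel (\<lambda>y. x - y)"
    using lborel_affine_euclidean[of "\<lambda>_. -1" x] by (simp add: euclidean_representation sum_negf density_1)
  show "integral\<^sup>L lborel (\<lambda>y. f (x - y)) = integral\<^sup>L lborel f"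
    by (subst (2) eq, subst integral_distr) (use assms in auto)
  show "integrable lborel f \<Longrightarrow> integrable lborel (\<lambda>y. f (x - y))"
    by (subst (asm) eq, subst (asm) integrable_distr_eq) (use assms in auto)
qed

lemma nn_integral_HM_le:
  assumes "f \<in> borel_measurable borel"
  shows "(\<integral>\<^sup>+x. f x \<partial>HM) \<le> (\<integral>\<^sup>+x. f x \<partial>lborel)"
proof -
  have "(\<integral>\<^sup>+x. f x \<partial>HM) = (\<integral>\<^sup>+x. f x * indicator Hdisk x \<partial>lebesgue)"
    by (rule nn_integral_restrict_space) (simp add: Hdisk_lebesgue)
  also have "\<dots> \<le> (\<integral>\<^sup>+x. f x \<partial>lebesgue)"
    by (rule nn_integral_mono) (simp add: indicator_def)
  also have "\<dots> = (\<integral>\<^sup>+x. f x \<partial>lborel)"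
    using assms by (intro nn_integral_completion)
  finally show ?thesis .
qed

text \<open>Only inequalities, since near the boundary part of the mass falls outside the disk. Both
  marginals are bounded, as the L2 estimate for the integral operator requires.\<close>

lemma mol_mass:
  assumes "k > 0"
  shows "(\<integral>\<^sup>+y. ennreal (mol k (x - y)) \<partial>HM) \<le> 1" "(\<integral>\<^sup>+x. ennreal (mol k (x - y)) \<partial>HM) \<le> 1"
proof -
  have m [measurable]: "mol k \<in> borel_measurable borel"
    by (rule borel_measurable_continuous_onI[OF smooth_fun_continuous[OF kernel.smooth[OF kernel_mol[OF assms]]]])
  note i = kernel_integrable[OF kernel_mol[OF assms]]
  have "(\<integral>\<^sup>+y. ennreal (mol k (x - y)) \<partial>HM) \<le> (\<integral>\<^sup>+y. ennreal (mol k (x - y)) \<partial>lborel)"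
    by (rule nn_integral_HM_le) measurable
  also have "\<dots> = ennreal (integral\<^sup>L lborel (\<lambda>y. mol k (x - y)))"
    by (rule nn_integral_eq_integral[OF integral_reflect_translate(2)[OF m i]]) (simp add: mol_nonneg)
  also have "\<dots> = 1" by (simp add: integral_reflect_translate(1)[OF m] integral_mol[OF assms])
  finally show "(\<integral>\<^sup>+y. ennreal (mol k (x - y)) \<partial>HM) \<le> 1" .
  have "mol k (x - y) = mol k (y - x)" for x y by (simp add: mol_def norm_minus_commute)
  then have "(\<integral>\<^sup>+x. ennreal (mol k (x - y)) \<partial>HM) = (\<integral>\<^sup>+x. ennreal (mol k (y - x)) \<partial>HM)" by simp
  also have "\<dots> \<le> (\<integral>\<^sup>+x. ennreal (mol k (y - x)) \<partial>lborel)"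
    by (rule nn_integral_HM_le) measurable
  also have "\<dots> = ennreal (integral\<^sup>L lborel (\<lambda>x. mol k (y - x)))"
    by (rule nn_integral_eq_integral[OF integral_reflect_translate(2)[OF m i]]) (simp add: mol_nonneg)
  also have "\<dots> = 1" by (simp add: integral_reflect_translate(1)[OF m] integral_mol[OF assms])
  finally show "(\<integral>\<^sup>+x. ennreal (mol k (x - y)) \<partial>HM) \<le> 1" .
qed

text \<open>Jensen's inequality with the sub-probability weights \<open>mol k (x - y)\<close>,
  followed by Tonelli and the bound on the other marginal.\<close>

lemma nsq_conv_le:
  assumes k: "k > 0" and f: "sqint f"
  shows "sqint (conv (mol k) f)" "nsq (conv (mol k) f) \<le> nsq f"
proof -
  interpret K: kernel "mol k" "2 / k" by (rule kernel_mol[OF k])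
  have fm [measurable]: "f \<in> borel_measurable HM" by (rule sqint_measurable[OF f])
  have mm [measurable]: "mol k \<in> borel_measurable borel"
    by (rule borel_measurable_continuous_onI[OF smooth_fun_continuous[OF K.smooth]])
  have id: "(\<lambda>x. x) \<in> borel_measurable HM"
    by (rule continuous_HM_measurable) (rule continuous_on_id)
  have cm [measurable]: "conv (mol k) f \<in> borel_measurable HM"
    by (rule continuous_HM_measurable[OF continuous_on_subset[OF smooth_fun_continuous[OF smooth_conv[OF K.kernel_axioms f]]]]) simp
  obtain B where B: "\<And>z. \<bar>mol k z\<bar> \<le> B" using K.bounded by blast
  have i2: "integrable HM (\<lambda>y. mol k (x - y) * (f y)\<^sup>2)" for x
  proof (rule Bochner_Integration.integrable_bound)
    show "integrable HM (\<lambda>y. B * (f y)\<^sup>2)" using sqint_integrable_sq[OF f] by simp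
    show "(\<lambda>y. mol k (x - y) * (f y)\<^sup>2) \<in> borel_measurable HM"
      using K.measurable_translate[of x] by measurable
    show "AE y in HM. norm (mol k (x - y) * (f y)\<^sup>2) \<le> norm (B * (f y)\<^sup>2)"
      using B by (intro AE_I2) (auto simp: abs_mult intro!: mult_right_mono order_trans[OF B abs_ge_self])
  qed
  have i0: "integrable HM (\<lambda>y. mol k (x - y))" for x
    by (rule integrable_HM_bounded[OF K.measurable_translate, of _ B]) (use B in simp)
  have w: "(LINT y|HM. mol k (x - y)) \<le> 1" for x
  proof -
    have "ennreal ((LINT y|HM. mol k (x - y))) \<le> 1"
      using mol_mass(1)[OF k, of x] by (subst nn_integral_eq_integral[symmetric, OF i0]) (auto simp: mol_nonneg)
    then show ?thesis by (simp add: ennreal_le_1)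
  qed
  \<comment> \<open>Jensen by expanding the nonnegative integral of
    \<open>mol k (x - y) * (f y - t)^2\<close> with \<open>t\<close> equal to the convolution; total
    mass at most one suffices.\<close>
  have pw: "(conv (mol k) f x)\<^sup>2 \<le> (LINT y|HM. mol k (x - y) * (f y)\<^sup>2)" for x
  proof -
    define t where "t = conv (mol k) f x"
    have "0 \<le> (LINT y|HM. mol k (x - y) * (f y - t)\<^sup>2)"
      by (intro Bochner_Integration.integral_nonneg mult_nonneg_nonneg mol_nonneg zero_le_power2)
    also have "\<dots> = (LINT y|HM. mol k (x - y) * (f y)\<^sup>2 - 2 * t * (mol k (x - y) * f y) + t\<^sup>2 * mol k (x - y))"
      by (rule Bochner_Integration.integral_cong) (auto simp: power2_eq_square algebra_simps)
    also have "\<dots> = (LINT y|HM. mol k (x - y) * (f y)\<^sup>2) - 2 * t * t + t\<^sup>2 * (LINT y|HM. mol k (x - y))"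
      using i2 i0 K.integrable_translate_mult[OF f] by (simp add: t_def conv_def)
    also have "\<dots> \<le> (LINT y|HM. mol k (x - y) * (f y)\<^sup>2) - 2 * t * t + t\<^sup>2 * 1"
      by (intro add_left_mono mult_left_mono w) simp
    finally show ?thesis by (simp add: t_def power2_eq_square)
  qed
  interpret fin: finite_measure HM by (rule finite_measure_HM)
  interpret pair: pair_sigma_finite HM HM ..
  have pm: "(\<lambda>(x, y). ennreal (mol k (x - y) * (f y)\<^sup>2)) \<in> borel_measurable (HM \<Otimes>\<^sub>M HM)"
  proof -
    have "(\<lambda>p. fst p - snd p) \<in> borel_measurable (HM \<Otimes>\<^sub>M HM)"
      by (intro borel_measurable_diff measurable_compose[OF measurable_fst id] measurable_compose[OF measurable_snd id])
    then have "(\<lambda>p. mol k (fst p - snd p)) \<in> borel_measurable (HM \<Otimes>\<^sub>M HM)"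
      by (rule measurable_compose[OF _ mm])
    moreover have "(\<lambda>p. f (snd p)) \<in> borel_measurable (HM \<Otimes>\<^sub>M HM)"
      by (rule measurable_compose[OF measurable_snd fm])
    ultimately show ?thesis by (simp add: split_beta)
  qed
  have "(\<integral>\<^sup>+x. ennreal ((conv (mol k) f x)\<^sup>2) \<partial>HM) \<le> (\<integral>\<^sup>+x. (\<integral>\<^sup>+y. ennreal (mol k (x - y) * (f y)\<^sup>2) \<partial>HM) \<partial>HM)"
  proof (rule nn_integral_mono)
    fix x
    have "(\<integral>\<^sup>+y. ennreal (mol k (x - y) * (f y)\<^sup>2) \<partial>HM) = ennreal ((LINT y|HM. mol k (x - y) * (f y)\<^sup>2))"
      by (rule nn_integral_eq_integral[OF i2]) (simp add: mol_nonneg)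
    then show "ennreal ((conv (mol k) f x)\<^sup>2) \<le> (\<integral>\<^sup>+y. ennreal (mol k (x - y) * (f y)\<^sup>2) \<partial>HM)"
      using pw[of x] by (simp add: ennreal_leI)
  qed
  also have "\<dots> = (\<integral>\<^sup>+y. (\<integral>\<^sup>+x. ennreal (mol k (x - y) * (f y)\<^sup>2) \<partial>HM) \<partial>HM)"
    using pair.Fubini[OF pm] by simp
  also have "\<dots> \<le> (\<integral>\<^sup>+y. ennreal ((f y)\<^sup>2) \<partial>HM)"
  proof (rule nn_integral_mono)
    fix y
    have "(\<lambda>x. mol k (x - y)) \<in> borel_measurable HM"
      by (intro measurable_compose[OF _ mm] borel_measurable_diff id) simp
    then have "(\<integral>\<^sup>+x. ennreal (mol k (x - y) * (f y)\<^sup>2) \<partial>HM) = (\<integral>\<^sup>+x. ennreal (mol k (x - y)) \<partial>HM) * ennreal ((f y)\<^sup>2)"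
      by (simp add: ennreal_mult mol_nonneg nn_integral_multc)
    also have "\<dots> \<le> 1 * ennreal ((f y)\<^sup>2)"
      by (intro mult_right_mono mol_mass[OF k]) simp
    finally show "(\<integral>\<^sup>+x. ennreal (mol k (x - y) * (f y)\<^sup>2) \<partial>HM) \<le> ennreal ((f y)\<^sup>2)" by simp
  qed
  also have "\<dots> = ennreal (nsq f)"
    unfolding nsq_def using sqint_integrable_sq[OF f] by (subst nn_integral_eq_integral) auto
  finally have fin: "(\<integral>\<^sup>+x. ennreal ((conv (mol k) f x)\<^sup>2) \<partial>HM) \<le> ennreal (nsq f)" .
  have i: "integrable HM (\<lambda>x. (conv (mol k) f x)\<^sup>2)"
    by (rule integrableI_bounded) (use fin in \<open>auto intro: le_less_trans\<close>)
  then show "sqint (conv (mol k) f)" by (simp add: sqint_def)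
  have "ennreal (nsq (conv (mol k) f)) \<le> ennreal (nsq f)"
    using fin unfolding nsq_def[of "conv (mol k) f"] real_norm_def power2_abs
    by (subst nn_integral_eq_integral[symmetric, OF i]) auto
  then show "nsq (conv (mol k) f) \<le> nsq f"
    by (simp add: ennreal_le_iff nsq_nonneg)
qed

section \<open>Density of continuous functions and L2 convergence of mollification\<close>

lemma nsq_tendsto_0_dominated:
  fixes g :: "nat \<Rightarrow> real^2 \<Rightarrow> 'b::euclidean_space"
  assumes "\<And>n. g n \<in> borel_measurable HM" "integrable HM h"
    "AE x in HM. (\<lambda>n. g n x) \<longlonglongrightarrow> 0" "\<And>n x. x \<in> Hdisk \<Longrightarrow> (norm (g n x))\<^sup>2 \<le> h x"
  shows "(\<lambda>n. nsq (g n)) \<longlonglongrightarrow> 0"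
proof -
  have "(\<lambda>n. nsq (g n)) \<longlonglongrightarrow> (LINT x|HM. 0)"
    unfolding nsq_def
  proof (rule integral_dominated_convergence[OF _ _ assms(2)])
    show "(\<lambda>x. (norm (g n x))\<^sup>2) \<in> borel_measurable HM" for n
      using assms(1)[of n] by measurable
    show "AE x in HM. (\<lambda>n. (norm (g n x))\<^sup>2) \<longlonglongrightarrow> 0"
      using assms(3)
    proof eventually_elim
      case (elim x)
      have "(\<lambda>n. (norm (g n x))\<^sup>2) \<longlonglongrightarrow> (norm (0::'b))\<^sup>2"
        by (intro tendsto_power tendsto_norm elim)
      then show ?case by simp
    qed
    show "AE x in HM. norm ((norm (g n x))\<^sup>2) \<le> h x" for n
      using assms(4) by (intro AE_I2) (simp add: space_HM)
  qed simp
  then show ?thesis by simp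
qed

definition clamp1 :: "real \<Rightarrow> real \<Rightarrow> real" where
  "clamp1 j t = max (- j) (min j t)"

lemma clamp1_bound: "j \<ge> 0 \<Longrightarrow> \<bar>clamp1 j t\<bar> \<le> j" "\<bar>t\<bar> \<le> j \<Longrightarrow> clamp1 j t = t" "j \<ge> 0 \<Longrightarrow> \<bar>clamp1 j t\<bar> \<le> \<bar>t\<bar>"
  by (auto simp: clamp1_def)

lemma continuous_clamp1: "continuous_on S g \<Longrightarrow> continuous_on S (\<lambda>x. clamp1 j (g x))"
  unfolding clamp1_def by (intro continuous_on_max continuous_on_min continuous_on_const)

text \<open>The function is first truncated in height, then approximated almost everywhere by
  continuous functions, which are clamped to the same height for domination. Vanishing off the disk
  is demanded because only then is the approximant compatible with the extension by zero inside
  \<open>conv\<close>.\<close>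

lemma continuous_dense:
  assumes f: "sqint f" and e: "e > 0"
  obtains g :: "real^2 \<Rightarrow> real" where "continuous_on UNIV g" "\<And>x. x \<notin> Hdisk \<Longrightarrow> g x = 0"
    "nsq (\<lambda>x. f x - g x) < e"
proof -
  have fm [measurable]: "f \<in> borel_measurable HM" by (rule sqint_measurable[OF f])
  have cm [measurable]: "clamp1 j \<in> borel_measurable borel" for j
    by (rule borel_measurable_continuous_onI) (rule continuous_clamp1[OF continuous_on_id])
  have "(\<lambda>j. nsq (\<lambda>x. f x - clamp1 (real j) (f x))) \<longlonglongrightarrow> 0"
  proof (rule nsq_tendsto_0_dominated)
    show "(\<lambda>x. f x - clamp1 (real j) (f x)) \<in> borel_measurable HM" for j by measurable
    show "integrable HM (\<lambda>x. 4 * (norm (f x))\<^sup>2)" using sqint_integrable_sq[OF f] by simp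
    have "\<forall>\<^sub>F j in sequentially. f x - clamp1 (real j) (f x) = 0" for x
    proof -
      obtain m where m: "\<bar>f x\<bar> \<le> real m" using real_arch_simple by blast
      show ?thesis
      proof (rule eventually_sequentiallyI[of m])
        fix n assume "m \<le> n"
        then have "\<bar>f x\<bar> \<le> real n" using m by linarith
        then show "f x - clamp1 (real n) (f x) = 0" by (simp add: clamp1_bound(2))
      qed
    qed
    then show "AE x in HM. (\<lambda>j. f x - clamp1 (real j) (f x)) \<longlonglongrightarrow> 0"
      by (intro AE_I2 tendsto_eventually)
    show "(norm (f x - clamp1 (real j) (f x)))\<^sup>2 \<le> 4 * (norm (f x))\<^sup>2" for j x
    proof -
      have "\<bar>f x - clamp1 (real j) (f x)\<bar> \<le> 2 * \<bar>f x\<bar>" using clamp1_bound(3)[of "real j" "f x"] by linarith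
      then have "\<bar>f x - clamp1 (real j) (f x)\<bar>\<^sup>2 \<le> (2 * \<bar>f x\<bar>)\<^sup>2" by (intro power_mono) auto
      then show ?thesis by (simp add: power_mult_distrib)
    qed
  qed
  from LIMSEQ_D[OF this, of "e / 4"] e
  obtain j where "\<forall>n\<ge>j. norm (nsq (\<lambda>x. f x - clamp1 (real n) (f x)) - 0) < e / 4" by auto
  from this[rule_format, OF order_refl] have j: "nsq (\<lambda>x. f x - clamp1 (real j) (f x)) < e / 4" by simp
  let ?F = "\<lambda>x. clamp1 (real j) (f x)"
  have Fm: "?F \<in> borel_measurable HM" by measurable
  then have "?F measurable_on Hdisk"
    by (simp add: measurable_on_iff_borel_measurable[OF Hdisk_lebesgue])
  then obtain N g where N: "negligible N" and g: "\<And>n. continuous_on UNIV (g n)"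
    and lim: "\<And>x. x \<notin> N \<Longrightarrow> (\<lambda>n. g n x) \<longlonglongrightarrow> (if x \<in> Hdisk then ?F x else 0)"
    unfolding measurable_on_def by blast
  \<comment> \<open>The second factor is a continuous cutoff that is zero off the disk and, at each
    point of the disk, equal to one for all large \<open>n\<close>.\<close>
  define G where "G n x = clamp1 (real j) (g n x) * max 0 (min 1 (real n * (1 - norm x)))" for n x
  have Gc: "continuous_on UNIV (G n)" for n
    unfolding G_def
    by (intro continuous_on_mult continuous_clamp1 g continuous_on_max continuous_on_min continuous_on_const
        continuous_on_diff continuous_on_norm_id)
  have G0: "G n x = 0" if "x \<notin> Hdisk" for n x
  proof -
    have "real n * (1 - norm x) \<le> 0" using that by (intro mult_nonneg_nonpos) (auto simp: in_Hdisk_iff)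
    then show ?thesis by (simp add: G_def)
  qed
  have Gb: "\<bar>G n x\<bar> \<le> real j" for n x
  proof -
    have "\<bar>G n x\<bar> \<le> real j * 1"
      unfolding G_def abs_mult by (intro mult_mono clamp1_bound) auto
    then show ?thesis by simp
  qed
  have "(\<lambda>n. nsq (\<lambda>x. ?F x - G n x)) \<longlonglongrightarrow> 0"
  proof (rule nsq_tendsto_0_dominated)
    show "(\<lambda>x. ?F x - G n x) \<in> borel_measurable HM" for n
      by (intro borel_measurable_diff Fm continuous_HM_measurable continuous_on_subset[OF Gc]) simp
    show "integrable HM (\<lambda>x. (2 * real j)\<^sup>2)" by (rule finite_measure.integrable_const[OF finite_measure_HM])
    show "(norm (?F x - G n x))\<^sup>2 \<le> (2 * real j)\<^sup>2" for n x
      using Gb[of n x] clamp1_bound(1)[of "real j" "f x"] by (intro power_mono) auto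
    have "AE x in HM. x \<notin> N"
    proof -
      have "AE x in lebesgue. x \<notin> N" using N by (simp add: negligible_iff_null_sets AE_not_in)
      then show ?thesis
        using Hdisk_lebesgue by (subst AE_restrict_space_iff) auto
    qed
    moreover have "AE x in HM. x \<in> Hdisk" by (intro AE_I2) (simp add: space_HM)
    ultimately show "AE x in HM. (\<lambda>n. ?F x - G n x) \<longlonglongrightarrow> 0"
    proof eventually_elim
      case (elim x)
      have 1: "(\<lambda>n. g n x) \<longlonglongrightarrow> ?F x" using lim[OF elim(1)] elim(2) by simp
      have "isCont (clamp1 (real j)) (?F x)"
        using continuous_clamp1[where j = "real j" and S = UNIV, OF continuous_on_id] by (simp add: continuous_on_eq_continuous_at)
      then have "(\<lambda>n. clamp1 (real j) (g n x)) \<longlonglongrightarrow> clamp1 (real j) (?F x)"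
        by (rule isCont_tendsto_compose[OF _ 1])
      also have "clamp1 (real j) (?F x) = ?F x" by (rule clamp1_bound(2)) (simp add: clamp1_bound(1))
      finally have 2: "(\<lambda>n. clamp1 (real j) (g n x)) \<longlonglongrightarrow> ?F x" .
      have p: "1 - norm x > 0" using elim(2) by (simp add: in_Hdisk_iff)
      obtain m where m: "1 / (1 - norm x) \<le> real m" using real_arch_simple by blast
      have "\<forall>\<^sub>F n in sequentially. max 0 (min 1 (real n * (1 - norm x))) = 1"
      proof (rule eventually_sequentiallyI[of m])
        fix n assume "m \<le> n"
        then have "1 / (1 - norm x) \<le> real n" using m by linarith
        then have "1 \<le> real n * (1 - norm x)" using p by (simp add: field_simps)
        then show "max 0 (min 1 (real n * (1 - norm x))) = 1" by simp
      qed
      then have "(\<lambda>n. max 0 (min 1 (real n * (1 - norm x)))) \<longlonglongrightarrow> 1"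
        by (rule tendsto_eventually)
      from tendsto_mult[OF 2 this] have "(\<lambda>n. G n x) \<longlonglongrightarrow> ?F x" by (simp add: G_def)
      from tendsto_diff[OF tendsto_const this, of "?F x"] show ?case by simp
    qed
  qed
  from LIMSEQ_D[OF this, of "e / 4"] e
  obtain n where "\<forall>m\<ge>n. norm (nsq (\<lambda>x. ?F x - G m x) - 0) < e / 4" by auto
  from this[rule_format, OF order_refl] have n: "nsq (\<lambda>x. ?F x - G n x) < e / 4" by simp
  have F: "sqint ?F" by (rule sqint_bounded[OF Fm, of "real j"]) (simp add: clamp1_bound)
  have G: "sqint (G n)"
    by (rule sqint_bounded[OF continuous_HM_measurable[OF continuous_on_subset[OF Gc]], where B = "real j"]) (simp_all add: Gb)
  have "nsq (\<lambda>x. f x - G n x) = nsq (\<lambda>x. (f x - ?F x) + (?F x - G n x))" by simp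
  also have "\<dots> \<le> 2 * nsq (\<lambda>x. f x - ?F x) + 2 * nsq (\<lambda>x. ?F x - G n x)"
    by (intro sqint_add sqint_diff f F G)
  also have "\<dots> < e" using j n by simp
  finally show thesis using that[OF Gc G0] by blast
qed

text \<open>As \<open>g\<close> vanishes off the disk, the convolution is a true average of
  \<open>g\<close> with total mass one, and it differs from \<open>g x\<close> by at most the
  oscillation on the scale of the kernel.\<close>

lemma conv_mol_continuous:
  assumes g: "continuous_on UNIV g" "\<And>x. x \<notin> Hdisk \<Longrightarrow> g x = 0" and k: "k > 0"
    and osc: "\<And>x y. norm (x - y) \<le> 2 / k \<Longrightarrow> \<bar>g x - g y\<bar> \<le> e"
  shows "\<bar>conv (mol k) g x - g x\<bar> \<le> e"
proof -
  interpret K: kernel "mol k" "2 / k" by (rule kernel_mol[OF k])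
  have mm [measurable]: "mol k \<in> borel_measurable borel"
    by (rule borel_measurable_continuous_onI[OF smooth_fun_continuous[OF K.smooth]])
  have gm [measurable]: "g \<in> borel_measurable borel" by (rule borel_measurable_continuous_onI[OF g(1)])
  note i = integral_reflect_translate(2)[OF mm kernel_integrable[OF K.kernel_axioms], of x]
  have gz: "g z = 0" if "norm z > 1" for z using g(2)[of z] that by (simp add: in_Hdisk_iff)
  obtain B where B: "\<And>z. \<bar>g z\<bar> \<le> B" using continuous_bounded_support[OF g(1) gz] by blast
  have ig: "integrable lborel (\<lambda>y. mol k (x - y) * g y)"
  proof (rule Bochner_Integration.integrable_bound)
    show "integrable lborel (\<lambda>y. B * mol k (x - y))" using i by simp
    show "(\<lambda>y. mol k (x - y) * g y) \<in> borel_measurable lborel" by measurable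
    show "AE y in lborel. norm (mol k (x - y) * g y) \<le> norm (B * mol k (x - y))"
      using order_trans[OF B abs_ge_self] by (intro AE_I2) (auto simp: abs_mult mult.commute intro!: mult_right_mono)
  qed
  have "conv (mol k) g x = integral\<^sup>L lborel (\<lambda>y. mol k (x - y) * g y)"
    unfolding conv_def by (rule integral_HM_eq_lborel) (use g(2) in auto)
  moreover have "g x = integral\<^sup>L lborel (\<lambda>y. mol k (x - y) * g x)"
    using integral_reflect_translate(1)[OF mm, of x] integral_mol[OF k] by simp
  ultimately have "conv (mol k) g x - g x = integral\<^sup>L lborel (\<lambda>y. mol k (x - y) * g y - mol k (x - y) * g x)"
    using ig i by simp
  also have "norm \<dots> \<le> integral\<^sup>L lborel (\<lambda>y. mol k (x - y) * e)"
  proof (rule Bochner_Integration.integral_norm_bound_integral)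
    fix y
    show "norm (mol k (x - y) * g y - mol k (x - y) * g x) \<le> mol k (x - y) * e"
    proof (cases "norm (x - y) \<le> 2 / k")
      case True
      then have "mol k (x - y) * \<bar>g y - g x\<bar> \<le> mol k (x - y) * e"
        using osc[of y x] by (intro mult_left_mono mol_nonneg) (simp add: norm_minus_commute)
      moreover have "norm (mol k (x - y) * g y - mol k (x - y) * g x) = mol k (x - y) * \<bar>g y - g x\<bar>"
        unfolding right_diff_distrib[symmetric] real_norm_def abs_mult by (simp add: mol_nonneg)
      ultimately show ?thesis by simp
    next
      case False
      then have "mol k (x - y) = 0" by (intro K.support) simp
      then show ?thesis by simp
    qed
  qed (use ig i in auto)
  also have "\<dots> = e" using integral_reflect_translate(1)[OF mm, of x] integral_mol[OF k] by simp
  finally show ?thesis by simp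
qed

text \<open>The standard three-term splitting: \<open>f\<close> is close to a continuous
  \<open>g\<close>, mollification is a contraction, and for \<open>g\<close> it converges
  uniformly.\<close>

lemma mollification_converges:
  assumes f: "sqint f"
  shows "(\<lambda>n. nsq (\<lambda>x. conv (mol (real (Suc n))) f x - f x)) \<longlonglongrightarrow> 0"
proof (rule LIMSEQ_I)
  fix e :: real assume e: "e > 0"
  define V where "V = nsq (\<lambda>x::real^2. 1::real) + 1"
  have V: "V > 0" "nsq (\<lambda>x::real^2. 1::real) \<le> V"
    using nsq_nonneg[of "\<lambda>x::real^2. 1::real"] by (simp_all add: V_def)
  obtain g where g: "continuous_on UNIV g" "\<And>x. x \<notin> Hdisk \<Longrightarrow> g x = 0" "nsq (\<lambda>x. f x - g x) < e / 32"
    using continuous_dense[OF f, of "e / 32"] e by auto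
  have gz: "g z = 0" if "norm z > 1" for z using g(2)[of z] that by (simp add: in_Hdisk_iff)
  obtain B where B: "\<And>z. \<bar>g z\<bar> \<le> B" using continuous_bounded_support[OF g(1) gz] by blast
  have gs: "sqint g"
    by (rule sqint_bounded[OF continuous_HM_measurable[OF continuous_on_subset[OF g(1)]], where B = B]) (use B in auto)
  \<comment> \<open>Chosen so that a uniform error \<open>\<delta>\<close> has squared L2 norm at
    most \<open>e / 32\<close>; the 32 leaves room for the factors 2 and 4 produced by splitting the
    sum.\<close>
  define \<delta> where "\<delta> = sqrt (e / (32 * V))"
  have \<delta>: "\<delta> > 0" "\<delta>\<^sup>2 * V = e / 32" using e V by (auto simp: \<delta>_def)
  obtain d where d: "d > 0" "\<And>x y. norm (x - y) < d \<Longrightarrow> \<bar>g x - g y\<bar> < \<delta>"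
    using uniformly_continuous_bounded_support[OF g(1) gz \<delta>(1)] by blast
  obtain N where N: "2 / d < real N" using reals_Archimedean2 by blast
  have "norm (nsq (\<lambda>x. conv (mol (real (Suc n))) f x - f x) - 0) < e" if n: "n \<ge> N" for n
  proof -
    define k where "k = real (Suc n)"
    have k: "k > 0" by (simp add: k_def)
    have "2 / d < k" using N n by (simp add: k_def)
    then have kd: "2 / k < d" using d(1) k by (simp add: field_simps)
    note c = nsq_conv_le[OF k]
    have 1: "\<bar>conv (mol k) g x - g x\<bar> \<le> \<delta>" for x
      by (rule conv_mol_continuous[OF g(1,2) k]) (use d(2) kd in \<open>auto intro: less_imp_le\<close>)
    have "nsq (\<lambda>x. conv (mol k) g x - g x) \<le> \<delta>\<^sup>2 * nsq (\<lambda>x::real^2. 1::real)"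
      by (rule sqint_bound(2))
        (use 1 sqint_bounded[of "\<lambda>_. 1::real" 1] sqint_measurable[OF sqint_diff(1)[OF c(1)[OF gs] gs]] in auto)
    also have "\<dots> \<le> \<delta>\<^sup>2 * V" using V by (intro mult_left_mono) auto
    finally have 2: "nsq (\<lambda>x. conv (mol k) g x - g x) \<le> e / 32" using \<delta> by simp
    have d1: "sqint (\<lambda>x. f x - g x)" by (rule sqint_diff(1)[OF f gs])
    interpret K: kernel "mol k" "2 / k" by (rule kernel_mol[OF k])
    have eq: "conv (mol k) (\<lambda>x. f x - g x) x = conv (mol k) f x - conv (mol k) g x" for x
      unfolding conv_def using K.integrable_translate_mult[OF f] K.integrable_translate_mult[OF gs]
      by (simp add: right_diff_distrib)
    have 3: "nsq (\<lambda>x. conv (mol k) f x - conv (mol k) g x) \<le> e / 32"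
      using c(2)[OF d1] g(3) unfolding eq by simp
    have "nsq (\<lambda>x. conv (mol k) f x - f x) = nsq (\<lambda>x. (conv (mol k) f x - conv (mol k) g x) + ((conv (mol k) g x - g x) - (f x - g x)))"
      by simp
    also have "\<dots> \<le> 2 * nsq (\<lambda>x. conv (mol k) f x - conv (mol k) g x) + 2 * nsq (\<lambda>x. (conv (mol k) g x - g x) - (f x - g x))"
      by (intro sqint_add sqint_diff c f gs)
    also have "nsq (\<lambda>x. (conv (mol k) g x - g x) - (f x - g x)) \<le> 2 * nsq (\<lambda>x. conv (mol k) g x - g x) + 2 * nsq (\<lambda>x. f x - g x)"
      by (intro sqint_diff c f gs)
    finally have "nsq (\<lambda>x. conv (mol k) f x - f x) < e" using 2 3 g(3) e by simp
    then show ?thesis by (simp add: k_def nsq_nonneg)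
  qed
  then show "\<exists>no. \<forall>n\<ge>no. norm (nsq (\<lambda>x. conv (mol (real (Suc n))) f x - f x) - 0) < e" by blast
qed

section \<open>Weyl's lemma for divergence-free and curl-free fields\<close>

text \<open>The Hodge star of \<open>d\<phi>\<close>, that is the divergence-free field with stream
  function \<open>\<phi>\<close>.\<close>

definition dperp :: "(real^2 \<Rightarrow> real) \<Rightarrow> real^2 \<Rightarrow> real^2" where
  "dperp \<phi> x = (\<chi> i. if i = 1 then - pd 2 \<phi> x else pd 1 \<phi> x)"

lemma inner_vec2: "u \<bullet> v = u $ 1 * v $ 1 + u $ 2 * v $ (2::2)" for u v :: "real^2"
  by (simp add: inner_vec_def sum_2)

lemma inner_dfun: "u \<bullet> dfun \<phi> x = u $ 1 * pd 1 \<phi> x + u $ 2 * pd 2 \<phi> x"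
  by (simp add: inner_vec2 dfun_def)

lemma inner_dperp: "u \<bullet> dperp \<phi> x = u $ 2 * pd 1 \<phi> x - u $ 1 * pd 2 \<phi> x"
  by (simp add: inner_vec2 dperp_def)

lemma div_free_orthogonal_dfun:
  fixes w :: "real^2 \<Rightarrow> real^2"
  assumes w: "\<And>i. smooth_fun Hdisk (\<lambda>x. w x $ i)" and t: "test_fun \<phi>"
    and div: "\<And>x. x \<in> Hdisk \<Longrightarrow> pd 1 (\<lambda>x. w x $ 1) x + pd 2 (\<lambda>x. w x $ 2) x = 0"
  shows "(LINT x|HM. w x \<bullet> dfun \<phi> x) = 0"
proof -
  have i1: "integrable HM (\<lambda>x. pd i (\<lambda>x. w x $ i) x * \<phi> x)" for i
    by (rule integrable_mult_test_fun[OF smooth_fun_continuous[OF smooth_fun_pd[OF w]] t])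
  have i2: "integrable HM (\<lambda>x. w x $ i * pd i \<phi> x)" for i
    by (rule integrable_mult_test_fun[OF smooth_fun_continuous[OF w] test_fun_pd[OF t]])
  have "(LINT x|HM. w x \<bullet> dfun \<phi> x) = - ((LINT x|HM. pd 1 (\<lambda>x. w x $ 1) x * \<phi> x) + (LINT x|HM. pd 2 (\<lambda>x. w x $ 2) x * \<phi> x))"
    unfolding inner_dfun using i2 integration_by_parts[OF w t] by simp
  also have "(LINT x|HM. pd 1 (\<lambda>x. w x $ 1) x * \<phi> x) + (LINT x|HM. pd 2 (\<lambda>x. w x $ 2) x * \<phi> x)
      = (LINT x|HM. (pd 1 (\<lambda>x. w x $ 1) x + pd 2 (\<lambda>x. w x $ 2) x) * \<phi> x)"
    unfolding distrib_right by (rule Bochner_Integration.integral_add[OF i1 i1, symmetric])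
  also have "\<dots> = (LINT x|HM. 0)"
    by (rule Bochner_Integration.integral_cong) (simp_all add: space_HM div)
  finally show ?thesis by simp
qed

lemma measurable_vec_nth:
  assumes "u \<in> borel_measurable M"
  shows "(\<lambda>x. (u x :: 'b::euclidean_space ^ 2) $ i) \<in> borel_measurable M"
  by (rule measurable_compose[OF assms borel_measurable_continuous_onI])
    (intro continuous_on_component continuous_on_id)

lemma measurable_vec2I:
  fixes u :: "'a \<Rightarrow> 'b::euclidean_space ^ 2"
  assumes "\<And>i. (\<lambda>x. u x $ i) \<in> borel_measurable M"
  shows "u \<in> borel_measurable M"
proof -
  have "(\<lambda>x. u x \<bullet> b) \<in> borel_measurable M" if "b \<in> Basis" for b
  proof -
    obtain i c where b: "b = axis i c" using \<open>b \<in> Basis\<close> by (auto simp: Basis_vec_def)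
    have "(\<lambda>x. u x $ i \<bullet> c) \<in> borel_measurable M"
      by (intro borel_measurable_inner assms) simp
    then show ?thesis by (simp add: b inner_axis)
  qed
  then show ?thesis using borel_measurable_euclidean_space by blast
qed

lemma sqint_nth:
  fixes u :: "real^2 \<Rightarrow> real^2"
  assumes "sqint u"
  shows "sqint (\<lambda>x. u x $ i)"
  by (rule sqint_bound(1)[OF assms measurable_vec_nth[OF sqint_measurable[OF assms]], where c = 1])
    (simp add: component_le_norm_cart)

lemma norm_vec2_sq: "(norm (u :: real^2))\<^sup>2 = (u $ 1)\<^sup>2 + (u $ 2)\<^sup>2"
  unfolding norm_sq_vec2 by (simp add: power2_eq_square)

lemma sqint_vec2:
  fixes u :: "real^2 \<Rightarrow> real^2"
  assumes "\<And>i. sqint (\<lambda>x. u x $ i)"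
  shows "sqint u" "nsq u = nsq (\<lambda>x. u x $ 1) + nsq (\<lambda>x. u x $ 2)"
  using measurable_vec2I[of u HM] sqint_measurable[OF assms] sqint_integrable_sq[OF assms]
  by (auto simp: sqint_def nsq_def norm_vec2_sq)

lemma sqint_dfun: "test_fun \<phi> \<Longrightarrow> sqint (dfun \<phi>)"
  by (rule sqint_vec2(1)) (simp add: dfun_def sqint_test_fun test_fun_pd)

text \<open>The condition \<open>norm x + R < 1\<close> keeps the reflected kernel inside the disk;
  exactly at such points can weak equations be tested by a kernel.\<close>

lemma test_fun_reflect:
  assumes "kernel \<eta> R" "norm x + R < 1"
  shows "test_fun (\<lambda>y. \<eta> (x - y))"
proof (rule test_funI[OF _ assms(2)])
  show "smooth_fun Hdisk (\<lambda>y. \<eta> (x - y))"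
    by (rule smooth_fun_subset[OF smooth_fun_reflect[OF kernel.smooth[OF assms(1)]]]) simp
  show "\<eta> (x - y) = 0" if "norm y > norm x + R" for y
    using that norm_triangle_sub[of y x] by (intro kernel.support[OF assms(1)]) (simp add: norm_minus_commute)
qed

locale weak_div_curl_free =
  fixes w :: "real^2 \<Rightarrow> real^2"
  assumes w: "sqint w"
    and div: "\<And>\<phi>. test_fun \<phi> \<Longrightarrow> (LINT x|HM. w x \<bullet> dfun \<phi> x) = 0"
    and curl: "\<And>\<phi>. test_fun \<phi> \<Longrightarrow> (LINT x|HM. w x \<bullet> dperp \<phi> x) = 0"
begin

abbreviation "wc i \<equiv> (\<lambda>x. w x $ i)"

lemma wc: "sqint (wc i)"
  by (rule sqint_nth[OF w])

text \<open>Derivatives of the kernel in \<open>x\<close> are, up to sign, derivatives of the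
  reflected kernel in the integration variable, which is an admissible test function.\<close>

lemma conv_div_curl:
  assumes k: "kernel \<eta> R" and x: "norm x + R < 1"
  shows "conv (pd 1 \<eta>) (wc 1) x + conv (pd 2 \<eta>) (wc 2) x = 0"
    "conv (pd 1 \<eta>) (wc 2) x - conv (pd 2 \<eta>) (wc 1) x = 0"
proof -
  have p: "pd i (\<lambda>y. \<eta> (x - y)) y = - pd i \<eta> (x - y)" for i y
    by (rule pd_reflect(1)[OF smooth_fun_differentiable[OF kernel.smooth[OF k] UNIV_I]])
  have int: "integrable HM (\<lambda>y. pd i \<eta> (x - y) * w y $ j)" for i j
    by (rule kernel.integrable_translate_mult[OF kernel.kernel_pd[OF k] wc])
  have "conv (pd 1 \<eta>) (wc 1) x + conv (pd 2 \<eta>) (wc 2) x = - (LINT y|HM. w y \<bullet> dfun (\<lambda>y. \<eta> (x - y)) y)"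
    unfolding inner_dfun p conv_def using int by (simp add: mult.commute)
  then show "conv (pd 1 \<eta>) (wc 1) x + conv (pd 2 \<eta>) (wc 2) x = 0"
    using div[OF test_fun_reflect[OF k x]] by simp
  have "conv (pd 1 \<eta>) (wc 2) x - conv (pd 2 \<eta>) (wc 1) x
      = (LINT y|HM. pd 1 \<eta> (x - y) * w y $ 2 - pd 2 \<eta> (x - y) * w y $ 1)"
    unfolding conv_def by (rule Bochner_Integration.integral_diff[symmetric]) (rule int)+
  also have "\<dots> = (LINT y|HM. - (w y \<bullet> dperp (\<lambda>y. \<eta> (x - y)) y))"
    unfolding inner_dperp p by (simp add: algebra_simps)
  finally have "conv (pd 1 \<eta>) (wc 2) x - conv (pd 2 \<eta>) (wc 1) x = - (LINT y|HM. w y \<bullet> dperp (\<lambda>y. \<eta> (x - y)) y)"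
    by simp
  then show "conv (pd 1 \<eta>) (wc 2) x - conv (pd 2 \<eta>) (wc 1) x = 0"
    using curl[OF test_fun_reflect[OF k x]] by simp
qed

text \<open>Both equations are tested against the gradient field whose divergence is the difference of the mollifiers.\<close>

lemma conv_mol_indep:
  assumes k: "k > 0" "l > 0" and x: "norm x + 2 / k < 1" "norm x + 2 / l < 1"
  shows "conv (mol k) (wc i) x = conv (mol l) (wc i) x"
proof -
  let ?P = "\<lambda>i z. z $ i * rad_diff k l z"
  have ker: "kernel (?P i) (max (2 / k) (2 / l))" for i
    by unfold_locales (use smooth_rad_diff[OF k] rad_diff_far[OF k] in auto)
  have xR: "norm x + max (2 / k) (2 / l) < 1" using x by simp
  note e = conv_div_curl[OF ker xR]
  have int: "integrable HM (\<lambda>y. pd i (?P j) (x - y) * w y $ m)" for i j m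
    by (rule kernel.integrable_translate_mult[OF kernel.kernel_pd[OF ker] wc])
  have intm: "integrable HM (\<lambda>y. mol q (x - y) * w y $ m)" if "q > 0" for q m
    by (rule kernel.integrable_translate_mult[OF kernel_mol[OF that] wc])
  have c: "pd 1 (?P 2) = pd 2 (?P 1)" using rad_diff_curl[OF k] by (rule ext)
  have d: "conv (pd 1 (?P 1)) (wc i) x + conv (pd 2 (?P 2)) (wc i) x
      = 2 * radial_const * (conv (mol k) (wc i) x - conv (mol l) (wc i) x)"
  proof -
    have "conv (pd 1 (?P 1)) (wc i) x + conv (pd 2 (?P 2)) (wc i) x
      = (LINT y|HM. (pd 1 (?P 1) (x - y) + pd 2 (?P 2) (x - y)) * w y $ i)"
      unfolding conv_def distrib_right by (rule Bochner_Integration.integral_add[symmetric]) (rule int)+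
    also have "\<dots> = (LINT y|HM. 2 * radial_const * (mol k (x - y) * w y $ i - mol l (x - y) * w y $ i))"
      unfolding rad_diff_div[OF k] by (simp add: algebra_simps)
    also have "\<dots> = 2 * radial_const * (conv (mol k) (wc i) x - conv (mol l) (wc i) x)"
      unfolding conv_def integral_mult_right_zero
      by (simp only: Bochner_Integration.integral_diff[OF intm[OF k(1)] intm[OF k(2)]])
    finally show ?thesis .
  qed
  \<comment> \<open>The identity Laplacian = grad div - curl curl in convolved form: one divergence
    and one curl equation are combined, and the mixed terms cancel because the field
    \<open>?P\<close> is curl-free.\<close>
  have "conv (pd 1 (?P 1)) (wc i) x + conv (pd 2 (?P 2)) (wc i) x = 0"
    using exhaust_2[of i]
  proof
    assume "i = 1"
    then show ?thesis using e(1)[of 1] e(2)[of 2] unfolding c by simp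
  next
    assume "i = 2"
    then show ?thesis using e(1)[of 2] e(2)[of 1] unfolding c by simp
  qed
  then show ?thesis using d radial_const_pos by simp
qed

text \<open>The candidate for the smooth representative. The scale varies with the point so that the
  kernel radius bound \<open>2 / k\<close> is half the distance to the boundary; by
  \<open>conv_mol_indep\<close> this variation is invisible.\<close>

definition W :: "real^2 \<Rightarrow> real^2" where
  "W x = (\<chi> i. conv (mol (4 / (1 - norm x))) (wc i) x)"

text \<open>On a smaller concentric ball a single scale serves all points, so smoothness and the two
  equations for \<open>W\<close> reduce to those of an ordinary convolution.\<close>

lemma W_eq:
  assumes "k > 0" "r + 2 / k < 1" "x \<in> ball 0 r"
  shows "W x $ i = conv (mol k) (wc i) x"
proof -
  have n: "norm x < r" using assms(3) by (simp add: dist_norm)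
  have k2: "2 / k > 0" using assms(1) by simp
  then have n1: "norm x < 1" using n assms(2) by linarith
  have "norm x + 2 / (4 / (1 - norm x)) < 1" using n1 by (simp add: field_simps)
  moreover have "norm x + 2 / k < 1" using n assms(2) by linarith
  ultimately show ?thesis
    unfolding W_def using conv_mol_indep[of "4 / (1 - norm x)" k x i] n1 assms(1) by simp
qed

lemma Hdisk_eq_Union: "Hdisk = \<Union> (ball 0 ` {0<..<1})"
proof (intro set_eqI iffI)
  fix x :: "real^2" assume "x \<in> Hdisk"
  then have "norm x < (1 + norm x) / 2" "(1 + norm x) / 2 < 1" "(1 + norm x) / 2 > 0"
    by (auto simp: in_Hdisk_iff add_pos_nonneg)
  then show "x \<in> \<Union> (ball 0 ` {0<..<1})" by (intro UN_I[of "(1 + norm x) / 2"]) (auto simp: dist_norm)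
qed (auto simp: in_Hdisk_iff dist_norm intro: less_trans)

lemma scale_ex: "r < 1 \<Longrightarrow> \<exists>k>0. r + 2 / k < (1::real)"
  by (rule exI[of _ "4 / (1 - r)"]) (simp add: field_simps)

lemma smooth_W: "smooth_fun Hdisk (\<lambda>x. W x $ i)"
  unfolding Hdisk_eq_Union
proof (rule smooth_fun_Union, safe)
  fix r :: real assume r: "r \<in> {0<..<1}"
  then obtain k where k: "k > 0" "r + 2 / k < 1" using scale_ex[of r] by auto
  have "smooth_fun (ball 0 r) (conv (mol k) (wc i))"
    by (rule smooth_fun_subset[OF smooth_conv[OF kernel_mol[OF k(1)] wc]]) simp
  then show "smooth_fun (ball 0 r) (\<lambda>x. W x $ i)"
    by (rule smooth_fun_cong[OF open_ball, rotated]) (simp add: W_eq[OF k])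
qed simp

lemma W_div_curl:
  assumes "x \<in> Hdisk"
  shows "pd 1 (\<lambda>x. W x $ 1) x + pd 2 (\<lambda>x. W x $ 2) x = 0" "pd 1 (\<lambda>x. W x $ 2) x = pd 2 (\<lambda>x. W x $ 1) x"
proof -
  obtain r where r: "x \<in> ball 0 r" "r < 1" using assms unfolding Hdisk_eq_Union by auto
  obtain k where k: "k > 0" "r + 2 / k < 1" using scale_ex[OF r(2)] by blast
  have p: "pd j (\<lambda>x. W x $ i) x = conv (pd j (mol k)) (wc i) x" for i j
  proof -
    have "pd j (\<lambda>x. W x $ i) x = pd j (conv (mol k) (wc i)) x"
      by (rule pd_cong[OF open_ball r(1)]) (rule W_eq[OF k])
    then show ?thesis by (simp add: kernel.pd_conv[OF kernel_mol[OF k(1)] wc])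
  qed
  have "norm x + 2 / k < 1" using r k by (simp add: dist_norm)
  note conv_div_curl[OF kernel_mol[OF k(1)] this]
  then show "pd 1 (\<lambda>x. W x $ 1) x + pd 2 (\<lambda>x. W x $ 2) x = 0" "pd 1 (\<lambda>x. W x $ 2) x = pd 2 (\<lambda>x. W x $ 1) x"
    unfolding p by simp_all
qed

text \<open>On a fixed smaller ball \<open>W\<close> equals every sufficiently fine mollification of
  \<open>w\<close>, and these converge to \<open>w\<close> in L2; a constant sequence can converge
  only to itself. Countably many balls exhaust the disk.\<close>

lemma W_AE: "AE x in HM. w x = W x"
proof -
  have Wm: "(\<lambda>x. W x $ i) \<in> borel_measurable HM" for i
    by (rule continuous_HM_measurable[OF smooth_fun_continuous[OF smooth_W]])
  have ball: "AE x in HM. x \<in> ball 0 r \<longrightarrow> W x $ i = w x $ i" if r: "r < 1" for r i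
  proof -
    let ?g = "\<lambda>x. indicator (ball 0 r) x *\<^sub>R (W x $ i - w x $ i)"
    obtain N :: nat where N: "2 / (1 - r) < real N" using reals_Archimedean2 by blast
    have n: "r + 2 / real (Suc n) < 1" if "n \<ge> N" for n
    proof -
      have "2 / (1 - r) < real (Suc n)" using N that by simp
      then show ?thesis using r by (simp add: field_simps)
    qed
    have gm: "?g \<in> borel_measurable HM"
      by (intro borel_measurable_scaleR borel_measurable_indicator borel_measurable_diff Wm sqint_measurable[OF wc])
        (use r in \<open>auto simp: sets_restrict_space_iff Hdisk_def\<close>)
    have b: "sqint ?g \<and> nsq ?g \<le> 1\<^sup>2 * nsq (\<lambda>x. conv (mol (real (Suc n))) (wc i) x - w x $ i)" if "n \<ge> N" for n
    proof -
      have s: "sqint (\<lambda>x. conv (mol (real (Suc n))) (wc i) x - w x $ i)"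
        by (rule sqint_diff(1)[OF nsq_conv_le(1)[OF _ wc] wc]) simp
      have le: "norm (?g x) \<le> 1 * norm (conv (mol (real (Suc n))) (wc i) x - w x $ i)" for x
        using W_eq[OF _ n[OF that], of x i] by (auto simp: indicator_def)
      show ?thesis using sqint_bound[OF s gm le] by blast
    qed
    have "nsq ?g \<le> 0"
    proof (rule LIMSEQ_le_const)
      show "(\<lambda>n. nsq (\<lambda>x. conv (mol (real (Suc n))) (wc i) x - w x $ i)) \<longlonglongrightarrow> 0"
        by (rule mollification_converges[OF wc])
      show "\<exists>N. \<forall>n\<ge>N. nsq ?g \<le> nsq (\<lambda>x. conv (mol (real (Suc n))) (wc i) x - w x $ i)"
        using b by (intro exI[of _ N]) simp
    qed
    then have "nsq ?g = 0" using nsq_nonneg[of ?g] by simp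
    then have "AE x in HM. (norm (?g x))\<^sup>2 = 0"
      unfolding nsq_def using integral_nonneg_eq_0_iff_AE[OF sqint_integrable_sq, of ?g] b[of N] by simp
    then show ?thesis by eventually_elim (auto simp: indicator_def)
  qed
  have "AE x in HM. \<forall>m::nat. \<forall>i::2. x \<in> ball 0 (1 - inverse (real (Suc m))) \<longrightarrow> W x $ i = w x $ i"
    unfolding AE_all_countable by (intro allI ball) simp
  moreover have "AE x in HM. x \<in> Hdisk" by (intro AE_I2) (simp add: space_HM)
  ultimately show ?thesis
  proof eventually_elim
    case (elim x)
    then have "1 - norm x > 0" by (simp add: in_Hdisk_iff)
    then obtain m where "inverse (real (Suc m)) < 1 - norm x" using reals_Archimedean by blast
    then have "x \<in> ball 0 (1 - inverse (real (Suc m)))" by (simp add: dist_norm)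
    then show ?case using elim(1) by (auto simp: vec_eq_iff)
  qed
qed

end

section \<open>Harmonic potentials\<close>

definition vec_of :: "complex \<Rightarrow> real^2" where
  "vec_of z = (\<chi> i. if i = 1 then Re z else Im z)"

lemma vec_of_nth [simp]: "vec_of z $ 1 = Re z" "vec_of z $ 2 = Im z"
  by (simp_all add: vec_of_def)

lemma norm_vec_of: "norm (vec_of z) = norm z"
proof -
  have "(norm (vec_of z))\<^sup>2 = (norm z)\<^sup>2"
    by (simp add: norm_vec2_sq vec_of_def cmod_power2)
  then show ?thesis by simp
qed

lemma vec_of_has_derivative: "(vec_of has_derivative vec_of) (at z)"
proof (rule bounded_linear_imp_has_derivative)
  show "bounded_linear vec_of"
  proof
    show "\<exists>K. \<forall>x. norm (vec_of x) \<le> norm x * K" by (rule exI[of _ 1]) (simp add: norm_vec_of)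
  qed (auto simp: vec_of_def vec_eq_iff)
qed

text \<open>The two equations are the Cauchy-Riemann equations for \<open>f = W_1 - i W_2\<close>.
  The disk is convex, so \<open>f\<close> has a holomorphic primitive \<open>g\<close>, and the
  gradient of \<open>Re g\<close> is \<open>(Re f, - Im f)\<close>, which is
  \<open>W\<close>.\<close>

lemma potential_exists:
  fixes W :: "real^2 \<Rightarrow> real^2"
  assumes s: "\<And>i. smooth_fun Hdisk (\<lambda>x. W x $ i)"
    and div: "\<And>x. x \<in> Hdisk \<Longrightarrow> pd 1 (\<lambda>x. W x $ 1) x + pd 2 (\<lambda>x. W x $ 2) x = 0"
    and curl: "\<And>x. x \<in> Hdisk \<Longrightarrow> pd 1 (\<lambda>x. W x $ 2) x = pd 2 (\<lambda>x. W x $ 1) x"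
  obtains F where "smooth_fun Hdisk F" "\<And>x. x \<in> Hdisk \<Longrightarrow> dfun F x = W x"
proof -
  define f where "f z = complex_of_real (W (vec_of z) $ 1) - \<i> * complex_of_real (W (vec_of z) $ 2)" for z
  have "f field_differentiable (at z)" if z: "z \<in> ball 0 1" for z
  proof -
    let ?x = "vec_of z"
    have x: "?x \<in> Hdisk" using z by (simp add: in_Hdisk_iff norm_vec_of)
    have d: "((\<lambda>z. W (vec_of z) $ i) has_derivative (\<lambda>h. \<Sum>j\<in>UNIV. pd j (\<lambda>x. W x $ i) ?x * vec_of h $ j)) (at z)" for i
      by (rule has_derivative_compose[where f = vec_of and g = "\<lambda>x. W x $ i",
          OF vec_of_has_derivative has_derivative_pd[OF smooth_fun_differentiable[OF s x]]])
    define a where "a = pd 1 (\<lambda>x. W x $ 1) ?x"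
    define b where "b = pd 2 (\<lambda>x. W x $ 1) ?x"
    have ab: "pd 2 (\<lambda>x. W x $ 2) ?x = - a" "pd 1 (\<lambda>x. W x $ 2) ?x = b"
      using div[OF x] curl[OF x] by (auto simp: a_def b_def)
    have "(f has_derivative (\<lambda>h. complex_of_real (a * Re h + b * Im h) - \<i> * complex_of_real (b * Re h - a * Im h))) (at z)"
      unfolding f_def
      by (intro has_derivative_diff has_derivative_mult_right has_derivative_of_real)
        (use d[of 1] d[of 2] in \<open>simp_all add: sum_2 ab a_def[symmetric] b_def[symmetric]\<close>)
    \<comment> \<open>The real derivative is multiplication by a complex number, which is complex
      differentiability.\<close>
    moreover have "(\<lambda>h. complex_of_real (a * Re h + b * Im h) - \<i> * complex_of_real (b * Re h - a * Im h)) = (*) (Complex a (- b))"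
      by (auto simp: complex_eq_iff)
    ultimately show ?thesis
      unfolding field_differentiable_def has_field_derivative_def by auto
  qed
  then have "f holomorphic_on ball 0 1"
    by (simp add: holomorphic_on_def field_differentiable_at_within)
  then obtain g where g: "\<And>z. z \<in> ball 0 1 \<Longrightarrow> (g has_field_derivative f z) (at z within ball 0 1)"
    using holomorphic_convex_primitive'[OF convex_ball open_ball] by blast
  define F where "F x = Re (g (Complex (x $ 1) (x $ 2)))" for x :: "real^2"
  have FD: "(F has_derivative (\<lambda>h. \<Sum>i\<in>UNIV. W x $ i * h $ i)) (at x)" if x: "x \<in> Hdisk" for x
  proof -
    let ?z = "Complex (x $ 1) (x $ 2)"
    have vz: "vec_of ?z = x" using exhaust_2 by (auto simp: vec_of_def vec_eq_iff)
    have z: "?z \<in> ball 0 1" using x norm_vec_of[of ?z] by (simp add: vz in_Hdisk_iff)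
    have gd: "(g has_derivative (\<lambda>h. f ?z * h)) (at ?z)"
      using g[OF z] at_within_open[OF z open_ball] by (simp add: has_field_derivative_def)
    have "bounded_linear (\<lambda>h::real^2. complex_of_real (h $ 1) + \<i> * complex_of_real (h $ 2))"
      by (intro bounded_linear_add bounded_linear_const_mult bounded_linear_compose[OF bounded_linear_of_real] bounded_linear_vec_nth)
    then have "((\<lambda>h::real^2. complex_of_real (h $ 1) + \<i> * complex_of_real (h $ 2)) has_derivative
        (\<lambda>h. complex_of_real (h $ 1) + \<i> * complex_of_real (h $ 2))) (at x)"
      by (rule bounded_linear_imp_has_derivative)
    then have ld: "((\<lambda>h::real^2. Complex (h $ 1) (h $ 2)) has_derivative (\<lambda>h. Complex (h $ 1) (h $ 2))) (at x)"
      by (simp add: Complex_eq)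
    have "((\<lambda>h. g (Complex (h $ 1) (h $ 2))) has_derivative (\<lambda>h. f ?z * Complex (h $ 1) (h $ 2))) (at x)"
      by (rule has_derivative_compose[where g = g, OF ld gd])
    from bounded_linear.has_derivative[OF bounded_linear_Re this]
    have "(F has_derivative (\<lambda>h. Re (f ?z * Complex (h $ 1) (h $ 2)))) (at x)"
      unfolding F_def .
    moreover have "Re (f ?z * Complex (h $ 1) (h $ 2)) = (\<Sum>i\<in>UNIV. W x $ i * h $ i)" for h :: "real^2"
      by (simp add: f_def vz sum_2)
    ultimately show ?thesis by simp
  qed
  have p: "pd i F x = W x $ i" if "x \<in> Hdisk" for i x
    unfolding pd_eq[OF FD[OF that]] using exhaust_2[of i] by (auto simp: sum_2 axis_def)
  show thesis
  proof (rule that)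
    show "smooth_fun Hdisk F"
    proof (rule smooth_fun_I)
      show "F differentiable (at x)" if "x \<in> Hdisk" for x
        using FD[OF that] unfolding differentiable_def by blast
      show "smooth_fun Hdisk (pd i F)" for i
        by (rule smooth_fun_cong[OF open_Hdisk _ s]) (simp add: p)
    qed
    show "dfun F x = W x" if "x \<in> Hdisk" for x
      by (simp add: dfun_def p[OF that])
  qed
qed

section \<open>Conformal reduction to the Euclidean disk\<close>

text \<open>Equal to \<open>(1 - |x|) (1 + |x|)\<close>, hence comparable with the distance to the
  boundary circle but smooth at the origin; the conformal factor is
  \<open>2 / (a * dl x)\<close>.\<close>

definition dl :: "real^2 \<Rightarrow> real" where
  "dl x = 1 - (norm x)\<^sup>2"

lemma dl_pos: "x \<in> Hdisk \<Longrightarrow> dl x > 0"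
  by (simp add: dl_def in_Hdisk_iff power_less_one_iff)

lemma dl_le_1: "dl x \<le> 1"
  by (simp add: dl_def)

lemma smooth_dl: "open S \<Longrightarrow> smooth_fun S dl"
  unfolding dl_def[abs_def] by (intro smooth_fun_diff smooth_fun_const smooth_fun_norm_sq)

lemma pd_dl: "pd i dl x = - 2 * x $ i"
  unfolding dl_def[abs_def]
  using pd_diff[of "\<lambda>_. 1" x "\<lambda>x. (norm x)\<^sup>2" i] smooth_fun_differentiable[OF smooth_fun_norm_sq[OF open_UNIV] UNIV_I, of x]
  by (simp add: pd_norm_sq)

lemma smooth_inverse_dl: "smooth_fun Hdisk (\<lambda>x. inverse (dl x))"
  by (rule smooth_fun_inverse[OF open_Hdisk _ smooth_dl[OF open_Hdisk]]) (use dl_pos in force)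

lemma dl_measurable: "dl \<in> borel_measurable HM"
  by (rule continuous_HM_measurable[OF smooth_fun_continuous[OF smooth_dl[OF open_Hdisk]]])

lemma inverse_dl_measurable: "(\<lambda>x. inverse (dl x)) \<in> borel_measurable HM"
  by (rule continuous_HM_measurable[OF smooth_fun_continuous[OF smooth_inverse_dl]])

lemma rho_dl: "rho a x = 2 / (a * dl x)"
  by (simp add: rho_def dl_def)

text \<open>\<open>matrix_inv\<close> is a choice among two-sided inverses, so an inverse is
  exhibited first and the entries are then read off from the product with the chosen one.\<close>

lemma matrix_inv_scalar:
  fixes c :: real and i j :: "'n::finite"
  assumes "c \<noteq> 0"
  shows "matrix_inv (\<chi> k l. if k = l then c else 0) $ i $ j = (if i = j then 1 / c else 0 :: real)"
proof -
  let ?A = "(\<chi> k l. if k = l then c else 0) :: real^'n^'n"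
  let ?B = "(\<chi> k l. if k = l then 1 / c else 0) :: real^'n^'n"
  have mult: "(?A ** M) $ i $ j = c * M $ i $ j" for M i j
    by (simp add: matrix_matrix_mult_def if_distrib[of "\<lambda>x. x * _"] cong: if_cong)
  have mult': "(?B ** M) $ i $ j = M $ i $ j / c" for M i j
    by (simp add: matrix_matrix_mult_def if_distrib[of "\<lambda>x. x * _"] cong: if_cong)
  have "?A ** ?B = mat 1" "?B ** ?A = mat 1"
    using assms by (simp_all add: vec_eq_iff mult mult' mat_def)
  then have "\<exists>M. ?A ** M = mat 1 \<and> M ** ?A = mat 1" by (intro exI[of _ ?B] conjI)
  then have "?A ** matrix_inv ?A = mat 1"
    unfolding matrix_inv_def by (rule someI2_ex) (rule conjunct1)
  then have "(?A ** matrix_inv ?A) $ i $ j = mat 1 $ i $ j" by simp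
  then show ?thesis unfolding mult using assms by (simp add: mat_def field_simps split: if_splits)
qed

lemma inner_mat2: "S \<bullet> T = (\<Sum>i\<in>UNIV. \<Sum>j\<in>UNIV. S $ i $ j * T $ i $ j)" for S T :: "real^2^2"
  by (simp add: inner_vec_def)

lemma norm_mat2_le:
  fixes M :: "real^2^2"
  assumes "\<And>i j. \<bar>M $ i $ j\<bar> \<le> c"
  shows "norm M \<le> 4 * c"
proof -
  have "norm M \<le> (\<Sum>i\<in>UNIV. norm (M $ i))"
    by (simp add: norm_vec_def L2_set_le_sum)
  also have "\<dots> \<le> (\<Sum>i\<in>UNIV. \<Sum>j\<in>UNIV. norm (M $ i $ j))"
    by (intro sum_mono) (simp add: norm_vec_def L2_set_le_sum)
  also have "\<dots> \<le> (\<Sum>i\<in>(UNIV::2 set). \<Sum>j\<in>(UNIV::2 set). c)"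
    by (intro sum_mono) (simp add: assms)
  finally show ?thesis by (simp add: sum_2)
qed

text \<open>The contraction of the Christoffel symbols with \<open>u\<close>, in closed form and
  without \<open>a\<close>; see \<open>christoffel_sum\<close>. It has the singularity
  \<open>1 / dl\<close> at the boundary.\<close>

definition Gam :: "real^2 \<Rightarrow> real^2 \<Rightarrow> real^2^2" where
  "Gam x u = (\<chi> i j. 2 * inverse (dl x) * (x $ i * u $ j + x $ j * u $ i - (if i = j then x \<bullet> u else 0)))"

definition Sym :: "(real^2 \<Rightarrow> real^2) \<Rightarrow> real^2 \<Rightarrow> real^2^2" where
  "Sym u x = (\<chi> i j. (1/2) * (pd i (\<lambda>y. u y $ j) x + pd j (\<lambda>y. u y $ i) x))"

lemma sqint_dl_measurable:
  fixes T :: "real^2 \<Rightarrow> 'b::euclidean_space"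
  assumes "(\<lambda>x. dl x *\<^sub>R T x) \<in> borel_measurable HM"
  shows "T \<in> borel_measurable HM"
proof -
  have "(\<lambda>x. inverse (dl x) *\<^sub>R (dl x *\<^sub>R T x)) \<in> borel_measurable HM"
    by (intro borel_measurable_scaleR inverse_dl_measurable assms)
  then show ?thesis
    by (subst measurable_cong[where g = "\<lambda>x. inverse (dl x) *\<^sub>R (dl x *\<^sub>R T x)"])
      (use dl_pos in \<open>force simp: space_HM\<close>)+
qed

lemma measurable_mat2: "(\<forall>i j. (\<lambda>x. T x $ i $ j) \<in> borel_measurable M) \<longleftrightarrow> (T :: 'a \<Rightarrow> real^2^2) \<in> borel_measurable M"
  using measurable_vec2I[of T M] measurable_vec2I[of "\<lambda>x. T x $ _" M] measurable_vec_nth[of T M] measurable_vec_nth[of "\<lambda>x. T x $ _" M]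
  by blast

text \<open>The weight \<open>dl\<close> cancels the singularity exactly. The constant is crude: at
  most \<open>6 * norm u\<close> in each of four entries.\<close>

lemma Gam_bound: "x \<in> Hdisk \<Longrightarrow> norm (dl x *\<^sub>R Gam x u) \<le> 24 * norm u"
proof -
  assume x: "x \<in> Hdisk"
  have n: "norm x \<le> 1" using x by (simp add: in_Hdisk_iff)
  have pr: "\<bar>x $ i * u $ j\<bar> \<le> norm u" for i j
  proof -
    have "\<bar>x $ i\<bar> * \<bar>u $ j\<bar> \<le> 1 * norm u"
      using component_le_norm_cart[of x i] component_le_norm_cart[of u j] n by (intro mult_mono) auto
    then show ?thesis by (simp add: abs_mult)
  qed
  have ip: "\<bar>x \<bullet> u\<bar> \<le> norm u"
    using Cauchy_Schwarz_ineq2[of x u] mult_right_mono[OF n, of "norm u"] by simp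
  have e: "norm ((dl x *\<^sub>R Gam x u) $ i $ j) \<le> 6 * norm u" for i j
  proof -
    define r where "r = (if i = j then x \<bullet> u else 0)"
    have r: "\<bar>r\<bar> \<le> norm u" using ip by (simp add: r_def)
    have "(dl x *\<^sub>R Gam x u) $ i $ j = 2 * (x $ i * u $ j + x $ j * u $ i - r)"
      using dl_pos[OF x] by (simp add: Gam_def r_def field_simps)
    moreover have "\<bar>2 * (x $ i * u $ j + x $ j * u $ i - r)\<bar> \<le> 6 * norm u"
      using pr[of i j] pr[of j i] r by (auto simp: abs_le_iff)
    ultimately show ?thesis by simp
  qed
  have "norm (dl x *\<^sub>R Gam x u) \<le> 4 * (6 * norm u)"
    by (rule norm_mat2_le) (use e in \<open>simp only: real_norm_def\<close>)
  then show ?thesis by simp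
qed

lemma Gam_diff: "Gam x (u - v) = Gam x u - Gam x v"
  by (simp add: Gam_def vec_eq_iff inner_diff_right algebra_simps)

lemma Gam_measurable:
  assumes "u \<in> borel_measurable HM"
  shows "(\<lambda>x. Gam x (u x)) \<in> borel_measurable HM"
proof -
  have x: "(\<lambda>x. x) \<in> borel_measurable HM" by (rule continuous_HM_measurable) (rule continuous_on_id)
  have "(\<lambda>x. Gam x (u x) $ i $ j) \<in> borel_measurable HM" for i j
  proof -
    have "(\<lambda>x. if i = j then x \<bullet> u x else 0) \<in> borel_measurable HM"
      by (cases "i = j") (simp_all add: borel_measurable_inner x assms)
    then have "(\<lambda>x. 2 * inverse (dl x) * (x $ i * u x $ j + x $ j * u x $ i - (if i = j then x \<bullet> u x else 0))) \<in> borel_measurable HM"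
      by (intro borel_measurable_times borel_measurable_add borel_measurable_diff borel_measurable_const
          inverse_dl_measurable measurable_vec_nth x assms)
    then show ?thesis by (simp add: Gam_def)
  qed
  then show ?thesis using measurable_mat2 by blast
qed

lemma sqint_Gam:
  assumes "sqint u"
  shows "sqint (\<lambda>x. dl x *\<^sub>R Gam x (u x))" "nsq (\<lambda>x. dl x *\<^sub>R Gam x (u x)) \<le> 24\<^sup>2 * nsq u"
  using sqint_bound[OF assms borel_measurable_scaleR[OF dl_measurable Gam_measurable[OF sqint_measurable[OF assms]]], of 24]
    Gam_bound by auto

text \<open>Weak symmetric gradients are square integrable only after multiplication by
  \<open>dl\<close>; a test function absorbs the inverse weight, being zero near the
  boundary.\<close>

lemma integrable_dl_test:
  fixes f :: "real^2 \<Rightarrow> real"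
  assumes "sqint (\<lambda>x. dl x * f x)" "test_fun \<phi>"
  shows "integrable HM (\<lambda>x. f x * \<phi> x)"
proof -
  have "integrable HM (\<lambda>x. (dl x * f x) * (inverse (dl x) * \<phi> x))"
    by (intro sqint_mult assms(1) sqint_test_fun test_fun_mult smooth_inverse_dl assms(2))
  then show ?thesis
    by (subst Bochner_Integration.integrable_cong[OF refl, where g = "\<lambda>x. (dl x * f x) * (inverse (dl x) * \<phi> x)"])
      (use dl_pos in \<open>force simp: space_HM\<close>)+
qed

lemma sqint_mat:
  fixes T :: "real^2 \<Rightarrow> real^2^2"
  assumes "\<And>i j. sqint (\<lambda>x. T x $ i $ j)"
  shows "sqint T" "nsq T = (\<Sum>i\<in>UNIV. \<Sum>j\<in>UNIV. nsq (\<lambda>x. T x $ i $ j))"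
proof -
  have m: "T \<in> borel_measurable HM" using assms sqint_measurable measurable_mat2 by blast
  have e: "(norm (T x))\<^sup>2 = (\<Sum>i\<in>UNIV. \<Sum>j\<in>UNIV. (norm (T x $ i $ j))\<^sup>2)" for x
    unfolding power2_norm_eq_inner inner_mat2 by simp
  have i: "integrable HM (\<lambda>x. (norm (T x $ i $ j))\<^sup>2)" for i j by (rule sqint_integrable_sq[OF assms])
  show "sqint T"
    unfolding sqint_def e by (intro conjI m Bochner_Integration.integrable_sum i)
  show "nsq T = (\<Sum>i\<in>UNIV. \<Sum>j\<in>UNIV. nsq (\<lambda>x. T x $ i $ j))"
    unfolding nsq_def e using i by (simp add: Bochner_Integration.integral_sum Bochner_Integration.integrable_sum)
qed

lemma sqint_mat_nth:
  fixes T :: "real^2 \<Rightarrow> real^2^2"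
  assumes "sqint T"
  shows "sqint (\<lambda>x. T x $ i $ j)"
proof (rule sqint_bound(1)[OF assms, where c = 1])
  show "(\<lambda>x. T x $ i $ j) \<in> borel_measurable HM" by (intro measurable_vec_nth sqint_measurable assms)
  show "norm (T x $ i $ j) \<le> 1 * norm (T x)" for x
    using component_le_norm_cart[of "T x $ i" j] Finite_Cartesian_Product.norm_nth_le[of "T x" i] by simp
qed

definition weak_sym :: "(real^2 \<Rightarrow> real^2) \<Rightarrow> (real^2 \<Rightarrow> real^2^2) \<Rightarrow> bool" where
  "weak_sym u S \<longleftrightarrow> (\<forall>\<phi>. test_fun \<phi> \<longrightarrow> (\<forall>i j. (LINT x|HM. S x $ i $ j * \<phi> x) =
      (LINT x|HM. - (1/2) * (u x $ j * pd i \<phi> x + u x $ i * pd j \<phi> x))))"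

lemma cc_formD:
  fixes \<theta> :: "real^2 \<Rightarrow> real^2"
  assumes "cc_form \<theta>"
  shows "test_fun (\<lambda>x. \<theta> x $ i)"
proof -
  have s: "smooth_fun Hdisk (\<lambda>x. \<theta> x $ i)" and c: "csupp_in Hdisk \<theta>"
    using assms by (auto simp: cc_form_def smooth_form_def)
  show ?thesis
    by (rule csupp_inE[OF c], rule test_funI[OF s]) auto
qed

lemma cc_formI:
  fixes \<theta> :: "real^2 \<Rightarrow> real^2"
  assumes "\<And>i. test_fun (\<lambda>x. \<theta> x $ i)"
  shows "cc_form \<theta>"
proof -
  obtain r where r: "r < 1" "\<forall>x. norm x > r \<longrightarrow> \<theta> x $ 1 = 0" using test_funD[OF assms[of 1]] by blast
  obtain s where s: "s < 1" "\<forall>x. norm x > s \<longrightarrow> \<theta> x $ 2 = 0" using test_funD[OF assms[of 2]] by blast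
  have "csupp_in Hdisk \<theta>"
    by (rule csupp_inI[of "max r s"]) (use r s in \<open>auto simp: vec_eq_iff forall_2\<close>)
  then show ?thesis
    using test_fun_smooth[OF assms] by (simp add: cc_form_def smooth_form_def)
qed

lemma sqint_cc:
  assumes "cc_form \<theta>"
  shows "sqint \<theta>" "sqint (\<lambda>x. dl x *\<^sub>R Sym \<theta> x)"
proof -
  show "sqint \<theta>" by (rule sqint_vec2(1)) (rule sqint_test_fun[OF cc_formD[OF assms]])
  have t: "test_fun (\<lambda>x. dl x * ((1/2) * (pd i (\<lambda>y. \<theta> y $ j) x + pd j (\<lambda>y. \<theta> y $ i) x)))" for i j
    by (intro test_fun_mult smooth_dl open_Hdisk test_fun_cmult test_fun_add test_fun_pd cc_formD assms)
  show "sqint (\<lambda>x. dl x *\<^sub>R Sym \<theta> x)"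
    by (rule sqint_mat(1)) (use sqint_test_fun[OF t] in \<open>simp add: Sym_def\<close>)
qed

section \<open>The Riemannian notions in disk coordinates\<close>

context
  fixes a :: real
  assumes a: "a > 0"
begin

lemma rho_pos: "x \<in> Hdisk \<Longrightarrow> rho a x > 0"
  using a dl_pos by (simp add: rho_dl)

lemma ginv_eq: "x \<in> Hdisk \<Longrightarrow> ginv a i j x = (if i = j then 1 / (rho a x)\<^sup>2 else 0)"
  unfolding ginv_def gmet_def using rho_pos[of x] by (subst matrix_inv_scalar) auto

lemma voldens_eq: "x \<in> Hdisk \<Longrightarrow> voldens a x = (rho a x)\<^sup>2"
  unfolding voldens_def gmet_def by (simp add: det_2 power2_eq_square real_sqrt_mult)

text \<open>Conformal invariance in dimension two: the inverse metric contributes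
  \<open>rho^(-2)\<close>, the volume \<open>rho^2\<close>.\<close>

lemma gform_voldens: "x \<in> Hdisk \<Longrightarrow> gform a x u v * voldens a x = u \<bullet> v"
  using rho_pos[of x] by (simp add: gform_def ginv_eq voldens_eq sum_2 inner_vec2 field_simps)

text \<open>Two inverse metrics against one volume density leave
  \<open>rho^(-2) = (a * dl / 2)^2\<close>. This is the origin of the weight \<open>dl\<close>
  carried by all symmetric gradients.\<close>

lemma gtens_voldens: "x \<in> Hdisk \<Longrightarrow> gtens a x S T * voldens a x = (a / 2)\<^sup>2 * ((dl x)\<^sup>2 * (S \<bullet> T))"
proof -
  assume x: "x \<in> Hdisk"
  have "gtens a x S T = (1 / (rho a x)\<^sup>2)\<^sup>2 * (S \<bullet> T)"
    by (simp add: gtens_def ginv_eq[OF x] sum_2 inner_mat2 power2_eq_square algebra_simps)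
  moreover have "(1 / (rho a x)\<^sup>2)\<^sup>2 * (rho a x)\<^sup>2 = (a / 2)\<^sup>2 * (dl x)\<^sup>2"
    using a dl_pos[OF x] by (simp add: rho_dl field_simps power2_eq_square)
  ultimately show ?thesis using voldens_eq[OF x] by (simp add: mult_ac)
qed

lemma pd_gmet:
  assumes x: "x \<in> Hdisk"
  shows "pd i (gmet a j k) x = (if j = k then (rho a x)\<^sup>2 * (4 * x $ i / dl x) else 0)"
proof (cases "j = k")
  case True
  have s: "smooth_fun Hdisk (\<lambda>x. inverse (dl x) * inverse (dl x))"
    by (intro smooth_fun_mult open_Hdisk smooth_inverse_dl)
  have der: "(inverse has_real_derivative - (inverse (dl x) * inverse (dl x))) (at (dl x))"
    using dl_pos[OF x] by (auto intro!: derivative_eq_intros simp: power2_eq_square)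
  have p: "pd i (\<lambda>x. inverse (dl x)) x = - (inverse (dl x) * inverse (dl x)) * (- 2 * x $ i)"
    using pd_compose(1)[where f = dl and b = inverse, OF smooth_fun_differentiable[OF smooth_dl[OF open_Hdisk] x] der]
    by (simp add: pd_dl)
  have "gmet a j k = (\<lambda>x. (2 / a)\<^sup>2 * (inverse (dl x) * inverse (dl x)))"
    using True by (rule_tac ext) (simp add: gmet_def rho_dl power2_eq_square divide_inverse)
  then have "pd i (gmet a j k) x = (2 / a)\<^sup>2 * (inverse (dl x) * pd i (\<lambda>x. inverse (dl x)) x + pd i (\<lambda>x. inverse (dl x)) x * inverse (dl x))"
    using pd_cmult[OF smooth_fun_differentiable[OF s x]]
      pd_mult[OF smooth_fun_differentiable[OF smooth_inverse_dl x] smooth_fun_differentiable[OF smooth_inverse_dl x]] by simp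
  then show ?thesis
    using True a dl_pos[OF x] unfolding p by (simp add: rho_dl field_simps power2_eq_square)
next
  case False
  then have "gmet a j k = (\<lambda>x. 0)" by (simp add: gmet_def fun_eq_iff)
  then show ?thesis using False by simp
qed

text \<open>For a conformal metric the symbols are combinations of derivatives of
  \<open>log rho\<close>, and here the \<open>i\<close>-th derivative of \<open>log rho\<close> is
  \<open>2 x_i / dl x\<close>.\<close>

lemma christoffel_sum:
  assumes x: "x \<in> Hdisk"
  shows "(\<Sum>k\<in>UNIV. christoffel a k i j x * u $ k) = Gam x u $ i $ j"
proof -
  have c: "christoffel a k i j x = (2 / dl x) * ((if j = k then x $ i else 0) + (if i = k then x $ j else 0) - (if i = j then x $ k else 0))" for k
    using rho_pos[OF x] dl_pos[OF x] exhaust_2[of k]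
    by (auto simp: christoffel_def ginv_eq[OF x] pd_gmet[OF x] sum_2 field_simps)
  show ?thesis
    unfolding sum_2 c divide_inverse using exhaust_2[of i] exhaust_2[of j]
    by (elim disjE) (simp_all add: Gam_def inner_vec2 algebra_simps)
qed

lemma Def_classical_eq: "x \<in> Hdisk \<Longrightarrow> Def_classical a u x = Sym u x - Gam x (u x)"
  by (simp add: vec_eq_iff Def_classical_def Sym_def christoffel_sum)

lemma codiff_eq: "x \<in> Hdisk \<Longrightarrow> codiff a u x = - (1 / voldens a x) * (pd 1 (\<lambda>y. u y $ 1) x + pd 2 (\<lambda>y. u y $ 2) x)"
proof -
  assume x: "x \<in> Hdisk"
  have "pd i (\<lambda>y. voldens a y * (\<Sum>j\<in>UNIV. ginv a i j y * u y $ j)) x = pd i (\<lambda>y. u y $ i) x" for i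
  proof (rule pd_cong[OF open_Hdisk x])
    fix y assume y: "y \<in> Hdisk"
    show "voldens a y * (\<Sum>j\<in>UNIV. ginv a i j y * u y $ j) = u y $ i"
      using rho_pos[OF y] exhaust_2[of i] by (auto simp: voldens_eq[OF y] ginv_eq[OF y] sum_2)
  qed
  then show ?thesis by (simp add: codiff_def sum_2)
qed

lemma laplace_eq: "x \<in> Hdisk \<Longrightarrow> laplace_beltrami a F x = (1 / voldens a x) * (pd 1 (pd 1 F) x + pd 2 (pd 2 F) x)"
proof -
  assume x: "x \<in> Hdisk"
  have "pd i (\<lambda>y. voldens a y * (\<Sum>j\<in>UNIV. ginv a i j y * pd j F y)) x = pd i (pd i F) x" for i
  proof (rule pd_cong[OF open_Hdisk x])
    fix y assume y: "y \<in> Hdisk"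
    show "voldens a y * (\<Sum>j\<in>UNIV. ginv a i j y * pd j F y) = pd i F y"
      using rho_pos[OF y] exhaust_2[of i] by (auto simp: voldens_eq[OF y] ginv_eq[OF y] sum_2)
  qed
  then show ?thesis by (simp add: laplace_beltrami_def sum_2)
qed

lemma voldens_pos: "x \<in> Hdisk \<Longrightarrow> voldens a x > 0"
  using rho_pos[of x] by (simp add: voldens_eq)

lemma harmonic_H_iff: "harmonic_H a F \<longleftrightarrow> smooth_fun Hdisk F \<and> (\<forall>x\<in>Hdisk. pd 1 (pd 1 F) x + pd 2 (pd 2 F) x = 0)"
  using voldens_pos by (force simp: harmonic_H_def laplace_eq)

lemma Lambda_c_sigma_iff:
  "Lambda_c_sigma a \<theta> \<longleftrightarrow> cc_form \<theta> \<and> (\<forall>x\<in>Hdisk. pd 1 (\<lambda>y. \<theta> y $ 1) x + pd 2 (\<lambda>y. \<theta> y $ 2) x = 0)"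
  using voldens_pos by (force simp: Lambda_c_sigma_def codiff_eq)

lemma weak_codiff_0_iff:
  "weak_codiff a u (\<lambda>x. 0) \<longleftrightarrow> (\<forall>\<phi>. test_fun \<phi> \<longrightarrow> (LINT x|HM. u x \<bullet> dfun \<phi> x) = 0)"
proof -
  have "hint a (\<lambda>x. gform a x (u x) (dfun \<phi> x)) = (LINT x|HM. u x \<bullet> dfun \<phi> x)" for \<phi>
    unfolding hint_def by (rule Bochner_Integration.integral_cong) (simp_all add: space_HM gform_voldens)
  moreover have "hint a (\<lambda>x. 0 * \<phi> x) = 0" for \<phi> by (simp add: hint_def)
  ultimately have "hint a (\<lambda>x. 0 * \<phi> x) = hint a (\<lambda>x. gform a x (u x) (dfun \<phi> x)) \<longleftrightarrow>
      (LINT x|HM. u x \<bullet> dfun \<phi> x) = 0" for \<phi>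
    by (simp only:) (rule eq_commute)
  then show ?thesis unfolding weak_codiff_def by blast
qed

lemma L2_form_iff: "L2_form a u \<longleftrightarrow> sqint u"
proof -
  have "integrable HM (\<lambda>x. gform a x (u x) (u x) * voldens a x) \<longleftrightarrow> integrable HM (\<lambda>x. (norm (u x))\<^sup>2)"
    by (rule Bochner_Integration.integrable_cong) (simp_all add: space_HM gform_voldens power2_norm_eq_inner)
  moreover have "(\<forall>i. (\<lambda>x. u x $ i) \<in> borel_measurable HM) \<longleftrightarrow> u \<in> borel_measurable HM"
    using measurable_vec2I[of u] measurable_vec_nth[of u] by blast
  ultimately show ?thesis by (simp add: L2_form_def sqint_def)
qed

lemma gtens_sq: "x \<in> Hdisk \<Longrightarrow> gtens a x S S * voldens a x = (a / 2)\<^sup>2 * (norm (dl x *\<^sub>R S))\<^sup>2"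
  unfolding power2_norm_eq_inner inner_scaleR_left inner_scaleR_right
  by (simp add: gtens_voldens power2_eq_square)

lemma L2_tens_iff: "L2_tens a T \<longleftrightarrow> sqint (\<lambda>x. dl x *\<^sub>R T x)"
proof -
  have "integrable HM (\<lambda>x. gtens a x (T x) (T x) * voldens a x) \<longleftrightarrow> integrable HM (\<lambda>x. (a / 2)\<^sup>2 * (norm (dl x *\<^sub>R T x))\<^sup>2)"
    by (rule Bochner_Integration.integrable_cong[OF refl]) (simp only: space_HM gtens_sq)
  also have "\<dots> \<longleftrightarrow> integrable HM (\<lambda>x. (norm (dl x *\<^sub>R T x))\<^sup>2)"
    using a by (subst integrable_mult_left_iff) simp
  finally show ?thesis
    unfolding L2_tens_def sqint_def measurable_mat2
    using sqint_dl_measurable[of T] borel_measurable_scaleR[OF dl_measurable, of T] by blast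
qed

lemma H1dist2_eq:
  "H1dist2 a \<theta> u T = nsq (\<lambda>x. \<theta> x - u x) + 2 * ((a / 2)\<^sup>2 * nsq (\<lambda>x. dl x *\<^sub>R (Def_classical a \<theta> x - T x)))"
proof -
  have "L2norm2_form a (\<lambda>x. \<theta> x - u x) = nsq (\<lambda>x. \<theta> x - u x)"
    unfolding L2norm2_form_def hint_def nsq_def
    by (rule Bochner_Integration.integral_cong) (simp_all add: space_HM gform_voldens power2_norm_eq_inner)
  moreover have "L2norm2_tens a (\<lambda>x. Def_classical a \<theta> x - T x) = (LINT x|HM. (a / 2)\<^sup>2 * (norm (dl x *\<^sub>R (Def_classical a \<theta> x - T x)))\<^sup>2)"
    unfolding L2norm2_tens_def hint_def
    by (rule Bochner_Integration.integral_cong[OF refl]) (simp only: space_HM gtens_sq)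
  ultimately show ?thesis by (simp add: H1dist2_def nsq_def)
qed

text \<open>The connection term has order zero and is integrable against test functions, so it can
  be moved into the tensor. What remains is a purely Euclidean condition.\<close>

lemma weak_Def_iff:
  assumes u: "sqint u" and T: "sqint (\<lambda>x. dl x *\<^sub>R T x)"
  shows "weak_Def a u T \<longleftrightarrow> weak_sym u (\<lambda>x. T x + Gam x (u x))"
proof -
  have "((LINT x|HM. T x $ i $ j * \<phi> x) =
      (LINT x|HM. - (1/2) * (u x $ j * pd i \<phi> x + u x $ i * pd j \<phi> x)
          - (\<Sum>k\<in>UNIV. christoffel a k i j x * u x $ k) * \<phi> x))
    \<longleftrightarrow> (LINT x|HM. (T x + Gam x (u x)) $ i $ j * \<phi> x) =
      (LINT x|HM. - (1/2) * (u x $ j * pd i \<phi> x + u x $ i * pd j \<phi> x))" (is "?l = ?r \<longleftrightarrow> ?l' = ?r'")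
    if t: "test_fun \<phi>" for \<phi> i j
  proof -
    have i1: "integrable HM (\<lambda>x. T x $ i $ j * \<phi> x)"
      using sqint_mat_nth[OF T, of i j] by (intro integrable_dl_test t) simp
    have i2: "integrable HM (\<lambda>x. Gam x (u x) $ i $ j * \<phi> x)"
      using sqint_mat_nth[OF sqint_Gam(1)[OF u], of i j] by (intro integrable_dl_test t) simp
    have i3: "integrable HM (\<lambda>x. - (1/2) * (u x $ j * pd i \<phi> x + u x $ i * pd j \<phi> x))"
      by (intro integrable_mult_right Bochner_Integration.integrable_add sqint_mult sqint_nth u sqint_test_fun test_fun_pd t)
    have "?r = (LINT x|HM. - (1/2) * (u x $ j * pd i \<phi> x + u x $ i * pd j \<phi> x) - Gam x (u x) $ i $ j * \<phi> x)"
      by (rule Bochner_Integration.integral_cong) (simp_all add: space_HM christoffel_sum)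
    also have "\<dots> = ?r' - (LINT x|HM. Gam x (u x) $ i $ j * \<phi> x)"
      by (rule Bochner_Integration.integral_diff[OF i3 i2])
    finally have r: "?r = ?r' - (LINT x|HM. Gam x (u x) $ i $ j * \<phi> x)" .
    have "?l' = ?l + (LINT x|HM. Gam x (u x) $ i $ j * \<phi> x)"
      using Bochner_Integration.integral_add[OF i1 i2] by (simp add: distrib_right)
    then show ?thesis using r by auto
  qed
  then show ?thesis unfolding weak_Def_def weak_sym_def by meson
qed

text \<open>The deformation of the error differs from its symmetric gradient by \<open>Gam\<close>
  applied to the error, which in the weighted norm is bounded by the L2 error itself. Given L2
  convergence, the two kinds of convergence are therefore equivalent, and apart from
  \<open>C\<close> the right-hand side no longer depends on \<open>a\<close>.\<close>

lemma H1_closure_iff: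
  assumes C: "\<And>\<theta>. C \<theta> \<Longrightarrow> cc_form \<theta>"
  shows "u \<in> H1_closure a C \<longleftrightarrow> sqint u \<and> (\<exists>S. sqint (\<lambda>x. dl x *\<^sub>R S x) \<and> weak_sym u S \<and>
     (\<exists>\<theta>. (\<forall>n. C (\<theta> n)) \<and> (\<lambda>n. nsq (\<lambda>x. \<theta> n x - u x)) \<longlonglongrightarrow> 0 \<and>
       (\<lambda>n. nsq (\<lambda>x. dl x *\<^sub>R (Sym (\<theta> n) x - S x))) \<longlonglongrightarrow> 0))" (is "_ \<longleftrightarrow> _ \<and> (\<exists>S. ?P S)")
proof -
  have key: "(\<lambda>n. H1dist2 a (\<theta> n) u T) \<longlonglongrightarrow> 0 \<longleftrightarrow> (\<lambda>n. nsq (\<lambda>x. \<theta> n x - u x)) \<longlonglongrightarrow> 0 \<and>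
       (\<lambda>n. nsq (\<lambda>x. dl x *\<^sub>R (Sym (\<theta> n) x - (T x + Gam x (u x))))) \<longlonglongrightarrow> 0"
    if u: "sqint u" and T: "sqint (\<lambda>x. dl x *\<^sub>R T x)" and th: "\<And>n. cc_form (\<theta> n)" for \<theta> T
  proof -
    define A where "A n = nsq (\<lambda>x. \<theta> n x - u x)" for n
    define B where "B n = nsq (\<lambda>x. dl x *\<^sub>R (Def_classical a (\<theta> n) x - T x))" for n
    define B' where "B' n = nsq (\<lambda>x. dl x *\<^sub>R (Sym (\<theta> n) x - (T x + Gam x (u x))))" for n
    have d: "sqint (\<lambda>x. \<theta> n x - u x)" for n by (intro sqint_diff sqint_cc th u)
    have G: "sqint (\<lambda>x. dl x *\<^sub>R Gam x (\<theta> n x - u x))" "nsq (\<lambda>x. dl x *\<^sub>R Gam x (\<theta> n x - u x)) \<le> 24\<^sup>2 * A n" for n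
      unfolding A_def by (rule sqint_Gam[OF d])+
    have s': "sqint (\<lambda>x. dl x *\<^sub>R (Sym (\<theta> n) x - (T x + Gam x (u x))))" for n
      using sqint_diff(1)[OF sqint_cc(2)[OF th] sqint_add(1)[OF T sqint_Gam(1)[OF u]], of n]
      by (simp add: scaleR_diff_right scaleR_add_right)
    have e: "dl x *\<^sub>R (Def_classical a (\<theta> n) x - T x) =
        dl x *\<^sub>R (Sym (\<theta> n) x - (T x + Gam x (u x))) - dl x *\<^sub>R Gam x (\<theta> n x - u x)" if "x \<in> Hdisk" for n x
      by (simp add: Def_classical_eq[OF that] Gam_diff algebra_simps)
    have Beq: "B n = nsq (\<lambda>x. dl x *\<^sub>R (Sym (\<theta> n) x - (T x + Gam x (u x))) - dl x *\<^sub>R Gam x (\<theta> n x - u x))" for n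
      unfolding B_def by (rule sqint_cong(2)) (rule e)
    have s: "sqint (\<lambda>x. dl x *\<^sub>R (Def_classical a (\<theta> n) x - T x))" for n
      by (subst sqint_cong(1)[OF e], assumption) (intro sqint_diff s' G)
    have B1: "B n \<le> 2 * B' n + 2 * (24\<^sup>2 * A n)" for n
      unfolding Beq using sqint_diff(2)[OF s' G(1), of n n] G(2)[of n] unfolding B'_def by linarith
    have "B' n = nsq (\<lambda>x. dl x *\<^sub>R (Def_classical a (\<theta> n) x - T x) + dl x *\<^sub>R Gam x (\<theta> n x - u x))" for n
      unfolding B'_def by (rule sqint_cong(2)) (simp add: e)
    then have B2: "B' n \<le> 2 * B n + 2 * (24\<^sup>2 * A n)" for n
      using sqint_add(2)[OF s G(1), of n n] G(2)[of n] unfolding B_def by simp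
    have nn: "A n \<ge> 0" "B n \<ge> 0" "B' n \<ge> 0" for n by (simp_all add: A_def B_def B'_def nsq_nonneg)
    have H: "H1dist2 a (\<theta> n) u T = A n + 2 * ((a / 2)\<^sup>2 * B n)" for n
      unfolding H1dist2_eq A_def B_def ..
    show ?thesis
      unfolding H A_def[symmetric] B'_def[symmetric]
    proof safe
      assume l: "(\<lambda>n. A n + 2 * ((a / 2)\<^sup>2 * B n)) \<longlonglongrightarrow> 0"
      show A0: "A \<longlonglongrightarrow> 0"
        by (rule tendsto_sandwich[OF _ _ tendsto_const l]) (simp_all add: nn)
      \<comment> \<open>The factor \<open>2 / a^2\<close> inverts the coefficient
        \<open>2 * (a / 2)^2\<close> of \<open>B n\<close>.\<close>
      have "(\<lambda>n. (A n + 2 * ((a / 2)\<^sup>2 * B n) - A n) * (2 / a\<^sup>2)) \<longlonglongrightarrow> (0 - 0) * (2 / a\<^sup>2)"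
        by (intro tendsto_intros l A0)
      then have B0: "B \<longlonglongrightarrow> 0" using a by (simp add: power_divide)
      have "(\<lambda>n. 2 * B n + 2 * (24\<^sup>2 * A n)) \<longlonglongrightarrow> 2 * 0 + 2 * (24\<^sup>2 * 0)"
        by (intro tendsto_intros B0 A0)
      then have l2: "(\<lambda>n. 2 * B n + 2 * (24\<^sup>2 * A n)) \<longlonglongrightarrow> 0" by simp
      show "B' \<longlonglongrightarrow> 0"
        by (rule tendsto_sandwich[OF _ _ tendsto_const l2]) (intro always_eventually allI nn B2)+
    next
      assume A0: "A \<longlonglongrightarrow> 0" and B0: "B' \<longlonglongrightarrow> 0"
      have "(\<lambda>n. 2 * B' n + 2 * (24\<^sup>2 * A n)) \<longlonglongrightarrow> 2 * 0 + 2 * (24\<^sup>2 * 0)"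
        by (intro tendsto_intros B0 A0)
      then have l2: "(\<lambda>n. 2 * B' n + 2 * (24\<^sup>2 * A n)) \<longlonglongrightarrow> 0" by simp
      have B0: "B \<longlonglongrightarrow> 0"
        by (rule tendsto_sandwich[OF _ _ tendsto_const l2]) (intro always_eventually allI nn B1)+
      have "(\<lambda>n. A n + 2 * ((a / 2)\<^sup>2 * B n)) \<longlonglongrightarrow> 0 + 2 * ((a / 2)\<^sup>2 * 0)"
        by (intro tendsto_add tendsto_mult tendsto_const A0 B0)
      then show "(\<lambda>n. A n + 2 * ((a / 2)\<^sup>2 * B n)) \<longlonglongrightarrow> 0" by simp
    qed
  qed
  show ?thesis
  proof
    assume "u \<in> H1_closure a C"
    then obtain T \<theta> where u: "sqint u" and wd: "weak_Def a u T" and T: "sqint (\<lambda>x. dl x *\<^sub>R T x)"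
      and th: "\<forall>n. C (\<theta> n)" and l: "(\<lambda>n. H1dist2 a (\<theta> n) u T) \<longlonglongrightarrow> 0"
      unfolding H1_closure_def L2_form_iff L2_tens_iff by blast
    show "sqint u \<and> (\<exists>S. ?P S)"
    proof (intro conjI exI[of _ "\<lambda>x. T x + Gam x (u x)"] exI[of _ \<theta>])
      show "sqint (\<lambda>x. dl x *\<^sub>R (T x + Gam x (u x)))"
        using sqint_add(1)[OF T sqint_Gam(1)[OF u]] by (simp add: scaleR_add_right)
      show "weak_sym u (\<lambda>x. T x + Gam x (u x))" using wd weak_Def_iff[OF u T] by blast
    qed (use u th l key[OF u T, of \<theta>] C in auto)
  next
    assume "sqint u \<and> (\<exists>S. ?P S)"
    then obtain S \<theta> where u: "sqint u" and S: "sqint (\<lambda>x. dl x *\<^sub>R S x)" and ws: "weak_sym u S"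
      and th: "\<forall>n. C (\<theta> n)" and l: "(\<lambda>n. nsq (\<lambda>x. \<theta> n x - u x)) \<longlonglongrightarrow> 0"
       "(\<lambda>n. nsq (\<lambda>x. dl x *\<^sub>R (Sym (\<theta> n) x - S x))) \<longlonglongrightarrow> 0" by blast
    define T where "T x = S x - Gam x (u x)" for x
    have T: "sqint (\<lambda>x. dl x *\<^sub>R T x)"
      using sqint_diff(1)[OF S sqint_Gam(1)[OF u]] by (simp add: T_def scaleR_diff_right)
    have ST: "S = (\<lambda>x. T x + Gam x (u x))" by (simp add: T_def)
    have "weak_Def a u T" using ws weak_Def_iff[OF u T] ST by simp
    moreover have "(\<lambda>n. H1dist2 a (\<theta> n) u T) \<longlonglongrightarrow> 0"
      using l key[OF u T, of \<theta>] th C ST by simp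
    ultimately show "u \<in> H1_closure a C"
      unfolding H1_closure_def L2_form_iff L2_tens_iff using u T th by blast
  qed
qed

end

section \<open>Cutoff functions adapted to the boundary distance\<close>

text \<open>A cutoff equal to 1 where \<open>dl \<ge> 2 / (n + 1)\<close> and to 0 where
  \<open>dl \<le> 1 / (n + 1)\<close>.\<close>

definition chi :: "nat \<Rightarrow> real^2 \<Rightarrow> real" where
  "chi n x = step (real (Suc n) * dl x)"

lemma smooth_scaled_dl: "smooth_fun UNIV (\<lambda>x. c * dl x)"
  by (intro smooth_fun_mult smooth_fun_const smooth_dl open_UNIV)

lemma smooth_chi: "smooth_fun UNIV (chi n)"
  unfolding chi_def[abs_def] by (rule smooth_fun_compose[OF open_UNIV C1_step smooth_scaled_dl])

lemma chi_bounds: "0 \<le> chi n x" "chi n x \<le> 1"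
  by (simp_all add: chi_def step_bounds)

lemma test_chi: "test_fun (chi n)"
proof (rule test_funI)
  show "smooth_fun Hdisk (chi n)" by (rule smooth_fun_subset[OF smooth_chi]) simp
  define r where "r = sqrt (1 - 1 / real (Suc n))"
  have q: "0 \<le> 1 - 1 / real (Suc n)" "1 - 1 / real (Suc n) < 1" by simp_all
  show "r < 1" using real_sqrt_less_mono[OF q(2)] by (simp add: r_def)
  show "chi n x = 0" if "norm x > r" for x
  proof -
    have "r\<^sup>2 < (norm x)\<^sup>2" using that q(1) by (intro power_strict_mono) (auto simp: r_def)
    then have "dl x < 1 / real (Suc n)" using q(1) by (simp add: r_def dl_def)
    then have "real (Suc n) * dl x \<le> 1" by (simp add: field_simps)
    then show ?thesis by (simp add: chi_def step_le_1)
  qed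
qed

lemma pd_scaled_dl: "pd i (\<lambda>x. c * dl x) x = c * (- 2 * x $ i)"
  using pd_cmult[OF smooth_fun_differentiable[OF smooth_dl[OF open_UNIV] UNIV_I]] by (simp add: pd_dl)

lemma pd_chi: "pd i (chi n) x = dstep (real (Suc n) * dl x) * (real (Suc n) * (- 2 * x $ i))"
  unfolding chi_def[abs_def]
  using pd_compose(1)[OF smooth_fun_differentiable[OF smooth_scaled_dl UNIV_I] step_has_derivative]
  by (simp add: pd_scaled_dl)

lemma component_le_1: "x \<in> Hdisk \<Longrightarrow> \<bar>x $ i\<bar> \<le> 1"
  using component_le_norm_cart[of x i] by (simp add: in_Hdisk_iff)

text \<open>Each derivative of \<open>chi n\<close> costs a factor \<open>n + 1\<close>, but it
  lives where \<open>(n + 1) * dl\<close> is between 1 and 2. Weighting by one power of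
  \<open>dl\<close> per derivative therefore gives bounds uniform in \<open>n\<close>. The constant
  20 adds 16 from the second derivative of \<open>step\<close> and 4 from the Hessian of
  \<open>dl\<close>.\<close>

lemma chi_derivative_bounds:
  shows "\<exists>B\<ge>0. \<forall>x\<in>Hdisk. \<forall>n i j. \<bar>dl x * pd i (chi n) x\<bar> \<le> B \<and> \<bar>(dl x)\<^sup>2 * pd j (pd i (chi n)) x\<bar> \<le> B"
    and pd_pd_chi_eq_0: "real (Suc m) * dl y > 2 \<Longrightarrow> pd k (pd l (chi m)) y = 0"
proof -
  obtain dd B where dd: "\<And>t. (dstep has_real_derivative dd t) (at t)" "\<And>k. C1 k dd"
    and B: "\<And>t. \<bar>dstep t\<bar> \<le> B" "\<And>t. \<bar>dd t\<bar> \<le> B" and z: "\<And>t. t < 1 \<or> t > 2 \<Longrightarrow> dd t = 0"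
    using step_second_derivative by blast
  have B0: "B \<ge> 0" using B(1)[of 0] by linarith
  have p2: "pd j (pd i (chi n)) x = dd (m * dl x) * (m * (- 2 * x $ j)) * (m * (- 2 * x $ i)) +
     (if i = j then - 2 * m * dstep (m * dl x) else 0)" if m: "m = real (Suc n)" for n i j x m
  proof -
    have e: "pd i (chi n) = (\<lambda>x. dstep (m * dl x) * ((- 2 * m) * x $ i))"
      by (rule ext) (simp add: pd_chi m mult_ac del: of_nat_Suc)
    have s1: "(\<lambda>x. dstep (m * dl x)) differentiable (at x)"
      by (rule pd_compose(2)[OF smooth_fun_differentiable[OF smooth_scaled_dl UNIV_I] dd(1)])
    have s2: "(\<lambda>x. (- 2 * m) * x $ i) differentiable (at x)"
      by (rule differentiable_mult) (simp_all)
    have "pd j (\<lambda>x. dstep (m * dl x)) x = dd (m * dl x) * (m * (- 2 * x $ j))"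
      using pd_compose(1)[OF smooth_fun_differentiable[OF smooth_scaled_dl UNIV_I] dd(1)] by (simp add: pd_scaled_dl)
    moreover have "pd j (\<lambda>x. (- 2 * m) * x $ i) x = (if i = j then - 2 * m else 0)"
      using pd_cmult[OF nth_differentiable, of j "- 2 * m" i x] by simp
    ultimately show ?thesis
      unfolding e pd_mult[OF s1 s2] by simp
  qed
  \<comment> \<open>Used with \<open>t = dl x\<close>: where \<open>m * t\<close> exceeds 2 the
    factor \<open>dstep\<close> vanishes, otherwise \<open>m * t\<close> is itself bounded.\<close>
  have mb: "\<bar>dstep (m * t)\<bar> * (m * t) \<le> 2 * B" if "m > 0" "t > 0" for m t :: real
  proof (cases "m * t \<le> 2")
    case True
    then have "\<bar>dstep (m * t)\<bar> * (m * t) \<le> B * 2"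
      using that by (intro mult_mono B B0) auto
    then show ?thesis by simp
  next
    case False
    then show ?thesis using B0 by (simp add: dstep_eq_0)
  qed
  have mb2: "\<bar>dd (m * t)\<bar> * (m * t)\<^sup>2 \<le> 4 * B" if "m > 0" "t > 0" for m t :: real
  proof (cases "m * t \<le> 2")
    case True
    then have "(m * t)\<^sup>2 \<le> 2\<^sup>2" using that by (intro power_mono) auto
    then have "\<bar>dd (m * t)\<bar> * (m * t)\<^sup>2 \<le> B * 4"
      by (intro mult_mono B B0) auto
    then show ?thesis by simp
  next
    case False
    then show ?thesis using B0 by (simp add: z)
  qed
  have 1: "\<bar>dl x * pd i (chi n) x\<bar> \<le> 20 * B" if x: "x \<in> Hdisk" for n i x
  proof -
    define m where "m = real (Suc n)"
    have m: "m > 0" by (simp add: m_def)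
    have p: "pd i (chi n) x = dstep (m * dl x) * (m * (- 2 * x $ i))"
      unfolding pd_chi m_def ..
    have "\<bar>dl x * pd i (chi n) x\<bar> = (\<bar>dstep (m * dl x)\<bar> * (m * dl x)) * (2 * \<bar>x $ i\<bar>)"
      unfolding p using dl_pos[OF x] m by (simp add: abs_mult mult_ac)
    also have "\<dots> \<le> (2 * B) * (2 * 1)"
      using component_le_1[OF x, of i] m dl_pos[OF x] B0 by (intro mult_mono mb) auto
    finally show ?thesis using B0 by simp
  qed
  have 2: "\<bar>(dl x)\<^sup>2 * pd j (pd i (chi n)) x\<bar> \<le> 20 * B" if x: "x \<in> Hdisk" for n i j x
  proof -
    define m where "m = real (Suc n)"
    have m: "m > 0" by (simp add: m_def)
    let ?d = "dl x"
    have d: "?d > 0" "?d \<le> 1" using dl_pos[OF x] dl_le_1 by auto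
    have xx: "\<bar>x $ j\<bar> * \<bar>x $ i\<bar> \<le> 1 * 1"
      by (intro mult_mono component_le_1 x) auto
    have "?d\<^sup>2 * (dd (m * ?d) * (m * (- 2 * x $ j)) * (m * (- 2 * x $ i))) = dd (m * ?d) * (m * ?d)\<^sup>2 * (4 * (x $ j * x $ i))"
      by (simp add: power2_eq_square)
    then have "\<bar>?d\<^sup>2 * (dd (m * ?d) * (m * (- 2 * x $ j)) * (m * (- 2 * x $ i)))\<bar>
        = (\<bar>dd (m * ?d)\<bar> * (m * ?d)\<^sup>2) * (4 * (\<bar>x $ j\<bar> * \<bar>x $ i\<bar>))"
      by (simp add: abs_mult)
    also have "\<dots> \<le> (4 * B) * (4 * 1)"
      using xx B0 by (intro mult_mono mb2 m d) auto
    finally have 1: "\<bar>?d\<^sup>2 * (dd (m * ?d) * (m * (- 2 * x $ j)) * (m * (- 2 * x $ i)))\<bar> \<le> 16 * B" by simp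
    have "\<bar>?d\<^sup>2 * (- 2 * m * dstep (m * ?d))\<bar> = (2 * ?d) * (\<bar>dstep (m * ?d)\<bar> * (m * ?d))"
      using d m by (simp add: abs_mult power2_eq_square)
    also have "\<dots> \<le> 2 * (2 * B)"
      using d B0 m by (intro mult_mono mb) auto
    finally have 2: "\<bar>?d\<^sup>2 * (if i = j then - 2 * m * dstep (m * ?d) else 0)\<bar> \<le> 4 * B"
      using B0 by auto
    show ?thesis
      unfolding p2[OF m_def] distrib_left using 1 2 by linarith
  qed
  show "\<exists>B\<ge>0. \<forall>x\<in>Hdisk. \<forall>n i j. \<bar>dl x * pd i (chi n) x\<bar> \<le> B \<and> \<bar>(dl x)\<^sup>2 * pd j (pd i (chi n)) x\<bar> \<le> B"
    by (intro exI[of _ "20 * B"] conjI ballI allI 1 2) (use B0 in simp)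
  show "pd k (pd l (chi m)) y = 0" if "real (Suc m) * dl y > 2"
    unfolding p2[OF refl] using that by (simp add: z dstep_eq_0 del: of_nat_Suc)
qed

lemma chi_eq_1: "real (Suc n) * dl x > 2 \<Longrightarrow> chi n x = 1"
  by (simp add: chi_def step_ge_2)

lemma pd_chi_eq_0: "real (Suc n) * dl x > 2 \<Longrightarrow> pd i (chi n) x = 0"
  unfolding pd_chi by (simp add: dstep_eq_0 del: of_nat_Suc)

lemma eventually_interior:
  assumes "x \<in> Hdisk"
  shows "\<forall>\<^sub>F n in sequentially. real (Suc n) * dl x > 2"
proof -
  obtain N :: nat where N: "2 / dl x < real N" using reals_Archimedean2 by blast
  show ?thesis
  proof (rule eventually_sequentiallyI[of N])
    fix n assume "n \<ge> N"
    then have "2 / dl x < real (Suc n)" using N by simp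
    then show "real (Suc n) * dl x > 2" using dl_pos[OF assms] by (simp add: field_simps del: of_nat_Suc)
  qed
qed

text \<open>Every point of the disk eventually lies where \<open>chi n\<close> is locally constant,
  so an error supported in the transition region or beyond it tends to zero pointwise; a fixed
  integrable majorant then suffices.\<close>

lemma nsq_tendsto_0_interior:
  fixes g :: "nat \<Rightarrow> real^2 \<Rightarrow> 'b::euclidean_space"
  assumes "\<And>n. g n \<in> borel_measurable HM" "integrable HM h"
    "\<And>n x. x \<in> Hdisk \<Longrightarrow> real (Suc n) * dl x > 2 \<Longrightarrow> g n x = 0"
    "\<And>n x. x \<in> Hdisk \<Longrightarrow> (norm (g n x))\<^sup>2 \<le> h x"
  shows "(\<lambda>n. nsq (g n)) \<longlonglongrightarrow> 0"
proof (rule nsq_tendsto_0_dominated[OF assms(1,2) _ assms(4)])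
  show "AE x in HM. (\<lambda>n. g n x) \<longlonglongrightarrow> 0"
  proof (rule AE_I2)
    fix x assume "x \<in> space HM"
    then have x: "x \<in> Hdisk" by (simp add: space_HM)
    show "(\<lambda>n. g n x) \<longlonglongrightarrow> 0"
      by (rule tendsto_eventually, rule eventually_mono[OF eventually_interior[OF x]]) (rule assms(3)[OF x])
  qed
qed

lemma sqint_smooth_test: "smooth_fun Hdisk f \<Longrightarrow> test_fun \<phi> \<Longrightarrow> sqint (\<lambda>x. f x * \<phi> x)"
  by (intro sqint_test_fun test_fun_mult)

text \<open>Caccioppoli's inequality with cutoff \<open>\<zeta> = dl * chi n\<close>, whose gradient is bounded uniformly in \<open>n\<close>.\<close>

lemma Caccioppoli:
  assumes h: "smooth_fun Hdisk h" "sqint h"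
    and lap: "\<And>x. x \<in> Hdisk \<Longrightarrow> pd 1 (pd 1 h) x + pd 2 (pd 2 h) x = 0"
  shows "sqint (\<lambda>x. dl x * pd i h x)"
proof -
  obtain B where "B \<ge> 0" "\<forall>x\<in>Hdisk. \<forall>n i j. \<bar>dl x * pd i (chi n) x\<bar> \<le> B \<and> \<bar>(dl x)\<^sup>2 * pd j (pd i (chi n)) x\<bar> \<le> B"
    using chi_derivative_bounds by blast
  then have B: "B \<ge> 0" "\<And>n i x. x \<in> Hdisk \<Longrightarrow> \<bar>dl x * pd i (chi n) x\<bar> \<le> B"
    by simp_all
  define z where "z n x = dl x * chi n x" for n x
  have zt: "test_fun (z n)" for n
    unfolding z_def[abs_def] by (intro test_fun_mult smooth_dl open_Hdisk test_chi)
  have zs: "smooth_fun Hdisk (z n)" for n by (rule test_fun_smooth[OF zt])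
  \<comment> \<open>\<open>B\<close> bounds \<open>dl\<close> times the gradient of
    \<open>chi n\<close>, and 2 bounds \<open>chi n\<close> times the gradient of
    \<open>dl\<close>.\<close>
  have pz: "\<bar>pd i (z n) x\<bar> \<le> B + 2" if x: "x \<in> Hdisk" for i n x
  proof -
    have "pd i (z n) x = dl x * pd i (chi n) x + (- 2 * x $ i) * chi n x"
      unfolding z_def[abs_def]
      using pd_mult[OF smooth_fun_differentiable[OF smooth_dl[OF open_UNIV] UNIV_I] smooth_fun_differentiable[OF smooth_chi UNIV_I]]
      by (simp add: pd_dl)
    moreover have "\<bar>(- 2 * x $ i) * chi n x\<bar> \<le> 2 * 1"
      unfolding abs_mult using component_le_1[OF x, of i] chi_bounds[of n x] by (intro mult_mono) auto
    ultimately show ?thesis using B(2)[OF x, of i n] by linarith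
  qed
  define g where "g n i x = z n x * pd i h x" for n i x
  have gs: "sqint (g n i)" for n i
    unfolding g_def[abs_def] using sqint_smooth_test[OF smooth_fun_pd[OF h(1)] zt] by (simp add: mult.commute)
  define b where "b n i x = pd i (z n) x * h x" for n i x
  have bs: "sqint (b n i)" and bn: "nsq (b n i) \<le> (B + 2)\<^sup>2 * nsq h" for n i
    using sqint_mult_bounded[OF h(2), of "pd i (z n)" "B + 2"] pz sqint_measurable[OF sqint_test_fun[OF test_fun_pd[OF zt]]]
    by (auto simp: b_def[abs_def])
  have main: "nsq (g n 1) + nsq (g n 2) \<le> 4 * (nsq (b n 1) + nsq (b n 2))" for n
  proof -
    \<comment> \<open>The classical test function, the square of the cutoff times \<open>h\<close>;
      compact support removes boundary terms.\<close>
    let ?\<phi> = "\<lambda>x. (z n x * h x) * z n x"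
    have t: "test_fun ?\<phi>" by (intro test_fun_mult smooth_fun_mult open_Hdisk zs h zt)
    have pphi: "pd i ?\<phi> x = z n x * z n x * pd i h x + 2 * z n x * pd i (z n) x * h x" if x: "x \<in> Hdisk" for i x
    proof -
      note dz = smooth_fun_differentiable[OF zs x] and dh = smooth_fun_differentiable[OF h(1) x]
      show ?thesis
        using pd_mult[OF differentiable_mult[OF dz dh] dz, where i = i] pd_mult[OF dz dh, where i = i] by (simp add: algebra_simps)
    qed
    have e: "(LINT x|HM. pd i h x * pd i ?\<phi> x) = nsq (g n i) + 2 * (LINT x|HM. g n i x * b n i x)" for i
    proof -
      have "(LINT x|HM. pd i h x * pd i ?\<phi> x) = (LINT x|HM. (norm (g n i x))\<^sup>2 + 2 * (g n i x * b n i x))"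
        by (rule Bochner_Integration.integral_cong[OF refl], simp only: space_HM pphi g_def b_def real_norm_def power2_abs)
          (simp add: power2_eq_square algebra_simps)
      then show ?thesis using sqint_integrable_sq[OF gs] sqint_mult[OF gs bs] by (simp add: nsq_def)
    qed
    have ibp: "(LINT x|HM. pd i h x * pd i ?\<phi> x) = - (LINT x|HM. pd i (pd i h) x * ?\<phi> x)" for i
      by (rule integration_by_parts[OF smooth_fun_pd[OF h(1)] t])
    have int: "integrable HM (\<lambda>x. pd i (pd i h) x * ?\<phi> x)" for i
      by (rule integrable_mult_test_fun[OF smooth_fun_continuous[OF smooth_fun_pd[OF smooth_fun_pd[OF h(1)]]] t])
    have "(LINT x|HM. pd 1 (pd 1 h) x * ?\<phi> x) + (LINT x|HM. pd 2 (pd 2 h) x * ?\<phi> x)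
       = (LINT x|HM. (pd 1 (pd 1 h) x + pd 2 (pd 2 h) x) * ?\<phi> x)"
      unfolding distrib_right by (rule Bochner_Integration.integral_add[OF int int, symmetric])
    also have "\<dots> = (LINT x|HM. 0)"
      by (rule Bochner_Integration.integral_cong) (simp_all add: space_HM lap)
    finally have s0: "nsq (g n 1) + nsq (g n 2) + 2 * (LINT x|HM. g n 1 x * b n 1 x) + 2 * (LINT x|HM. g n 2 x * b n 2 x) = 0"
      using e[of 1] e[of 2] ibp[of 1] ibp[of 2] by simp
    \<comment> \<open>Nonnegativity of the squared norm of \<open>g + 2 b\<close>. Added over both
      components and combined with \<open>s0\<close>, it absorbs the mixed terms and yields the
      constant 4.\<close>
    have c: "0 \<le> nsq (g n i) + 4 * (LINT x|HM. g n i x * b n i x) + 4 * nsq (b n i)" for i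
      using nsq_expand[OF gs[of n i] bs[of n i], of 2] nsq_nonneg[of "\<lambda>x. g n i x + 2 *\<^sub>R b n i x"] by (simp add: mult.commute)
    show ?thesis using s0 c[of 1] c[of 2] by (simp add: algebra_simps)
  qed
  have K: "nsq (g n i) \<le> 8 * ((B + 2)\<^sup>2 * nsq h)" for n
    using main[of n] bn[of n 1] bn[of n 2] nsq_nonneg[of "g n 1"] nsq_nonneg[of "g n 2"] exhaust_2[of i] by auto
  show ?thesis
  proof (rule sqint_Fatou(1)[OF _ gs, where K = "8 * ((B + 2)\<^sup>2 * nsq h)"])
    show "\<forall>\<^sub>F n in sequentially. nsq (g n i) \<le> 8 * ((B + 2)\<^sup>2 * nsq h)" by (simp add: K)
    show "0 \<le> 8 * ((B + 2)\<^sup>2 * nsq h)" by (simp add: nsq_nonneg)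
    show "(\<lambda>x. dl x * pd i h x) \<in> borel_measurable HM"
      by (intro borel_measurable_times dl_measurable continuous_HM_measurable smooth_fun_continuous smooth_fun_pd h)
    have "(\<lambda>n. g n i x) \<longlonglongrightarrow> dl x * pd i h x" if "x \<in> Hdisk" for x
      by (rule tendsto_eventually, rule eventually_mono[OF eventually_interior[OF that]])
        (simp add: g_def z_def chi_eq_1 del: of_nat_Suc)
    then show "AE x in HM. (\<lambda>n. g n i x) \<longlonglongrightarrow> dl x * pd i h x"
      by (intro AE_I2) (simp add: space_HM)
  qed
qed

section \<open>Gradients of harmonic functions\<close>

lemma weak_sym_smooth:
  fixes w :: "real^2 \<Rightarrow> real^2"
  assumes "\<And>i. smooth_fun Hdisk (\<lambda>x. w x $ i)"
  shows "weak_sym w (Sym w)"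
  unfolding weak_sym_def
proof (intro allI impI)
  fix \<phi> i j assume t: "test_fun \<phi>"
  have ibp: "(LINT x|HM. w x $ j * pd i \<phi> x) = - (LINT x|HM. pd i (\<lambda>y. w y $ j) x * \<phi> x)" for i j
    by (rule integration_by_parts[OF assms t])
  have i1: "integrable HM (\<lambda>x. pd i (\<lambda>y. w y $ j) x * \<phi> x)" for i j
    by (rule integrable_mult_test_fun[OF smooth_fun_continuous[OF smooth_fun_pd[OF assms]] t])
  have i2: "integrable HM (\<lambda>x. w x $ j * pd i \<phi> x)" for i j
    by (rule integrable_mult_test_fun[OF smooth_fun_continuous[OF assms] test_fun_pd[OF t]])
  have "(LINT x|HM. Sym w x $ i $ j * \<phi> x) = (LINT x|HM. (1/2) * (pd i (\<lambda>y. w y $ j) x * \<phi> x + pd j (\<lambda>y. w y $ i) x * \<phi> x))"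
    by (simp add: Sym_def algebra_simps)
  also have "\<dots> = (1/2) * ((LINT x|HM. pd i (\<lambda>y. w y $ j) x * \<phi> x) + (LINT x|HM. pd j (\<lambda>y. w y $ i) x * \<phi> x))"
    unfolding integral_mult_right_zero Bochner_Integration.integral_add[OF i1 i1] ..
  also have "\<dots> = - (1/2) * ((LINT x|HM. w x $ j * pd i \<phi> x) + (LINT x|HM. w x $ i * pd j \<phi> x))"
    unfolding ibp by (simp add: field_simps)
  also have "\<dots> = (LINT x|HM. - (1/2) * (w x $ j * pd i \<phi> x + w x $ i * pd j \<phi> x))"
    unfolding integral_mult_right_zero Bochner_Integration.integral_add[OF i2 i2] ..
  finally show "(LINT x|HM. Sym w x $ i $ j * \<phi> x) = (LINT x|HM. - (1/2) * (w x $ j * pd i \<phi> x + w x $ i * pd j \<phi> x))" .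
qed

locale harmonic_gradient =
  fixes F :: "real^2 \<Rightarrow> real"
  assumes F: "smooth_fun Hdisk F" and lap: "\<And>x. x \<in> Hdisk \<Longrightarrow> pd 1 (pd 1 F) x + pd 2 (pd 2 F) x = 0"
    and dF: "sqint (dfun F)"
begin

lemma dfun_nth: "(\<lambda>x. dfun F x $ i) = pd i F"
  by (simp add: dfun_def fun_eq_iff)

lemma smooth_nth: "smooth_fun Hdisk (\<lambda>x. dfun F x $ i)"
  unfolding dfun_nth by (rule smooth_fun_pd[OF F])

lemma pd_harmonic: "x \<in> Hdisk \<Longrightarrow> pd 1 (pd 1 (pd i F)) x + pd 2 (pd 2 (pd i F)) x = 0"
proof -
  assume x: "x \<in> Hdisk"
  have c: "pd j (pd j (pd i F)) x = pd i (pd j (pd j F)) x" for j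
  proof -
    have "pd j (pd j (pd i F)) x = pd j (pd i (pd j F)) x"
      by (rule pd_cong[OF open_Hdisk x]) (rule smooth_fun_pd_commute[OF open_Hdisk _ F])
    also have "\<dots> = pd i (pd j (pd j F)) x"
      by (rule smooth_fun_pd_commute[OF open_Hdisk x smooth_fun_pd[OF F]])
    finally show ?thesis .
  qed
  have d: "pd j (pd j F) differentiable (at x)" for j
    by (rule smooth_fun_differentiable[OF smooth_fun_pd[OF smooth_fun_pd[OF F]] x])
  have "pd i (\<lambda>x. pd 1 (pd 1 F) x + pd 2 (pd 2 F) x) x = pd i (\<lambda>x. 0) x"
    by (rule pd_cong[OF open_Hdisk x]) (rule lap)
  then show ?thesis unfolding c using pd_add[OF d d] by simp
qed

text \<open>Each component \<open>pd j F\<close> is harmonic and square integrable, so Caccioppoli's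
  inequality controls its \<open>dl\<close>-weighted derivatives.\<close>

lemma sqint_Sym: "sqint (\<lambda>x. dl x *\<^sub>R Sym (dfun F) x)"
proof (rule sqint_mat(1))
  fix i j
  have s: "sqint (\<lambda>x. dl x * pd i (pd j F) x)" for i j
    by (rule Caccioppoli[OF smooth_fun_pd[OF F] _ pd_harmonic]) (use sqint_nth[OF dF, of j] in \<open>simp_all add: dfun_nth\<close>)
  have "sqint (\<lambda>x. (1/2) *\<^sub>R (dl x * pd i (pd j F) x + dl x * pd j (pd i F) x))"
    by (intro sqint_scaleR sqint_add s)
  then show "sqint (\<lambda>x. (dl x *\<^sub>R Sym (dfun F) x) $ i $ j)"
    by (simp add: Sym_def dfun_nth algebra_simps)
qed

lemma orthogonal_to_gradients: "test_fun \<phi> \<Longrightarrow> (LINT x|HM. dfun F x \<bullet> dfun \<phi> x) = 0"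
  by (rule div_free_orthogonal_dfun[OF smooth_nth]) (simp_all add: dfun_nth lap)

text \<open>The approximants are \<open>chi n\<close> times the gradient. Their symmetric gradients
  differ from the limit by a part damped by \<open>chi n - 1\<close> and by a part containing the
  derivative of \<open>chi n\<close>; with weight \<open>dl\<close> both are dominated by fixed
  square integrable functions.\<close>

lemma in_H10: assumes "a > 0" shows "dfun F \<in> H10 a"
  unfolding H10_def H1_closure_iff[OF assms, of cc_form, simplified]
proof -
  obtain B where "B \<ge> 0" "\<forall>x\<in>Hdisk. \<forall>n i j. \<bar>dl x * pd i (chi n) x\<bar> \<le> B \<and> \<bar>(dl x)\<^sup>2 * pd j (pd i (chi n)) x\<bar> \<le> B"
    using chi_derivative_bounds by blast
  then have B: "B \<ge> 0" "\<And>n i x. x \<in> Hdisk \<Longrightarrow> \<bar>dl x * pd i (chi n) x\<bar> \<le> B"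
    by simp_all
  define \<theta> where "\<theta> n x = chi n x *\<^sub>R dfun F x" for n x
  have cc: "cc_form (\<theta> n)" for n
    using test_fun_mult[OF smooth_fun_pd[OF F] test_chi]
    by (intro cc_formI) (simp add: \<theta>_def dfun_def mult.commute)
  have l1: "(\<lambda>n. nsq (\<lambda>x. \<theta> n x - dfun F x)) \<longlonglongrightarrow> 0"
  proof (rule nsq_tendsto_0_interior[OF _ sqint_integrable_sq[OF dF]])
    show "(\<lambda>x. \<theta> n x - dfun F x) \<in> borel_measurable HM" for n
      by (rule sqint_measurable[OF sqint_diff(1)[OF sqint_cc(1)[OF cc] dF]])
    show "\<theta> n x - dfun F x = 0" if "real (Suc n) * dl x > 2" for n x
      by (simp add: \<theta>_def chi_eq_1[OF that])
    show "(norm (\<theta> n x - dfun F x))\<^sup>2 \<le> (norm (dfun F x))\<^sup>2" for n x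
    proof -
      have "\<theta> n x - dfun F x = (chi n x - 1) *\<^sub>R dfun F x" by (simp add: \<theta>_def scaleR_diff_left)
      then have "norm (\<theta> n x - dfun F x) \<le> 1 * norm (dfun F x)"
        unfolding norm_scaleR using chi_bounds[of n x] by (simp only: norm_scaleR) (intro mult_right_mono, auto)
      then show ?thesis by (intro power_mono) auto
    qed
  qed
  have l2: "(\<lambda>n. nsq (\<lambda>x. dl x *\<^sub>R (Sym (\<theta> n) x - Sym (dfun F) x))) \<longlonglongrightarrow> 0"
  proof (rule nsq_tendsto_0_interior)
    \<comment> \<open>The symmetrised product of the gradients of \<open>chi n\<close> and
      \<open>F\<close>, i.e. the commutator of \<open>Sym\<close> with the cutoff.\<close>
    define M where "M n x = (\<chi> i j. (1/2) * (pd i (chi n) x * pd j F x + pd j (chi n) x * pd i F x))" for n and x :: "real^2"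
    have S: "Sym (\<theta> n) x = chi n x *\<^sub>R Sym (dfun F) x + M n x" if x: "x \<in> Hdisk" for n x
    proof -
      have p: "pd i (\<lambda>y. \<theta> n y $ j) x = chi n x * pd i (pd j F) x + pd i (chi n) x * pd j F x" for i j
        using pd_mult[OF smooth_fun_differentiable[OF smooth_chi UNIV_I] smooth_fun_differentiable[OF smooth_fun_pd[OF F] x], of i n j]
        by (simp add: \<theta>_def dfun_def)
      show ?thesis by (simp add: vec_eq_iff Sym_def M_def p dfun_nth algebra_simps)
    qed
    have Mb: "norm (dl x *\<^sub>R M n x) \<le> 4 * B * norm (dfun F x)" if x: "x \<in> Hdisk" for n x
    proof -
      have c: "\<bar>dl x * pd i (chi n) x * pd j F x\<bar> \<le> B * norm (dfun F x)" for i j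
        unfolding abs_mult[of _ "pd j F x"] using B component_le_norm_cart[of "dfun F x" j]
        by (intro mult_mono B(2)[OF x]) (auto simp: dfun_def)
      have "norm (dl x *\<^sub>R M n x) \<le> 4 * (B * norm (dfun F x))"
      proof (rule norm_mat2_le)
        fix i j
        have "(dl x *\<^sub>R M n x) $ i $ j = (1/2) * (dl x * pd i (chi n) x * pd j F x + dl x * pd j (chi n) x * pd i F x)"
          by (simp add: M_def algebra_simps)
        then show "\<bar>(dl x *\<^sub>R M n x) $ i $ j\<bar> \<le> B * norm (dfun F x)" using c[of i j] c[of j i] by simp
      qed
      then show ?thesis by simp
    qed
    show "integrable HM (\<lambda>x. 2 * (norm (dl x *\<^sub>R Sym (dfun F) x))\<^sup>2 + 2 * ((4 * B)\<^sup>2 * (norm (dfun F x))\<^sup>2))"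
      by (intro Bochner_Integration.integrable_add integrable_mult_right sqint_integrable_sq sqint_Sym dF)
    show "(\<lambda>x. dl x *\<^sub>R (Sym (\<theta> n) x - Sym (dfun F) x)) \<in> borel_measurable HM" for n
      using sqint_measurable[OF sqint_diff(1)[OF sqint_cc(2)[OF cc] sqint_Sym]] by (simp add: scaleR_diff_right)
    show "dl x *\<^sub>R (Sym (\<theta> n) x - Sym (dfun F) x) = 0" if "x \<in> Hdisk" "real (Suc n) * dl x > 2" for n x
      unfolding S[OF that(1)] by (simp add: chi_eq_1[OF that(2)] M_def pd_chi_eq_0[OF that(2)] vec_eq_iff)
    show "(norm (dl x *\<^sub>R (Sym (\<theta> n) x - Sym (dfun F) x)))\<^sup>2
       \<le> 2 * (norm (dl x *\<^sub>R Sym (dfun F) x))\<^sup>2 + 2 * ((4 * B)\<^sup>2 * (norm (dfun F x))\<^sup>2)" if x: "x \<in> Hdisk" for n x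
    proof -
      have "dl x *\<^sub>R (Sym (\<theta> n) x - Sym (dfun F) x) = (chi n x - 1) *\<^sub>R (dl x *\<^sub>R Sym (dfun F) x) + dl x *\<^sub>R M n x"
        unfolding S[OF x] by (simp add: algebra_simps)
      then have "(norm (dl x *\<^sub>R (Sym (\<theta> n) x - Sym (dfun F) x)))\<^sup>2
         \<le> 2 * (norm ((chi n x - 1) *\<^sub>R (dl x *\<^sub>R Sym (dfun F) x)))\<^sup>2 + 2 * (norm (dl x *\<^sub>R M n x))\<^sup>2"
        using norm_add_sq_le by metis
      also have "norm ((chi n x - 1) *\<^sub>R (dl x *\<^sub>R Sym (dfun F) x)) \<le> 1 * norm (dl x *\<^sub>R Sym (dfun F) x)"
        unfolding norm_scaleR[of "chi n x - 1"] using chi_bounds[of n x] by (intro mult_right_mono) auto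
      then have "2 * (norm ((chi n x - 1) *\<^sub>R (dl x *\<^sub>R Sym (dfun F) x)))\<^sup>2 + 2 * (norm (dl x *\<^sub>R M n x))\<^sup>2
         \<le> 2 * (1 * norm (dl x *\<^sub>R Sym (dfun F) x))\<^sup>2 + 2 * (4 * B * norm (dfun F x))\<^sup>2"
        using Mb[OF x, of n] by (intro add_mono mult_left_mono power_mono) auto
      finally show ?thesis by (simp add: power_mult_distrib)
    qed
  qed
  show "sqint (dfun F) \<and> (\<exists>S. sqint (\<lambda>x. dl x *\<^sub>R S x) \<and> weak_sym (dfun F) S \<and>
     (\<exists>\<theta>. (\<forall>n. cc_form (\<theta> n)) \<and> (\<lambda>n. nsq (\<lambda>x. \<theta> n x - dfun F x)) \<longlonglongrightarrow> 0 \<and>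
       (\<lambda>n. nsq (\<lambda>x. dl x *\<^sub>R (Sym (\<theta> n) x - S x))) \<longlonglongrightarrow> 0))"
    using dF sqint_Sym weak_sym_smooth[OF smooth_nth] cc l1 l2 by blast
qed

end

section \<open>The Hardy inequality and stream functions\<close>

lemma norm_dfun_sq: "(norm (dfun \<phi> x))\<^sup>2 = (pd 1 \<phi> x)\<^sup>2 + (pd 2 \<phi> x)\<^sup>2"
  by (simp add: norm_vec2_sq dfun_def)

lemma norm_dperp_sq: "(norm (dperp \<phi> x))\<^sup>2 = (pd 1 \<phi> x)\<^sup>2 + (pd 2 \<phi> x)\<^sup>2"
  by (simp add: norm_vec2_sq dperp_def)

lemma dperp_nth [simp]: "dperp \<phi> x $ 1 = - pd 2 \<phi> x" "dperp \<phi> x $ 2 = pd 1 \<phi> x"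
  by (simp_all add: dperp_def)

lemma cc_form_dperp: "test_fun \<phi> \<Longrightarrow> cc_form (dperp \<phi>)"
proof (rule cc_formI)
  fix i :: 2 assume t: "test_fun \<phi>"
  show "test_fun (\<lambda>x. dperp \<phi> x $ i)"
    using exhaust_2[of i] test_fun_pd[OF t] test_fun_cmult[OF test_fun_pd[OF t], of "-1"] by auto
qed

lemma dperp_add_cmult:
  assumes "test_fun \<phi>" "test_fun \<psi>"
  shows "dperp (\<lambda>x. \<phi> x + c * \<psi> x) x = dperp \<phi> x + c *\<^sub>R dperp \<psi> x"
proof -
  have d: "\<phi> differentiable (at x)" "\<psi> differentiable (at x)" "(\<lambda>x. c * \<psi> x) differentiable (at x)"
    by (rule smooth_fun_differentiable[OF test_fun_smooth UNIV_I]; intro assms test_fun_cmult)+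
  show ?thesis
    by (simp add: vec_eq_iff forall_2 pd_add[OF d(1,3)] pd_cmult[OF d(2)])
qed

lemma dperp_div:
  assumes "test_fun \<phi>"
  shows "pd 1 (\<lambda>y. dperp \<phi> y $ 1) x + pd 2 (\<lambda>y. dperp \<phi> y $ 2) x = 0"
proof -
  have s: "smooth_fun UNIV \<phi>" by (rule test_fun_smooth[OF assms])
  have "pd 1 (\<lambda>y. dperp \<phi> y $ 1) x = - pd 1 (pd 2 \<phi>) x"
    using pd_minus[OF smooth_fun_differentiable[OF smooth_fun_pd[OF s] UNIV_I]] by simp
  then show ?thesis using smooth_fun_pd_commute[OF open_UNIV UNIV_I s, of 1 2] by simp
qed

lemma dperp_orthogonal_dfun:
  "test_fun \<phi> \<Longrightarrow> test_fun \<zeta> \<Longrightarrow> (LINT x|HM. dperp \<phi> x \<bullet> dfun \<zeta> x) = 0"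
  by (rule div_free_orthogonal_dfun[OF test_fun_smooth[OF cc_formD[OF cc_form_dperp]] _ dperp_div])

text \<open>Tests the divergence of the field \<open>x / dl x\<close>, which equals \<open>2 / (dl x)\<^sup>2\<close>, against \<open>\<phi>\<^sup>2\<close>.\<close>

lemma Hardy_inequality:
  assumes t: "test_fun \<phi>"
  shows "sqint (\<lambda>x. inverse (dl x) * \<phi> x)" "nsq (\<lambda>x. inverse (dl x) * \<phi> x) \<le> nsq (dperp \<phi>)"
proof -
  define q where "q x = inverse (dl x) * \<phi> x" for x
  have qt: "test_fun q" unfolding q_def[abs_def] by (rule test_fun_mult[OF smooth_inverse_dl t])
  have qs: "sqint q" by (rule sqint_test_fun[OF qt])
  then show "sqint (\<lambda>x. inverse (dl x) * \<phi> x)" by (simp add: q_def[abs_def])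
  define X where "X i x = x $ i * inverse (dl x)" for i and x :: "real^2"
  have Xs: "smooth_fun Hdisk (X i)" for i
    unfolding X_def[abs_def] by (intro smooth_fun_mult smooth_fun_nth smooth_inverse_dl open_Hdisk)
  have s: "smooth_fun Hdisk \<phi>" by (rule test_fun_smooth[OF t])
  have t2: "test_fun (\<lambda>x. \<phi> x * \<phi> x)" by (rule test_fun_mult[OF s t])
  have pX: "pd i (X i) x = inverse (dl x) + 2 * (x $ i)\<^sup>2 * (inverse (dl x))\<^sup>2" if x: "x \<in> Hdisk" for i x
  proof -
    have der: "(inverse has_real_derivative - (inverse (dl x) * inverse (dl x))) (at (dl x))"
      using dl_pos[OF x] by (auto intro!: derivative_eq_intros simp: power2_eq_square)
    have "pd i (\<lambda>x. inverse (dl x)) x = - (inverse (dl x) * inverse (dl x)) * (- 2 * x $ i)"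
      using pd_compose(1)[where f = dl and b = inverse, OF smooth_fun_differentiable[OF smooth_dl[OF open_Hdisk] x] der]
      by (simp add: pd_dl)
    then show ?thesis
      unfolding X_def[abs_def] pd_mult[OF nth_differentiable smooth_fun_differentiable[OF smooth_inverse_dl x]]
      by (simp add: power2_eq_square)
  qed
  have div: "pd 1 (X 1) x + pd 2 (X 2) x = 2 * (inverse (dl x))\<^sup>2" if x: "x \<in> Hdisk" for x
  proof -
    have "(norm x)\<^sup>2 = 1 - dl x" by (simp add: dl_def)
    then have n: "(x $ 1)\<^sup>2 + (x $ 2)\<^sup>2 = 1 - dl x" by (simp add: norm_vec2_sq)
    have "pd 1 (X 1) x + pd 2 (X 2) x = 2 * inverse (dl x) + 2 * ((x $ 1)\<^sup>2 + (x $ 2)\<^sup>2) * (inverse (dl x))\<^sup>2"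
      unfolding pX[OF x] by (simp add: algebra_simps)
    also have "\<dots> = 2 * inverse (dl x) + 2 * (1 - dl x) * (inverse (dl x))\<^sup>2" unfolding n ..
    also have "\<dots> = 2 * (inverse (dl x))\<^sup>2"
      using dl_pos[OF x] by (simp add: field_simps power2_eq_square)
    finally show ?thesis .
  qed
  have ibp: "(LINT x|HM. X i x * pd i (\<lambda>x. \<phi> x * \<phi> x) x) = - (LINT x|HM. pd i (X i) x * (\<phi> x * \<phi> x))" for i
    by (rule integration_by_parts[OF Xs t2])
  have i1: "integrable HM (\<lambda>x. pd i (X i) x * (\<phi> x * \<phi> x))" for i
    by (rule integrable_mult_test_fun[OF smooth_fun_continuous[OF smooth_fun_pd[OF Xs]] t2])
  have i2: "integrable HM (\<lambda>x. X i x * pd i (\<lambda>x. \<phi> x * \<phi> x) x)" for i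
    by (rule integrable_mult_test_fun[OF smooth_fun_continuous[OF Xs] test_fun_pd[OF t2]])
  have p2: "pd i (\<lambda>x. \<phi> x * \<phi> x) x = 2 * \<phi> x * pd i \<phi> x" if "x \<in> Hdisk" for i x
    using pd_mult[OF smooth_fun_differentiable[OF s that] smooth_fun_differentiable[OF s that]] by simp
  have "2 * nsq q = (LINT x|HM. 2 * (q x)\<^sup>2)" by (simp add: nsq_def)
  also have "\<dots> = (LINT x|HM. pd 1 (X 1) x * (\<phi> x * \<phi> x) + pd 2 (X 2) x * (\<phi> x * \<phi> x))"
    by (rule Bochner_Integration.integral_cong[OF refl], unfold distrib_right[symmetric], simp only: space_HM div)
      (simp add: q_def power2_eq_square mult_ac)
  also have "\<dots> = (LINT x|HM. - (X 1 x * pd 1 (\<lambda>x. \<phi> x * \<phi> x) x + X 2 x * pd 2 (\<lambda>x. \<phi> x * \<phi> x) x))"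
    using i1 i2 ibp[of 1] ibp[of 2] by simp
  \<comment> \<open>Pointwise \<open>- 2 q y \<le> q^2 + y^2\<close>, and \<open>|x| < 1\<close>
    bounds the radial derivative \<open>y\<close> by the full gradient. One of the two copies of
    \<open>nsq q\<close> is then absorbed, leaving the constant 1.\<close>
  also have "\<dots> \<le> (LINT x|HM. (norm (q x))\<^sup>2 + (norm (dperp \<phi> x))\<^sup>2)"
  proof (rule integral_mono)
    show "integrable HM (\<lambda>x. - (X 1 x * pd 1 (\<lambda>x. \<phi> x * \<phi> x) x + X 2 x * pd 2 (\<lambda>x. \<phi> x * \<phi> x) x))"
      using i2 by simp
    show "integrable HM (\<lambda>x. (norm (q x))\<^sup>2 + (norm (dperp \<phi> x))\<^sup>2)"
      by (intro Bochner_Integration.integrable_add sqint_integrable_sq qs sqint_cc cc_form_dperp t)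
    fix x assume "x \<in> space HM"
    then have x: "x \<in> Hdisk" by (simp add: space_HM)
    define y where "y = x $ 1 * pd 1 \<phi> x + x $ 2 * pd 2 \<phi> x"
    have "y = x \<bullet> dfun \<phi> x" by (simp add: y_def inner_dfun)
    then have "\<bar>y\<bar> \<le> norm x * norm (dfun \<phi> x)" using Cauchy_Schwarz_ineq2 by simp
    also have "\<dots> \<le> 1 * norm (dfun \<phi> x)" using x by (intro mult_right_mono) (auto simp: in_Hdisk_iff)
    finally have "y\<^sup>2 \<le> (norm (dfun \<phi> x))\<^sup>2" using power_mono[of "\<bar>y\<bar>" "norm (dfun \<phi> x)" 2] by simp
    then have y2: "y\<^sup>2 \<le> (norm (dperp \<phi> x))\<^sup>2" by (simp add: norm_dfun_sq norm_dperp_sq)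
    have "- (X 1 x * pd 1 (\<lambda>x. \<phi> x * \<phi> x) x + X 2 x * pd 2 (\<lambda>x. \<phi> x * \<phi> x) x) = - 2 * q x * y"
      unfolding p2[OF x] X_def q_def y_def by (simp add: algebra_simps)
    also have "\<dots> \<le> (q x)\<^sup>2 + y\<^sup>2"
      using zero_le_power2[of "q x + y"] by (simp add: power2_sum)
    finally show "- (X 1 x * pd 1 (\<lambda>x. \<phi> x * \<phi> x) x + X 2 x * pd 2 (\<lambda>x. \<phi> x * \<phi> x) x)
        \<le> (norm (q x))\<^sup>2 + (norm (dperp \<phi> x))\<^sup>2" using y2 by simp
  qed
  also have "\<dots> = nsq q + nsq (dperp \<phi>)"
    unfolding nsq_def by (intro Bochner_Integration.integral_add sqint_integrable_sq qs sqint_cc cc_form_dperp t)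
  finally show "nsq (\<lambda>x. inverse (dl x) * \<phi> x) \<le> nsq (dperp \<phi>)" by (simp add: q_def[abs_def])
qed

lemma sqint_mult_test:
  fixes f :: "real^2 \<Rightarrow> real"
  assumes "sqint f" "test_fun t"
  shows "sqint (\<lambda>x. f x * t x)"
proof -
  obtain r where r: "r < 1" "\<forall>x. norm x > r \<longrightarrow> t x = 0" using test_funD[OF assms(2)] by blast
  have c: "continuous_on Hdisk t" by (rule smooth_fun_continuous[OF test_fun_smooth[OF assms(2)]])
  obtain B where B: "\<And>x. x \<in> Hdisk \<Longrightarrow> norm (t x) \<le> B"
    using bounded_compact_support[OF c r(1)] r(2) by blast
  have "sqint (\<lambda>x. t x *\<^sub>R f x)"
    by (rule sqint_mult_bounded(1)[OF assms(1) continuous_HM_measurable[OF c], of B]) (use B in simp)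
  then show ?thesis by (simp add: mult.commute)
qed

locale stream_limit =
  fixes \<phi> :: "nat \<Rightarrow> real^2 \<Rightarrow> real" and v :: "real^2 \<Rightarrow> real^2"
  assumes t: "\<And>n. test_fun (\<phi> n)" and v: "sqint v"
    and lim: "(\<lambda>n. nsq (\<lambda>x. dperp (\<phi> n) x - v x)) \<longlonglongrightarrow> 0"
begin

text \<open>The gradient that a stream function of \<open>v\<close> must have: if \<open>v\<close>
  is the rotated gradient of \<open>\<psi>\<close>, then \<open>(v_2, - v_1)\<close> is its
  gradient.\<close>

definition gv :: "2 \<Rightarrow> real^2 \<Rightarrow> real" where
  "gv i x = (if i = 1 then v x $ 2 else - (v x $ 1))"

text \<open>Hardy's inequality applied to differences of the \<open>\<phi> n\<close> makes the
  quotients by \<open>dl\<close> Cauchy in L2. Their limit \<open>p\<close>, rather than the stream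
  function \<open>dl * p\<close>, is delivered, because it records the decay at the
  boundary.\<close>

lemma stream_exists:
  obtains p where "sqint p"
    "\<And>i \<zeta>. test_fun \<zeta> \<Longrightarrow> (LINT x|HM. (dl x * p x) * pd i \<zeta> x) = - (LINT x|HM. gv i x * \<zeta> x)"
proof -
  let ?q = "\<lambda>n x. inverse (dl x) * \<phi> n x"
  have q: "sqint (?q n)" for n by (rule Hardy_inequality(1)[OF t])
  have dp: "sqint (dperp (\<phi> n))" for n by (rule sqint_cc(1)[OF cc_form_dperp[OF t]])
  have tri: "nsq (\<lambda>x. ?q i x - ?q j x) \<le> 2 * nsq (\<lambda>x. dperp (\<phi> i) x - v x) + 2 * nsq (\<lambda>x. dperp (\<phi> j) x - v x)" for i j
  proof -
    have td: "test_fun (\<lambda>x. \<phi> i x + (-1) * \<phi> j x)" by (intro test_fun_add test_fun_cmult t)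
    have "nsq (\<lambda>x. ?q i x - ?q j x) = nsq (\<lambda>x. inverse (dl x) * (\<phi> i x + (-1) * \<phi> j x))"
      by (simp add: right_diff_distrib)
    also have "\<dots> \<le> nsq (dperp (\<lambda>x. \<phi> i x + (-1) * \<phi> j x))" by (rule Hardy_inequality(2)[OF td])
    also have "dperp (\<lambda>x. \<phi> i x + (-1) * \<phi> j x) = (\<lambda>x. (dperp (\<phi> i) x - v x) - (dperp (\<phi> j) x - v x))"
      by (rule ext) (simp only: dperp_add_cmult[OF t t], simp)
    also have "nsq \<dots> \<le> 2 * nsq (\<lambda>x. dperp (\<phi> i) x - v x) + 2 * nsq (\<lambda>x. dperp (\<phi> j) x - v x)"
      by (intro sqint_diff dp v)
    finally show ?thesis .
  qed
  have "\<exists>N. \<forall>i\<ge>N. \<forall>j\<ge>N. nsq (\<lambda>x. ?q i x - ?q j x) < e" if "e > 0" for e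
  proof -
    have "e / 4 > 0" using that by simp
    from LIMSEQ_D[OF lim this] obtain N where N: "\<forall>n\<ge>N. norm (nsq (\<lambda>x. dperp (\<phi> n) x - v x) - 0) < e / 4"
      by blast
    have "nsq (\<lambda>x. ?q i x - ?q j x) < e" if "i \<ge> N" "j \<ge> N" for i j
      using tri[of i j] N[rule_format, OF that(1)] N[rule_format, OF that(2)] by simp
    then show ?thesis by blast
  qed
  then obtain p where p: "sqint p" "(\<lambda>n. nsq (\<lambda>x. ?q n x - p x)) \<longlonglongrightarrow> 0"
    using sqint_complete[of ?q, OF q] by blast
  have "(LINT x|HM. (dl x * p x) * pd i \<zeta> x) = - (LINT x|HM. gv i x * \<zeta> x)" if z: "test_fun \<zeta>" for i \<zeta>
  proof -
    have dz: "sqint (\<lambda>x. dl x * pd i \<zeta> x)"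
      by (intro sqint_test_fun test_fun_mult smooth_dl open_Hdisk test_fun_pd z)
    \<comment> \<open>A constant direction times \<open>\<zeta>\<close>, chosen so that the inner
      product with a rotated gradient selects the single partial derivative
      \<open>pd i\<close>.\<close>
    define g :: "real^2 \<Rightarrow> real^2" where "g x = (if i = 1 then \<zeta> x *\<^sub>R axis 2 1 else - (\<zeta> x *\<^sub>R axis 1 (1::real)))" for x :: "real^2"
    have gs: "sqint (g)"
    proof (rule sqint_vec2(1))
      fix j :: 2
      have "(\<lambda>x. g x $ j) = (\<lambda>x. (if i = 1 then if j = 2 then 1 else 0 else if j = 1 then - 1 else 0) * \<zeta> x)"
        by (auto simp: g_def axis_def fun_eq_iff)
      then show "sqint (\<lambda>x. g x $ j)"
        using sqint_test_fun[OF test_fun_cmult[OF z]] by simp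
    qed
    have vg: "v x \<bullet> g x = gv i x * \<zeta> x" "dperp (\<phi> n) x \<bullet> g x = pd i (\<phi> n) x * \<zeta> x" for x n
      using exhaust_2[of i] by (auto simp: g_def gv_def inner_vec2 axis_def)
    have "(\<lambda>n. (LINT x|HM. ?q n x \<bullet> (dl x * pd i \<zeta> x))) \<longlonglongrightarrow> (LINT x|HM. p x \<bullet> (dl x * pd i \<zeta> x))"
      by (rule integral_inner_tendsto[OF q p(1) dz p(2)])
    moreover have "(LINT x|HM. ?q n x \<bullet> (dl x * pd i \<zeta> x)) = - (LINT x|HM. dperp (\<phi> n) x \<bullet> g x)" for n
    proof -
      have "(LINT x|HM. ?q n x \<bullet> (dl x * pd i \<zeta> x)) = (LINT x|HM. \<phi> n x * pd i \<zeta> x)"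
        by (rule Bochner_Integration.integral_cong) (use dl_pos in \<open>force simp: space_HM\<close>)+
      then show ?thesis using integration_by_parts[OF test_fun_smooth[OF t[of n]] z] by (simp add: vg)
    qed
    moreover have "(\<lambda>n. - (LINT x|HM. dperp (\<phi> n) x \<bullet> g x)) \<longlonglongrightarrow> - (LINT x|HM. v x \<bullet> g x)"
      by (intro tendsto_minus integral_inner_tendsto[OF dp v gs lim])
    ultimately have "(LINT x|HM. p x \<bullet> (dl x * pd i \<zeta> x)) = - (LINT x|HM. v x \<bullet> g x)"
      using LIMSEQ_unique by simp
    then show ?thesis by (simp add: vg mult_ac)
  qed
  then show thesis using that p(1) by blast
qed

end

section \<open>The truncated stream function and its weak derivatives\<close>

locale stream_function =
  fixes v :: "real^2 \<Rightarrow> real^2" and p :: "real^2 \<Rightarrow> real" and gv :: "2 \<Rightarrow> real^2 \<Rightarrow> real" and S :: "real^2 \<Rightarrow> real^2^2"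
  assumes v: "sqint v" and p: "sqint p" and S: "sqint (\<lambda>x. dl x *\<^sub>R S x)"
    and gv: "gv i x = (if i = 1 then v x $ 2 else - (v x $ 1))"
    and weak_gv: "\<And>i \<zeta>. test_fun \<zeta> \<Longrightarrow> (LINT x|HM. (dl x * p x) * pd i \<zeta> x) = - (LINT x|HM. gv i x * \<zeta> x)"
    and weak_S: "weak_sym v S"
begin

definition \<psi> :: "real^2 \<Rightarrow> real" where "\<psi> x = dl x * p x"

lemma \<psi>: "sqint \<psi>"
proof (rule sqint_bound(1)[OF p, where c = 1])
  show "\<psi> \<in> borel_measurable HM"
    unfolding \<psi>_def[abs_def] by (intro borel_measurable_times dl_measurable sqint_measurable[OF p])
  show "norm (\<psi> x) \<le> 1 * norm (p x)" if "x \<in> Hdisk" for x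
    using dl_pos[OF that] dl_le_1[of x] by (simp add: \<psi>_def abs_mult mult_left_le_one_le)
qed

lemma gv_sqint: "sqint (gv i)"
proof -
  have "gv 1 = (\<lambda>x. v x $ 2)" "gv 2 = (\<lambda>x. - (v x $ 1))" by (simp_all add: gv fun_eq_iff)
  then show ?thesis
    using exhaust_2[of i] sqint_nth[OF v, of 2] sqint_uminus(1)[OF sqint_nth[OF v, of 1]] by auto
qed

text \<open>The weak product rule, with \<open>\<zeta>\<close> smooth on the plane and the compact
  support supplied by \<open>t\<close>. Later \<open>\<zeta>\<close> is a translated mollifier,
  whose support may reach beyond the disk.\<close>

lemma weak_grad_cutoff:
  assumes z: "smooth_fun UNIV \<zeta>" and t: "test_fun t"
  shows "(LINT x|HM. \<psi> x * (t x * pd i \<zeta> x)) = - (LINT x|HM. gv i x * (t x * \<zeta> x)) - (LINT x|HM. \<psi> x * (pd i t x * \<zeta> x))"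
proof -
  have zD: "smooth_fun Hdisk \<zeta>" by (rule smooth_fun_subset[OF z]) simp
  have tz: "test_fun (\<lambda>x. t x * \<zeta> x)" "test_fun (\<lambda>x. t x * pd i \<zeta> x)" "test_fun (\<lambda>x. pd i t x * \<zeta> x)"
    using test_fun_mult[OF zD t] test_fun_mult[OF smooth_fun_pd[OF zD] t] test_fun_mult[OF zD test_fun_pd[OF t]]
    by (simp_all add: mult.commute)
  have e: "pd i (\<lambda>x. t x * \<zeta> x) x = t x * pd i \<zeta> x + pd i t x * \<zeta> x" for x
    by (rule pd_mult[OF smooth_fun_differentiable[OF test_fun_smooth[OF t] UNIV_I] smooth_fun_differentiable[OF z UNIV_I]])
  have i: "integrable HM (\<lambda>x. \<psi> x * (t x * pd i \<zeta> x))" "integrable HM (\<lambda>x. \<psi> x * (pd i t x * \<zeta> x))"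
    by (intro sqint_mult \<psi> sqint_test_fun tz)+
  have "(LINT x|HM. \<psi> x * (t x * pd i \<zeta> x)) + (LINT x|HM. \<psi> x * (pd i t x * \<zeta> x))
     = (LINT x|HM. \<psi> x * pd i (\<lambda>x. t x * \<zeta> x) x)"
    unfolding e distrib_left by (rule Bochner_Integration.integral_add[OF i, symmetric])
  also have "\<dots> = - (LINT x|HM. gv i x * (t x * \<zeta> x))"
    using weak_gv[OF tz(1)] by (simp add: \<psi>_def)
  finally show ?thesis by simp
qed

text \<open>By the product rule \<open>G n\<close> is the weak gradient of
  \<open>\<psi> * chi n\<close>, and \<open>V n\<close> below is its rotated version, a cut-off of
  \<open>v\<close> plus a correction that restores zero divergence.\<close>

definition G :: "nat \<Rightarrow> 2 \<Rightarrow> real^2 \<Rightarrow> real" where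
  "G n i x = gv i x * chi n x + \<psi> x * pd i (chi n) x"

definition V :: "nat \<Rightarrow> 2 \<Rightarrow> real^2 \<Rightarrow> real" where
  "V n i x = v x $ i * chi n x + \<psi> x * dperp (chi n) x $ i"

lemma V_G: "V n 1 x = - G n 2 x" "V n 2 x = G n 1 x"
  by (simp_all add: V_def G_def gv)

text \<open>The weak symmetric gradient of \<open>V\<close>; \<open>Q\<close> collects the terms in which a derivative falls on the cutoff
  or on the stream function.\<close>

definition Q :: "nat \<Rightarrow> 2 \<Rightarrow> 2 \<Rightarrow> real^2 \<Rightarrow> real" where
  "Q n i j x = v x $ j * pd i (chi n) x + gv i x * dperp (chi n) x $ j + \<psi> x * pd i (\<lambda>x. dperp (chi n) x $ j) x"

text \<open>The first product is \<open>S * chi n\<close> on the disk, grouped so that a square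
  integrable factor meets a test function.\<close>

definition SS :: "nat \<Rightarrow> 2 \<Rightarrow> 2 \<Rightarrow> real^2 \<Rightarrow> real" where
  "SS n i j x = (dl x * S x $ i $ j) * (inverse (dl x) * chi n x) + (1/2) * (Q n i j x + Q n j i x)"

lemma test_c: "test_fun (\<lambda>x. dperp (chi n) x $ i)"
  by (rule cc_formD[OF cc_form_dperp[OF test_chi]])

lemma sqint_dlS: "sqint (\<lambda>x. dl x * S x $ i $ j)"
  using sqint_mat_nth[OF S, of i j] by simp

lemma sqint_G: "sqint (G n i)"
  unfolding G_def[abs_def] by (intro sqint_add sqint_mult_test gv_sqint \<psi> test_chi test_fun_pd)

lemma sqint_V: "sqint (V n i)"
  unfolding V_def[abs_def] by (intro sqint_add sqint_mult_test sqint_nth v \<psi> test_chi test_c)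

lemma sqint_Q: "sqint (Q n i j)"
  unfolding Q_def[abs_def] by (intro sqint_add sqint_mult_test sqint_nth v \<psi> gv_sqint test_chi test_fun_pd test_c)

lemma sqint_SS: "sqint (SS n i j)"
proof -
  have 1: "sqint (\<lambda>x. (dl x * S x $ i $ j) * (inverse (dl x) * chi n x))"
    by (rule sqint_mult_test[OF sqint_dlS test_fun_mult[OF smooth_inverse_dl test_chi]])
  have 2: "sqint (\<lambda>x. (1/2) *\<^sub>R (Q n i j x + Q n j i x))" by (intro sqint_scaleR sqint_add sqint_Q)
  show ?thesis using sqint_add(1)[OF 1 2] by (simp add: SS_def[abs_def])
qed

lemma sqint_\<psi>_chi: "sqint (\<lambda>x. \<psi> x * chi n x)"
  by (intro sqint_mult_test \<psi> test_chi)

text \<open>The truncation has compact support, so the weak gradient identity holds against every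
  smooth function on the plane.\<close>

lemma weak_G:
  assumes z: "smooth_fun UNIV \<zeta>"
  shows "(LINT x|HM. (\<psi> x * chi n x) * pd i \<zeta> x) = - (LINT x|HM. G n i x * \<zeta> x)"
proof -
  have zD: "smooth_fun Hdisk \<zeta>" by (rule smooth_fun_subset[OF z]) simp
  have tz: "test_fun (\<lambda>x. chi n x * \<zeta> x)" "test_fun (\<lambda>x. pd i (chi n) x * \<zeta> x)"
    using test_fun_mult[OF zD test_chi] test_fun_mult[OF zD test_fun_pd[OF test_chi]] by (simp_all add: mult.commute)
  have i: "integrable HM (\<lambda>x. gv i x * (chi n x * \<zeta> x))" "integrable HM (\<lambda>x. \<psi> x * (pd i (chi n) x * \<zeta> x))"
    by (intro sqint_mult \<psi> gv_sqint sqint_test_fun tz)+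
  have "(LINT x|HM. G n i x * \<zeta> x) = (LINT x|HM. gv i x * (chi n x * \<zeta> x) + \<psi> x * (pd i (chi n) x * \<zeta> x))"
    by (simp add: G_def algebra_simps)
  also have "\<dots> = (LINT x|HM. gv i x * (chi n x * \<zeta> x)) + (LINT x|HM. \<psi> x * (pd i (chi n) x * \<zeta> x))"
    by (rule Bochner_Integration.integral_add[OF i])
  finally show ?thesis
    using weak_grad_cutoff[OF z test_chi, of n i] by (simp add: mult.assoc)
qed

text \<open>Derivatives of \<open>v\<close> arise only through \<open>A i j + A j i\<close>, which
  \<open>weak_sym\<close> converts into \<open>S\<close>. In the remaining terms the derivative
  falls on the cutoff or on \<open>\<psi>\<close>, whose gradient is known to be
  \<open>gv\<close>.\<close>

lemma weak_SS:
  assumes z: "smooth_fun UNIV \<zeta>"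
  shows "(LINT x|HM. V n j x * pd i \<zeta> x) + (LINT x|HM. V n i x * pd j \<zeta> x) = - 2 * (LINT x|HM. SS n i j x * \<zeta> x)"
proof -
  have zD: "smooth_fun Hdisk \<zeta>" by (rule smooth_fun_subset[OF z]) simp
  have tm: "test_fun (\<lambda>x. t x * \<zeta> x)" "test_fun (\<lambda>x. t x * pd i \<zeta> x)" if "test_fun t" for t i
    using test_fun_mult[OF zD that] test_fun_mult[OF smooth_fun_pd[OF zD] that] by (simp_all add: mult.commute)
  have iS: "integrable HM (\<lambda>x. f x * (t x * \<zeta> x))" "integrable HM (\<lambda>x. f x * (t x * pd i \<zeta> x))"
    if "sqint f" "test_fun t" for f t i
    by (intro sqint_mult sqint_test_fun tm that)+
  note tc = test_c[of n] and tchi = test_chi[of n] and tpchi = test_fun_pd[OF test_chi[of n]] and tpc = test_fun_pd[OF test_c[of n]]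
  note vi = sqint_nth[OF v]
  \<comment> \<open>The derivative is put on \<open>chi n * \<zeta>\<close> as a whole, so that the
    weak symmetric gradient of \<open>v\<close> can be tested against it.\<close>
  define A where "A i j = (LINT x|HM. v x $ j * pd i (\<lambda>x. chi n x * \<zeta> x) x)" for i j
  have ep: "pd i (\<lambda>x. chi n x * \<zeta> x) x = chi n x * pd i \<zeta> x + pd i (chi n) x * \<zeta> x" for i x
    by (rule pd_mult[OF smooth_fun_differentiable[OF smooth_chi UNIV_I] smooth_fun_differentiable[OF z UNIV_I]])
  have A: "(LINT x|HM. v x $ j * (chi n x * pd i \<zeta> x)) = A i j - (LINT x|HM. v x $ j * (pd i (chi n) x * \<zeta> x))" for i j
    unfolding A_def ep distrib_left Bochner_Integration.integral_add[OF iS(2)[OF vi tchi] iS(1)[OF vi tpchi]] by simp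
  \<comment> \<open>For the correction term the derivative is moved off \<open>\<zeta>\<close> by
    \<open>weak_grad_cutoff\<close>, with a component of the rotated gradient of
    \<open>chi n\<close> as cutoff.\<close>
  have Vexp: "(LINT x|HM. V n j x * pd i \<zeta> x) = A i j - (LINT x|HM. Q n i j x * \<zeta> x)" for i j
  proof -
    have "(LINT x|HM. V n j x * pd i \<zeta> x) = (LINT x|HM. v x $ j * (chi n x * pd i \<zeta> x) + \<psi> x * (dperp (chi n) x $ j * pd i \<zeta> x))"
      by (simp add: V_def algebra_simps)
    also have "\<dots> = (LINT x|HM. v x $ j * (chi n x * pd i \<zeta> x)) + (LINT x|HM. \<psi> x * (dperp (chi n) x $ j * pd i \<zeta> x))"
      by (rule Bochner_Integration.integral_add[OF iS(2)[OF vi tchi] iS(2)[OF \<psi> tc]])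
    also have "\<dots> = A i j - ((LINT x|HM. v x $ j * (pd i (chi n) x * \<zeta> x)) + (LINT x|HM. gv i x * (dperp (chi n) x $ j * \<zeta> x))
        + (LINT x|HM. \<psi> x * (pd i (\<lambda>x. dperp (chi n) x $ j) x * \<zeta> x)))"
      unfolding A weak_grad_cutoff[OF z tc] by simp
    also have "(LINT x|HM. v x $ j * (pd i (chi n) x * \<zeta> x)) + (LINT x|HM. gv i x * (dperp (chi n) x $ j * \<zeta> x))
        + (LINT x|HM. \<psi> x * (pd i (\<lambda>x. dperp (chi n) x $ j) x * \<zeta> x))
       = (LINT x|HM. v x $ j * (pd i (chi n) x * \<zeta> x) + gv i x * (dperp (chi n) x $ j * \<zeta> x)
        + \<psi> x * (pd i (\<lambda>x. dperp (chi n) x $ j) x * \<zeta> x))"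
      using iS(1)[OF vi tpchi, of j i] iS(1)[OF gv_sqint tc, of i j] iS(1)[OF \<psi> tpc, of i j] by simp
    also have "\<dots> = (LINT x|HM. Q n i j x * \<zeta> x)"
      by (simp add: Q_def algebra_simps)
    finally show ?thesis .
  qed
  have Qi: "integrable HM (\<lambda>x. Q n i j x * \<zeta> x)" for i j
  proof -
    have "(\<lambda>x. Q n i j x * \<zeta> x) = (\<lambda>x. v x $ j * (pd i (chi n) x * \<zeta> x) + gv i x * (dperp (chi n) x $ j * \<zeta> x)
        + \<psi> x * (pd i (\<lambda>x. dperp (chi n) x $ j) x * \<zeta> x))"
      by (simp add: Q_def algebra_simps)
    then show ?thesis
      using iS(1)[OF vi tpchi, of j i] iS(1)[OF gv_sqint tc, of i j] iS(1)[OF \<psi> tpc, of i j] by simp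
  qed
  have tS: "test_fun (\<lambda>x. inverse (dl x) * chi n x)" by (rule test_fun_mult[OF smooth_inverse_dl tchi])
  have AS: "(LINT x|HM. (dl x * S x $ i $ j) * ((inverse (dl x) * chi n x) * \<zeta> x)) = - (1/2) * (A i j + A j i)"
  proof -
    have "(LINT x|HM. (dl x * S x $ i $ j) * ((inverse (dl x) * chi n x) * \<zeta> x)) = (LINT x|HM. S x $ i $ j * (chi n x * \<zeta> x))"
      by (rule Bochner_Integration.integral_cong) (use dl_pos in \<open>force simp: space_HM\<close>)+
    also have "\<dots> = (LINT x|HM. - (1/2) * (v x $ j * pd i (\<lambda>x. chi n x * \<zeta> x) x + v x $ i * pd j (\<lambda>x. chi n x * \<zeta> x) x))"
      using weak_S tm(1)[OF tchi] unfolding weak_sym_def by blast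
    also have "\<dots> = - (1/2) * (A i j + A j i)"
      unfolding A_def integral_mult_right_zero
      by (subst Bochner_Integration.integral_add) (intro sqint_mult vi sqint_test_fun test_fun_pd tm tchi refl)+
    finally show ?thesis .
  qed
  have "(LINT x|HM. SS n i j x * \<zeta> x) = (LINT x|HM. (dl x * S x $ i $ j) * ((inverse (dl x) * chi n x) * \<zeta> x) + (1/2) * (Q n i j x * \<zeta> x + Q n j i x * \<zeta> x))"
    by (rule Bochner_Integration.integral_cong) (simp_all add: SS_def distrib_right mult.assoc)
  also have "\<dots> = - (1/2) * (A i j + A j i) + (1/2) * ((LINT x|HM. Q n i j x * \<zeta> x) + (LINT x|HM. Q n j i x * \<zeta> x))"
    using iS(1)[OF sqint_dlS tS, of i j] Qi[of i j] Qi[of j i] AS by simp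
  finally show ?thesis unfolding Vexp by (simp add: field_simps)
qed

end

section \<open>Mollified truncations and their convergence\<close>

lemma conv_support:
  assumes k: "kernel \<eta> R" and f: "\<And>y. norm y > r \<Longrightarrow> f y = 0" and x: "norm x > r + R"
  shows "conv \<eta> f x = 0"
proof -
  have e: "\<eta> (x - y) * f y = 0" for y
  proof (cases "norm y > r")
    case False
    then have "norm (x - y) > R" using norm_triangle_ineq2[of x y] x by linarith
    then show ?thesis using kernel.support[OF k] by simp
  qed (simp add: f)
  show ?thesis unfolding conv_def e by simp
qed

lemma conv_mol_eq_integral:
  assumes k: "k > 0"
  shows "conv (pd i (mol k)) f x = - (LINT y|HM. f y * pd i (\<lambda>y. mol k (x - y)) y)"
    "conv (mol k) f x = (LINT y|HM. f y * mol k (x - y))"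
    "smooth_fun UNIV (\<lambda>y. mol k (x - y))"
proof -
  note s = kernel.smooth[OF kernel_mol[OF k]]
  have p: "pd i (\<lambda>y. mol k (x - y)) y = - pd i (mol k) (x - y)" for y
    by (rule pd_reflect(1)[OF smooth_fun_differentiable[OF s UNIV_I]])
  show "conv (pd i (mol k)) f x = - (LINT y|HM. f y * pd i (\<lambda>y. mol k (x - y)) y)"
    unfolding p conv_def by (simp add: mult.commute)
  show "conv (mol k) f x = (LINT y|HM. f y * mol k (x - y))"
    unfolding conv_def by (simp add: mult.commute)
  show "smooth_fun UNIV (\<lambda>y. mol k (x - y))" by (rule smooth_fun_reflect[OF s])
qed

lemma truncation_bound:
  obtains B where "B \<ge> 0" "\<And>n i x. x \<in> Hdisk \<Longrightarrow> \<bar>dl x * pd i (chi n) x\<bar> \<le> B"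
    "\<And>n i x. x \<in> Hdisk \<Longrightarrow> \<bar>dl x * dperp (chi n) x $ i\<bar> \<le> B"
    "\<And>n i j x. x \<in> Hdisk \<Longrightarrow> \<bar>(dl x)\<^sup>2 * pd i (\<lambda>x. dperp (chi n) x $ j) x\<bar> \<le> B"
proof -
  obtain B where B: "B \<ge> 0" "\<forall>x\<in>Hdisk. \<forall>n i j. \<bar>dl x * pd i (chi n) x\<bar> \<le> B \<and> \<bar>(dl x)\<^sup>2 * pd j (pd i (chi n)) x\<bar> \<le> B"
    using chi_derivative_bounds by blast
  have d2: "pd i (\<lambda>x. dperp (chi n) x $ j) x = (if j = 1 then - pd i (pd 2 (chi n)) x else pd i (pd 1 (chi n)) x)" for n i j x
    using exhaust_2[of j] pd_minus[OF smooth_fun_differentiable[OF smooth_fun_pd[OF smooth_chi] UNIV_I], of i 2 n x]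
    by (auto simp: dperp_def)
  show thesis
  proof (rule that[OF B(1)])
    show "\<bar>dl x * dperp (chi n) x $ i\<bar> \<le> B" if "x \<in> Hdisk" for n i x
      using B(2) that exhaust_2[of i] by auto
    show "\<bar>(dl x)\<^sup>2 * pd i (\<lambda>x. dperp (chi n) x $ j) x\<bar> \<le> B" if "x \<in> Hdisk" for n i j x
      using B(2) that unfolding d2 by auto
  qed (use B(2) in blast)
qed

lemma dperp_chi_eq_0: "real (Suc n) * dl x > 2 \<Longrightarrow> dperp (chi n) x $ i = 0"
  using exhaust_2[of i] by (auto simp: pd_chi_eq_0)

lemma pd_dperp_chi_eq_0:
  assumes "real (Suc n) * dl x > 2"
  shows "pd i (\<lambda>x. dperp (chi n) x $ j) x = 0"
  using exhaust_2[of j] pd_minus[OF smooth_fun_differentiable[OF smooth_fun_pd[OF smooth_chi] UNIV_I], of i 2 n x]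
  by (auto simp: dperp_def pd_pd_chi_eq_0[OF assms])

context stream_function
begin

text \<open>Mollifying the scalar stream function and rotating its gradient afterwards keeps the
  approximating fields exactly divergence-free.\<close>

definition Psi :: "nat \<Rightarrow> real \<Rightarrow> real^2 \<Rightarrow> real" where
  "Psi n k = conv (mol k) (\<lambda>x. \<psi> x * chi n x)"

text \<open>\<open>chi n\<close> is supported at positive distance from the boundary; once the
  kernel radius is smaller than that distance, the convolution has compact support in the
  disk.\<close>

lemma eventually_test_Psi: "\<forall>\<^sub>F m in sequentially. test_fun (Psi n (real (Suc m)))"
proof -
  obtain r where r: "r < 1" "\<forall>x. norm x > r \<longrightarrow> chi n x = 0" using test_funD[OF test_chi[of n]] by blast
  obtain N :: nat where N: "2 / (1 - r) < real N" using reals_Archimedean2 by blast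
  show ?thesis
  proof (rule eventually_sequentiallyI[of N])
    fix m assume "m \<ge> N"
    then have "2 / (1 - r) < real (Suc m)" using N by simp
    then have s: "r + 2 / real (Suc m) < 1" using r(1) by (simp add: field_simps del: of_nat_Suc)
    have k: "kernel (mol (real (Suc m))) (2 / real (Suc m))" by (rule kernel_mol) simp
    show "test_fun (Psi n (real (Suc m)))"
    proof (rule test_funI[OF _ s])
      show "smooth_fun Hdisk (Psi n (real (Suc m)))"
        unfolding Psi_def by (rule smooth_fun_subset[OF smooth_conv[OF k sqint_\<psi>_chi]]) simp
      show "Psi n (real (Suc m)) x = 0" if "norm x > r + 2 / real (Suc m)" for x
        unfolding Psi_def by (rule conv_support[OF k _ that]) (use r(2) in simp)
    qed
  qed
qed

text \<open>Convolution commutes with the weak derivative at every point of the plane, because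
  \<open>weak_G\<close> may be tested against any translate of the mollifier. The formula for
  \<open>Sym\<close> below follows in the same way from \<open>weak_SS\<close>.\<close>

lemma pd_Psi: assumes k: "k > 0" shows "pd i (Psi n k) x = conv (mol k) (G n i) x"
proof -
  have "pd i (Psi n k) x = conv (pd i (mol k)) (\<lambda>x. \<psi> x * chi n x) x"
    unfolding Psi_def kernel.pd_conv[OF kernel_mol[OF k] sqint_\<psi>_chi] ..
  also have "\<dots> = (LINT y|HM. G n i y * mol k (x - y))"
    unfolding conv_mol_eq_integral(1)[OF k] weak_G[OF conv_mol_eq_integral(3)[OF k]] by simp
  also have "\<dots> = conv (mol k) (G n i) x" by (rule conv_mol_eq_integral(2)[OF k, symmetric])
  finally show ?thesis .
qed

lemma dperp_Psi: assumes k: "k > 0" shows "dperp (Psi n k) x $ i = conv (mol k) (V n i) x"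
proof -
  have "V n 1 = (\<lambda>x. - G n 2 x)" "V n 2 = G n 1" by (simp_all add: V_G fun_eq_iff)
  then show ?thesis
    using exhaust_2[of i] by (auto simp: pd_Psi[OF k] conv_def)
qed

lemma Sym_Psi: assumes k: "k > 0" shows "Sym (dperp (Psi n k)) x $ i $ j = conv (mol k) (SS n i j) x"
proof -
  have e: "(\<lambda>y. dperp (Psi n k) y $ i) = conv (mol k) (V n i)" for i
    by (rule ext) (rule dperp_Psi[OF k])
  have "Sym (dperp (Psi n k)) x $ i $ j = (1/2) * (conv (pd i (mol k)) (V n j) x + conv (pd j (mol k)) (V n i) x)"
    by (simp add: Sym_def e kernel.pd_conv[OF kernel_mol[OF k] sqint_V])
  also have "\<dots> = (LINT y|HM. SS n i j y * mol k (x - y))"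
    unfolding conv_mol_eq_integral(1)[OF k] using weak_SS[OF conv_mol_eq_integral(3)[OF k, of x], of n j i] by simp
  also have "\<dots> = conv (mol k) (SS n i j) x" by (rule conv_mol_eq_integral(2)[OF k, symmetric])
  finally show ?thesis .
qed

text \<open>The correction term is \<open>dl\<close> times the rotated gradient of
  \<open>chi n\<close>, which is bounded, times \<open>p\<close>, which is square integrable; this
  is the first use of the decay of the stream function.\<close>

lemma V_tendsto: "(\<lambda>n. nsq (\<lambda>x. V n i x - v x $ i)) \<longlonglongrightarrow> 0"
proof (rule truncation_bound)
  fix B assume B: "B \<ge> 0" "\<And>n i x. x \<in> Hdisk \<Longrightarrow> \<bar>dl x * dperp (chi n) x $ i\<bar> \<le> B"
  show ?thesis
  proof (rule nsq_tendsto_0_interior)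
    show "(\<lambda>x. V n i x - v x $ i) \<in> borel_measurable HM" for n
      by (intro sqint_measurable sqint_diff sqint_V sqint_nth v)
    show "integrable HM (\<lambda>x. 2 * (norm (v x $ i))\<^sup>2 + 2 * (B\<^sup>2 * (norm (p x))\<^sup>2))"
      by (intro Bochner_Integration.integrable_add integrable_mult_right sqint_integrable_sq sqint_nth v p)
    show "V n i x - v x $ i = 0" if "real (Suc n) * dl x > 2" for n x
      by (simp add: V_def chi_eq_1[OF that] dperp_chi_eq_0[OF that])
    show "(norm (V n i x - v x $ i))\<^sup>2 \<le> 2 * (norm (v x $ i))\<^sup>2 + 2 * (B\<^sup>2 * (norm (p x))\<^sup>2)" if x: "x \<in> Hdisk" for n x
    proof -
      have "V n i x - v x $ i = (chi n x - 1) * v x $ i + (dl x * dperp (chi n) x $ i) * p x"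
        by (simp add: V_def \<psi>_def algebra_simps)
      then have "(norm (V n i x - v x $ i))\<^sup>2 \<le> 2 * (norm ((chi n x - 1) * v x $ i))\<^sup>2 + 2 * (norm ((dl x * dperp (chi n) x $ i) * p x))\<^sup>2"
        by (simp only: norm_add_sq_le)
      also have "\<dots> \<le> 2 * (1 * norm (v x $ i))\<^sup>2 + 2 * (B * norm (p x))\<^sup>2"
      proof (intro add_mono mult_left_mono power_mono)
        show "norm ((chi n x - 1) * v x $ i) \<le> 1 * norm (v x $ i)"
          unfolding real_norm_def abs_mult[of "chi n x - 1"] using chi_bounds[of n x] by (intro mult_right_mono) auto
        show "norm (dl x * dperp (chi n) x $ i * p x) \<le> B * norm (p x)"
          unfolding real_norm_def abs_mult[of _ "p x"] by (intro mult_right_mono B(2)[OF x]) auto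
      qed auto
      finally show ?thesis by (simp add: power_mult_distrib)
    qed
  qed
qed

text \<open>The weight \<open>dl\<close> turns the terms of \<open>Q\<close> into bounded multiples
  of \<open>v\<close>, \<open>gv\<close> and \<open>p\<close>: first derivatives of the cutoff take
  one \<open>dl\<close>, second derivatives take two, the second one being hidden in
  \<open>\<psi> = dl * p\<close>.\<close>

lemma SS_tendsto: "(\<lambda>n. nsq (\<lambda>x. dl x * (SS n i j x - S x $ i $ j))) \<longlonglongrightarrow> 0"
proof (rule truncation_bound)
  fix B assume B: "B \<ge> 0" "\<And>n i x. x \<in> Hdisk \<Longrightarrow> \<bar>dl x * pd i (chi n) x\<bar> \<le> B"
    "\<And>n i x. x \<in> Hdisk \<Longrightarrow> \<bar>dl x * dperp (chi n) x $ i\<bar> \<le> B"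
    "\<And>n i j x. x \<in> Hdisk \<Longrightarrow> \<bar>(dl x)\<^sup>2 * pd i (\<lambda>x. dperp (chi n) x $ j) x\<bar> \<le> B"
  \<comment> \<open>A common majorant for all index pairs; the factor 2 covers
    \<open>v x $ j\<close> and \<open>gv i x\<close>, both components of \<open>v\<close> up to
    sign.\<close>
  define H where "H x = 2 * (\<bar>v x $ 1\<bar> + \<bar>v x $ 2\<bar>) + \<bar>p x\<bar>" for x
  have abs: "sqint (\<lambda>x. \<bar>f x\<bar>)" if "sqint f" for f :: "real^2 \<Rightarrow> real"
  proof (rule sqint_bound(1)[OF that, where c = 1])
    show "(\<lambda>x. \<bar>f x\<bar>) \<in> borel_measurable HM" using sqint_measurable[OF that] by measurable
  qed simp
  have H: "sqint H"
  proof -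
    have "sqint (\<lambda>x. 2 *\<^sub>R (\<bar>v x $ 1\<bar> + \<bar>v x $ 2\<bar>) + \<bar>p x\<bar>)"
      by (intro sqint_add sqint_scaleR abs sqint_nth v p)
    then show ?thesis by (simp add: H_def[abs_def])
  qed
  have Qb: "\<bar>dl x * Q n i j x\<bar> \<le> B * H x" if x: "x \<in> Hdisk" for n i j x
  proof -
    have "dl x * Q n i j x = v x $ j * (dl x * pd i (chi n) x) + gv i x * (dl x * dperp (chi n) x $ j)
        + p x * ((dl x)\<^sup>2 * pd i (\<lambda>x. dperp (chi n) x $ j) x)"
      by (simp add: Q_def \<psi>_def algebra_simps power2_eq_square)
    also have "\<bar>\<dots>\<bar> \<le> \<bar>v x $ j\<bar> * B + \<bar>gv i x\<bar> * B + \<bar>p x\<bar> * B"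
    proof -
      have m: "\<bar>y * z\<bar> \<le> \<bar>y\<bar> * B" if "\<bar>z\<bar> \<le> B" for y z :: real
        unfolding abs_mult using that by (intro mult_left_mono) auto
      show ?thesis
        using m[OF B(2)[OF x, of i n], of "v x $ j"] m[OF B(3)[OF x, of n j], of "gv i x"] m[OF B(4)[OF x, of i n j], of "p x"]
        by linarith
    qed
    also have "\<dots> = B * (\<bar>v x $ j\<bar> + \<bar>gv i x\<bar> + \<bar>p x\<bar>)" by (simp add: algebra_simps)
    also have "\<dots> \<le> B * H x"
      using exhaust_2[of j] B(1) by (intro mult_left_mono) (auto simp: H_def gv)
    finally show ?thesis .
  qed
  show ?thesis
  proof (rule nsq_tendsto_0_interior)
    have "sqint (\<lambda>x. dl x *\<^sub>R SS n i j x - dl x * S x $ i $ j)" for n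
      by (intro sqint_diff sqint_dlS sqint_mult_bounded(1)[OF sqint_SS dl_measurable, of 1])
        (use dl_pos dl_le_1 in \<open>simp add: less_imp_le\<close>)
    then have "sqint (\<lambda>x. dl x * (SS n i j x - S x $ i $ j))" for n by (simp add: right_diff_distrib)
    then show "(\<lambda>x. dl x * (SS n i j x - S x $ i $ j)) \<in> borel_measurable HM" for n
      by (rule sqint_measurable)
    show "integrable HM (\<lambda>x. 2 * (norm (dl x * S x $ i $ j))\<^sup>2 + 2 * (B\<^sup>2 * (norm (H x))\<^sup>2))"
      by (intro Bochner_Integration.integrable_add integrable_mult_right sqint_integrable_sq sqint_dlS H)
    show "dl x * (SS n i j x - S x $ i $ j) = 0" if "x \<in> Hdisk" "real (Suc n) * dl x > 2" for n x
      using dl_pos[OF that(1)]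
      by (simp add: SS_def Q_def chi_eq_1[OF that(2)] pd_chi_eq_0[OF that(2)] dperp_chi_eq_0[OF that(2)] pd_dperp_chi_eq_0[OF that(2)] del: dperp_nth)
    show "(norm (dl x * (SS n i j x - S x $ i $ j)))\<^sup>2 \<le> 2 * (norm (dl x * S x $ i $ j))\<^sup>2 + 2 * (B\<^sup>2 * (norm (H x))\<^sup>2)"
      if x: "x \<in> Hdisk" for n x
    proof -
      have "dl x * (SS n i j x - S x $ i $ j) = (chi n x - 1) * (dl x * S x $ i $ j) + (1/2) * (dl x * Q n i j x + dl x * Q n j i x)"
        using dl_pos[OF x] by (simp add: SS_def field_simps)
      then have "(norm (dl x * (SS n i j x - S x $ i $ j)))\<^sup>2 \<le> 2 * (norm ((chi n x - 1) * (dl x * S x $ i $ j)))\<^sup>2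
          + 2 * (norm ((1/2) * (dl x * Q n i j x + dl x * Q n j i x)))\<^sup>2"
        by (simp only: norm_add_sq_le)
      also have "\<dots> \<le> 2 * (1 * norm (dl x * S x $ i $ j))\<^sup>2 + 2 * (B * H x)\<^sup>2"
      proof (intro add_mono mult_left_mono power_mono)
        show "norm ((chi n x - 1) * (dl x * S x $ i $ j)) \<le> 1 * norm (dl x * S x $ i $ j)"
          unfolding real_norm_def abs_mult[of "chi n x - 1"] using chi_bounds[of n x] by (intro mult_right_mono) auto
        show "norm ((1/2) * (dl x * Q n i j x + dl x * Q n j i x)) \<le> B * H x"
          using Qb[OF x, of n i j] Qb[OF x, of n j i] by simp
      qed auto
      finally show ?thesis by (simp add: power_mult_distrib)
    qed
  qed
qed

text \<open>A diagonal choice. The truncation index is \<open>n\<close>, and for each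
  \<open>n\<close> the mollification is taken so fine that \<open>Psi\<close> is a test function and
  the finitely many component errors are below \<open>1 / (n + 1)\<close>.\<close>

lemma approximating_sequence:
  obtains \<theta> :: "nat \<Rightarrow> real^2 \<Rightarrow> real^2" where "\<And>n. cc_form (\<theta> n)" "\<And>n x. x \<in> Hdisk \<Longrightarrow> pd 1 (\<lambda>y. \<theta> n y $ 1) x + pd 2 (\<lambda>y. \<theta> n y $ 2) x = 0"
    "(\<lambda>n. nsq (\<lambda>x. \<theta> n x - v x)) \<longlonglongrightarrow> 0" "(\<lambda>n. nsq (\<lambda>x. dl x *\<^sub>R (Sym (\<theta> n) x - S x))) \<longlonglongrightarrow> 0"
proof -
  let ?c = "\<lambda>n m f. \<lambda>x. conv (mol (real (Suc m))) f x - f x"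
  let ?e = "\<lambda>n. inverse (real (Suc n))"
  define ok where "ok n m \<longleftrightarrow> test_fun (Psi n (real (Suc m))) \<and> (\<forall>i. nsq (?c n m (V n i)) < ?e n) \<and>
    (\<forall>i j. nsq (?c n m (SS n i j)) < ?e n)" for n m
  have ev: "\<forall>\<^sub>F m in sequentially. nsq (?c n m f) < ?e n" if "sqint f" for f n
    by (rule order_tendstoD(2)[OF mollification_converges[OF that]]) simp
  have "\<forall>\<^sub>F m in sequentially. ok n m" for n
    unfolding ok_def
    by (intro eventually_conj eventually_test_Psi eventually_all_finite ev sqint_V sqint_SS)
  then have "\<exists>m. ok n m" for n
    by (rule eventually_happens'[OF sequentially_bot])
  then obtain f where f: "\<And>n. ok n (f n)" by metis
  define k where "k n = real (Suc (f n))" for n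
  have k: "k n > 0" for n by (simp add: k_def)
  have tP: "test_fun (Psi n (k n))" for n using f[of n] by (simp add: ok_def k_def)
  have cV: "nsq (\<lambda>x. conv (mol (k n)) (V n i) x - V n i x) < ?e n" for n i
    using f[of n] unfolding ok_def k_def by blast
  have cS: "nsq (\<lambda>x. conv (mol (k n)) (SS n i j) x - SS n i j x) < ?e n" for n i j
    using f[of n] unfolding ok_def k_def by blast
  define \<theta> where "\<theta> n = dperp (Psi n (k n))" for n
  have cc: "cc_form (\<theta> n)" for n unfolding \<theta>_def by (rule cc_form_dperp[OF tP])
  have sand: "g \<longlonglongrightarrow> 0" if "\<And>n. 0 \<le> g n" "\<And>n. g n \<le> 2 * ?e n + 2 * h n" "h \<longlonglongrightarrow> 0" for g h :: "nat \<Rightarrow> real"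
  proof (rule tendsto_sandwich[OF _ _ tendsto_const])
    have "(\<lambda>n. 2 * ?e n + 2 * h n) \<longlonglongrightarrow> 2 * 0 + 2 * 0"
      by (intro tendsto_add tendsto_mult tendsto_const LIMSEQ_inverse_real_of_nat that(3))
    then show "(\<lambda>n. 2 * ?e n + 2 * h n) \<longlonglongrightarrow> 0" by simp
  qed (intro always_eventually allI that)+
  have l1: "(\<lambda>n. nsq (\<lambda>x. (\<theta> n x - v x) $ i)) \<longlonglongrightarrow> 0" for i
  proof (rule sand[OF nsq_nonneg _ V_tendsto[of i]])
    fix n
    have c: "sqint (conv (mol (k n)) (V n i))" by (rule nsq_conv_le(1)[OF k sqint_V])
    have "nsq (\<lambda>x. (\<theta> n x - v x) $ i) = nsq (\<lambda>x. (conv (mol (k n)) (V n i) x - V n i x) + (V n i x - v x $ i))"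
      by (simp add: \<theta>_def dperp_Psi[OF k])
    also have "\<dots> \<le> 2 * nsq (\<lambda>x. conv (mol (k n)) (V n i) x - V n i x) + 2 * nsq (\<lambda>x. V n i x - v x $ i)"
      by (intro sqint_add sqint_diff c sqint_V sqint_nth v)
    finally show "nsq (\<lambda>x. (\<theta> n x - v x) $ i) \<le> 2 * ?e n + 2 * nsq (\<lambda>x. V n i x - v x $ i)"
      using cV[of n i] by linarith
  qed
  have l2: "(\<lambda>n. nsq (\<lambda>x. (dl x *\<^sub>R (Sym (\<theta> n) x - S x)) $ i $ j)) \<longlonglongrightarrow> 0" for i j
  proof (rule sand[OF nsq_nonneg _ SS_tendsto[of i j]])
    fix n
    have c: "sqint (\<lambda>x. conv (mol (k n)) (SS n i j) x - SS n i j x)"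
      by (rule sqint_diff(1)[OF nsq_conv_le(1)[OF k sqint_SS] sqint_SS])
    have db: "\<bar>dl x\<bar> \<le> 1" if "x \<in> Hdisk" for x using dl_pos[OF that] dl_le_1[of x] by simp
    note c1 = sqint_mult_bounded[OF c dl_measurable db]
    have dS: "sqint (\<lambda>x. dl x *\<^sub>R SS n i j x)" by (rule sqint_mult_bounded(1)[OF sqint_SS dl_measurable db])
    have c2: "sqint (\<lambda>x. dl x * (SS n i j x - S x $ i $ j))"
      using sqint_diff(1)[OF dS sqint_dlS[of i j]] by (simp add: right_diff_distrib)
    have "nsq (\<lambda>x. (dl x *\<^sub>R (Sym (\<theta> n) x - S x)) $ i $ j) = nsq (\<lambda>x. dl x *\<^sub>R (conv (mol (k n)) (SS n i j) x - SS n i j x) + dl x * (SS n i j x - S x $ i $ j))"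
      by (simp add: \<theta>_def Sym_Psi[OF k] algebra_simps)
    also have "\<dots> \<le> 2 * nsq (\<lambda>x. dl x *\<^sub>R (conv (mol (k n)) (SS n i j) x - SS n i j x)) + 2 * nsq (\<lambda>x. dl x * (SS n i j x - S x $ i $ j))"
      by (rule sqint_add(2)[OF c1(1) c2])
    finally show "nsq (\<lambda>x. (dl x *\<^sub>R (Sym (\<theta> n) x - S x)) $ i $ j) \<le> 2 * ?e n + 2 * nsq (\<lambda>x. dl x * (SS n i j x - S x $ i $ j))"
      using cS[of n i j] c1(2) by (simp del: of_nat_Suc)
  qed
  have s1: "sqint (\<lambda>x. (\<theta> n x - v x) $ i)" for n i by (intro sqint_nth sqint_diff sqint_cc cc v)
  have s2: "sqint (\<lambda>x. (dl x *\<^sub>R (Sym (\<theta> n) x - S x)) $ i $ j)" for n i j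
    using sqint_mat_nth[OF sqint_diff(1)[OF sqint_cc(2)[OF cc] S], of n i j] by (simp add: right_diff_distrib)
  show thesis
  proof (rule that[OF cc])
    show "pd 1 (\<lambda>y. \<theta> n y $ 1) x + pd 2 (\<lambda>y. \<theta> n y $ 2) x = 0" for n x
      unfolding \<theta>_def by (rule dperp_div[OF tP])
    have "(\<lambda>n. nsq (\<lambda>x. (\<theta> n x - v x) $ 1) + nsq (\<lambda>x. (\<theta> n x - v x) $ 2)) \<longlonglongrightarrow> 0 + 0"
      by (intro tendsto_add l1)
    then show "(\<lambda>n. nsq (\<lambda>x. \<theta> n x - v x)) \<longlonglongrightarrow> 0"
      by (simp add: sqint_vec2(2)[OF s1] del: vector_minus_component)
    have "(\<lambda>n. \<Sum>i\<in>UNIV. \<Sum>j\<in>UNIV. nsq (\<lambda>x. (dl x *\<^sub>R (Sym (\<theta> n) x - S x)) $ i $ j)) \<longlonglongrightarrow> (\<Sum>i\<in>(UNIV::2 set). \<Sum>j\<in>(UNIV::2 set). 0)"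
      by (intro tendsto_sum l2)
    then show "(\<lambda>n. nsq (\<lambda>x. dl x *\<^sub>R (Sym (\<theta> n) x - S x))) \<longlonglongrightarrow> 0"
      unfolding sqint_mat(2)[OF s2] by simp
  qed
qed

end

section \<open>The decomposition\<close>

lemma weak_sym_add_scaleR:
  assumes u: "sqint u" "sqint (\<lambda>x. dl x *\<^sub>R S x)" "weak_sym u S"
    and v: "sqint v" "sqint (\<lambda>x. dl x *\<^sub>R T x)" "weak_sym v T"
  shows "weak_sym (\<lambda>x. u x + c *\<^sub>R v x) (\<lambda>x. S x + c *\<^sub>R T x)"
  unfolding weak_sym_def
proof (intro allI impI)
  fix \<phi> i j assume t: "test_fun \<phi>"
  have iS: "integrable HM (\<lambda>x. S x $ i $ j * \<phi> x)" "integrable HM (\<lambda>x. T x $ i $ j * \<phi> x)"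
    using sqint_mat_nth[OF u(2), of i j] sqint_mat_nth[OF v(2), of i j] by (intro integrable_dl_test t; simp)+
  have iu: "integrable HM (\<lambda>x. - (1/2) * (w x $ j * pd i \<phi> x + w x $ i * pd j \<phi> x))" if "sqint w" for w :: "real^2 \<Rightarrow> real^2"
    by (intro integrable_mult_right Bochner_Integration.integrable_add sqint_mult sqint_nth that sqint_test_fun test_fun_pd t)
  have "(LINT x|HM. (S x + c *\<^sub>R T x) $ i $ j * \<phi> x) = (LINT x|HM. S x $ i $ j * \<phi> x + c * (T x $ i $ j * \<phi> x))"
    by (simp add: algebra_simps)
  also have "\<dots> = (LINT x|HM. S x $ i $ j * \<phi> x) + c * (LINT x|HM. T x $ i $ j * \<phi> x)"
    using iS by simp
  also have "\<dots> = (LINT x|HM. - (1/2) * (u x $ j * pd i \<phi> x + u x $ i * pd j \<phi> x)) +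
      c * (LINT x|HM. - (1/2) * (v x $ j * pd i \<phi> x + v x $ i * pd j \<phi> x))"
    using u(3) v(3) t unfolding weak_sym_def by simp
  also have "\<dots> = (LINT x|HM. - (1/2) * (u x $ j * pd i \<phi> x + u x $ i * pd j \<phi> x) +
      c * (- (1/2) * (v x $ j * pd i \<phi> x + v x $ i * pd j \<phi> x)))"
    unfolding Bochner_Integration.integral_add[OF iu[OF u(1)] integrable_mult_right[OF iu[OF v(1)]]] integral_mult_right_zero ..
  also have "\<dots> = (LINT x|HM. - (1/2) * ((u x + c *\<^sub>R v x) $ j * pd i \<phi> x + (u x + c *\<^sub>R v x) $ i * pd j \<phi> x))"
    by (rule Bochner_Integration.integral_cong[OF refl]) (simp add: algebra_simps)
  finally show "(LINT x|HM. (S x + c *\<^sub>R T x) $ i $ j * \<phi> x) =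
      (LINT x|HM. - (1/2) * ((u x + c *\<^sub>R v x) $ j * pd i \<phi> x + (u x + c *\<^sub>R v x) $ i * pd j \<phi> x))" .
qed

lemma Sym_add:
  fixes u v :: "real^2 \<Rightarrow> real^2"
  assumes "cc_form u" "cc_form v"
  shows "Sym (\<lambda>x. u x + v x) x = Sym u x + Sym v x"
proof -
  have d: "(\<lambda>x. u x $ i) differentiable (at x)" "(\<lambda>x. v x $ i) differentiable (at x)" for i
    using smooth_fun_differentiable[OF test_fun_smooth[OF cc_formD[OF assms(1)]] UNIV_I]
      smooth_fun_differentiable[OF test_fun_smooth[OF cc_formD[OF assms(2)]] UNIV_I] by auto
  show ?thesis
    by (simp add: vec_eq_iff Sym_def pd_add[OF d(1) d(2)] field_simps)
qed

lemma cc_form_add: "cc_form u \<Longrightarrow> cc_form v \<Longrightarrow> cc_form (\<lambda>x. u x + v x :: real^2)"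
  by (rule cc_formI) (simp add: test_fun_add cc_formD)

lemma H10_add:
  assumes a: "a > 0" and u: "u \<in> H10 a" and v: "v \<in> H10 a"
  shows "(\<lambda>x. u x + v x) \<in> H10 a"
proof -
  note iff = H1_closure_iff[OF a, of cc_form, simplified, folded H10_def]
  obtain S \<theta> where u: "sqint u" and S: "sqint (\<lambda>x. dl x *\<^sub>R S x)" "weak_sym u S" and th: "\<And>n. cc_form (\<theta> n)"
    and l: "(\<lambda>n. nsq (\<lambda>x. \<theta> n x - u x)) \<longlonglongrightarrow> 0" "(\<lambda>n. nsq (\<lambda>x. dl x *\<^sub>R (Sym (\<theta> n) x - S x))) \<longlonglongrightarrow> 0"
    using u unfolding iff by blast
  obtain T \<xi> where v: "sqint v" and T: "sqint (\<lambda>x. dl x *\<^sub>R T x)" "weak_sym v T" and xi: "\<And>n. cc_form (\<xi> n)"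
    and m: "(\<lambda>n. nsq (\<lambda>x. \<xi> n x - v x)) \<longlonglongrightarrow> 0" "(\<lambda>n. nsq (\<lambda>x. dl x *\<^sub>R (Sym (\<xi> n) x - T x))) \<longlonglongrightarrow> 0"
    using v unfolding iff by blast
  have sand: "(\<lambda>n. nsq (\<lambda>x. f n x + g n x)) \<longlonglongrightarrow> 0" if "\<And>n. sqint (f n)" "\<And>n. sqint (g n)" "(\<lambda>n. nsq (f n)) \<longlonglongrightarrow> 0" "(\<lambda>n. nsq (g n)) \<longlonglongrightarrow> 0"
    for f g :: "nat \<Rightarrow> real^2 \<Rightarrow> 'z::euclidean_space"
  proof (rule tendsto_sandwich[OF _ _ tendsto_const])
    have "(\<lambda>n. 2 * nsq (f n) + 2 * nsq (g n)) \<longlonglongrightarrow> 2 * 0 + 2 * 0"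
      by (intro tendsto_add tendsto_mult tendsto_const that)
    then show "(\<lambda>n. 2 * nsq (f n) + 2 * nsq (g n)) \<longlonglongrightarrow> 0" by simp
  qed (intro always_eventually allI nsq_nonneg sqint_add that)+
  have sS: "sqint (\<lambda>x. dl x *\<^sub>R (Sym (\<theta> n) x - S x))" "sqint (\<lambda>x. dl x *\<^sub>R (Sym (\<xi> n) x - T x))" for n
    using sqint_diff(1)[OF sqint_cc(2)[OF th] S(1)] sqint_diff(1)[OF sqint_cc(2)[OF xi] T(1)] by (simp_all add: scaleR_diff_right)
  have "sqint (\<lambda>x. u x + v x)" by (rule sqint_add(1)[OF u v])
  moreover have "sqint (\<lambda>x. dl x *\<^sub>R (S x + T x))" using sqint_add(1)[OF S(1) T(1)] by (simp add: scaleR_add_right)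
  moreover have "weak_sym (\<lambda>x. u x + v x) (\<lambda>x. S x + T x)" using weak_sym_add_scaleR[OF u S v T, of 1] by simp
  moreover have "\<forall>n. cc_form (\<lambda>x. \<theta> n x + \<xi> n x)" by (intro allI cc_form_add th xi)
  moreover have "(\<lambda>n. nsq (\<lambda>x. (\<theta> n x + \<xi> n x) - (u x + v x))) \<longlonglongrightarrow> 0"
    using sand[OF sqint_diff(1)[OF sqint_cc(1)[OF th] u] sqint_diff(1)[OF sqint_cc(1)[OF xi] v] l(1) m(1)]
    by (simp add: add_diff_add)
  moreover have "(\<lambda>n. nsq (\<lambda>x. dl x *\<^sub>R (Sym (\<lambda>x. \<theta> n x + \<xi> n x) x - (S x + T x)))) \<longlonglongrightarrow> 0"
    using sand[OF sS l(2) m(2)] by (simp add: Sym_add[OF th xi] add_diff_add scaleR_add_right[symmetric])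
  ultimately show ?thesis
    unfolding iff by (intro conjI exI[of _ "\<lambda>x. S x + T x"] exI[of _ "\<lambda>n x. \<theta> n x + \<xi> n x"])
qed

lemma Lambda_c_sigma_cc: "Lambda_c_sigma a \<theta> \<Longrightarrow> cc_form \<theta>"
  by (simp add: Lambda_c_sigma_def)

lemma Vbold_subset: assumes "v \<in> Vbold a" shows "v \<in> H10 a"
  using assms Lambda_c_sigma_cc unfolding Vbold_def H10_def H1_closure_def by blast

lemma Vbold_iff:
  assumes "a > 0"
  shows "u \<in> Vbold a \<longleftrightarrow> sqint u \<and> (\<exists>S. sqint (\<lambda>x. dl x *\<^sub>R S x) \<and> weak_sym u S \<and>
     (\<exists>\<theta>. (\<forall>n. Lambda_c_sigma a (\<theta> n)) \<and> (\<lambda>n. nsq (\<lambda>x. \<theta> n x - u x)) \<longlonglongrightarrow> 0 \<and>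
       (\<lambda>n. nsq (\<lambda>x. dl x *\<^sub>R (Sym (\<theta> n) x - S x))) \<longlonglongrightarrow> 0))"
  unfolding Vbold_def by (rule H1_closure_iff[OF assms]) (rule Lambda_c_sigma_cc)

text \<open>Orthogonality to gradients of test functions is an L2-closed condition, so the L2 part
  of the convergence carries it to the limit.\<close>

lemma Vbold_weak_codiff:
  assumes a: "a > 0" and v: "v \<in> Vbold a" and t: "test_fun \<phi>"
  shows "(LINT x|HM. v x \<bullet> dfun \<phi> x) = 0"
proof -
  obtain \<theta> where v: "sqint v" and th: "\<And>n. Lambda_c_sigma a (\<theta> n)" and l: "(\<lambda>n. nsq (\<lambda>x. \<theta> n x - v x)) \<longlonglongrightarrow> 0"
    using v unfolding Vbold_iff[OF a] by blast
  have cc: "cc_form (\<theta> n)" for n by (rule Lambda_c_sigma_cc[OF th])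
  have df: "sqint (dfun \<phi>)" by (rule sqint_dfun[OF t])
  have "(LINT x|HM. \<theta> n x \<bullet> dfun \<phi> x) = 0" for n
    by (rule div_free_orthogonal_dfun[OF test_fun_smooth[OF cc_formD[OF cc]] t])
      (use th[of n] in \<open>simp add: Lambda_c_sigma_iff[OF a]\<close>)
  then show ?thesis
    using integral_inner_tendsto[OF sqint_cc(1)[OF cc] v df l] by (simp add: LIMSEQ_const_iff)
qed

lemma Fharm_harmonic_gradient:
  assumes "a > 0" "w \<in> Fharm a"
  obtains F where "w = dfun F" "harmonic_gradient F"
  using assms unfolding Fharm_def harmonic_H_iff[OF assms(1)] L2_form_iff[OF assms(1)] harmonic_gradient_def by blast

lemma Vbb_subset: assumes a: "a > 0" shows "Vbb a \<subseteq> Vtilde a"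
proof
  fix u assume "u \<in> Vbb a"
  then obtain v w where uvw: "u = (\<lambda>x. v x + w x)" and v: "v \<in> Vbold a" and w: "w \<in> Fharm a"
    by (auto simp: Vbb_def)
  obtain F where F: "w = dfun F" and hF: "harmonic_gradient F" using Fharm_harmonic_gradient[OF a w] .
  have h: "u \<in> H10 a"
    unfolding uvw F by (rule H10_add[OF a Vbold_subset[OF v] harmonic_gradient.in_H10[OF hF a]])
  have sv: "sqint v" using v unfolding Vbold_def H1_closure_def L2_form_iff[OF a] by blast
  have sw: "sqint w" unfolding F by (rule harmonic_gradient.dF[OF hF])
  have "(LINT x|HM. u x \<bullet> dfun \<phi> x) = 0" if t: "test_fun \<phi>" for \<phi>
  proof -
    have df: "sqint (dfun \<phi>)" by (rule sqint_dfun[OF t])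
    show ?thesis
      unfolding uvw inner_add_left Bochner_Integration.integral_add[OF sqint_inner[OF sv df] sqint_inner[OF sw df]]
      using Vbold_weak_codiff[OF a v t] harmonic_gradient.orthogonal_to_gradients[OF hF t] by (simp add: F)
  qed
  then show "u \<in> Vtilde a" using h by (simp add: Vtilde_def weak_codiff_0_iff[OF a])
qed

text \<open>The upgrade from L2 to H1 approximation: an L2 limit of rotated gradients that happens
  to possess a weighted weak symmetric gradient is an H1 limit of divergence-free test fields. The
  given \<open>\<phi> n\<close> only produce the stream function; the H1 approximants are
  new.\<close>

lemma in_Vbold:
  assumes a: "a > 0" and t: "\<And>n. test_fun (\<phi> n)" and v: "sqint v"
    and lim: "(\<lambda>n. nsq (\<lambda>x. dperp (\<phi> n) x - v x)) \<longlonglongrightarrow> 0"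
    and S: "sqint (\<lambda>x. dl x *\<^sub>R S x)" "weak_sym v S"
  shows "v \<in> Vbold a"
proof -
  interpret L: stream_limit \<phi> v by unfold_locales (rule t v lim)+
  obtain p where p: "sqint p"
    "\<And>i \<zeta>. test_fun \<zeta> \<Longrightarrow> (LINT x|HM. (dl x * p x) * pd i \<zeta> x) = - (LINT x|HM. L.gv i x * \<zeta> x)"
    using L.stream_exists by blast
  interpret F: stream_function v p L.gv S
    by unfold_locales (use v p S in \<open>auto simp: L.gv_def\<close>)
  show ?thesis
  proof (rule F.approximating_sequence)
    fix \<theta> :: "nat \<Rightarrow> real^2 \<Rightarrow> real^2"
    assume th: "\<And>n. cc_form (\<theta> n)" "\<And>n x. x \<in> Hdisk \<Longrightarrow> pd 1 (\<lambda>y. \<theta> n y $ 1) x + pd 2 (\<lambda>y. \<theta> n y $ 2) x = 0"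
      and l: "(\<lambda>n. nsq (\<lambda>x. \<theta> n x - v x)) \<longlonglongrightarrow> 0" "(\<lambda>n. nsq (\<lambda>x. dl x *\<^sub>R (Sym (\<theta> n) x - S x))) \<longlonglongrightarrow> 0"
    have "\<forall>n. Lambda_c_sigma a (\<theta> n)" using th by (simp add: Lambda_c_sigma_iff[OF a])
    then show ?thesis
      unfolding Vbold_iff[OF a] using v S l by blast
  qed
qed

lemma Vtilde_subset: assumes a: "a > 0" shows "Vtilde a \<subseteq> Vbb a"
proof
  fix u assume u: "u \<in> Vtilde a"
  have udiv: "(LINT x|HM. u x \<bullet> dfun \<phi> x) = 0" if "test_fun \<phi>" for \<phi>
    using u that by (simp add: Vtilde_def weak_codiff_0_iff[OF a])
  obtain S where su: "sqint u" and S: "sqint (\<lambda>x. dl x *\<^sub>R S x)" "weak_sym u S"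
    using u unfolding Vtilde_def H10_def H1_closure_iff[OF a, of cc_form, simplified] by blast
  \<comment> \<open>The linear space onto whose closure \<open>u\<close> is projected; membership
    keeps track of the stream function.\<close>
  define P where "P s \<longleftrightarrow> (\<exists>\<phi>. test_fun \<phi> \<and> s = dperp \<phi>)" for s
  have Ps: "sqint s" if "P s" for s using that sqint_cc(1)[OF cc_form_dperp] by (auto simp: P_def)
  have P0: "P (\<lambda>x. 0)"
  proof -
    have "test_fun (\<lambda>x. 0 * chi 0 x)" by (rule test_fun_cmult[OF test_chi])
    moreover have "dperp (\<lambda>x. 0) = (\<lambda>x. 0)" by (simp add: dperp_def fun_eq_iff vec_eq_iff)
    ultimately show ?thesis unfolding P_def by (intro exI[of _ "\<lambda>x. 0"]) simp
  qed
  have Plin: "P (\<lambda>x. s x + c *\<^sub>R t x)" if s: "P s" and t: "P t" for s t c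
  proof -
    obtain f where f: "test_fun f" "s = dperp f" using s by (auto simp: P_def)
    obtain g where g: "test_fun g" "t = dperp g" using t by (auto simp: P_def)
    have "(\<lambda>x. s x + c *\<^sub>R t x) = dperp (\<lambda>x. f x + c * g x)"
      by (rule ext) (simp only: f(2) g(2) dperp_add_cmult[OF f(1) g(1)])
    then show ?thesis unfolding P_def using test_fun_add[OF f(1) test_fun_cmult[OF g(1)]] by blast
  qed
  obtain s v where s: "\<And>n. P (s n)" and v: "sqint v" and lim: "(\<lambda>n. nsq (\<lambda>x. s n x - v x)) \<longlonglongrightarrow> 0"
    and orth: "\<And>t. P t \<Longrightarrow> (LINT x|HM. (u x - v x) \<bullet> t x) = 0"
    using sqint_projection[of u P, OF su Ps P0 Plin] by blast
  have "\<forall>n. \<exists>\<phi>. test_fun \<phi> \<and> s n = dperp \<phi>" using s by (simp add: P_def)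
  then obtain \<phi> where \<phi>: "\<And>n. test_fun (\<phi> n)" "\<And>n. s n = dperp (\<phi> n)" by metis
  define w where "w x = u x - v x" for x
  have sw: "sqint w" unfolding w_def[abs_def] by (rule sqint_diff(1)[OF su v])
  \<comment> \<open>Zero divergence comes from \<open>u\<close> and from the L2 limit
    \<open>v\<close> of rotated gradients; zero curl is the orthogonality that defines the
    projection.\<close>
  interpret Wl: weak_div_curl_free w
  proof
    show "sqint w" by (rule sw)
    fix \<zeta> assume t: "test_fun \<zeta>"
    have df: "sqint (dfun \<zeta>)" by (rule sqint_dfun[OF t])
    have "(\<lambda>n. (LINT x|HM. s n x \<bullet> dfun \<zeta> x)) \<longlonglongrightarrow> (LINT x|HM. v x \<bullet> dfun \<zeta> x)"
      by (rule integral_inner_tendsto[OF Ps[OF s] v df lim])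
    then have "(LINT x|HM. v x \<bullet> dfun \<zeta> x) = 0"
      by (simp add: \<phi>(2) dperp_orthogonal_dfun[OF \<phi>(1) t] LIMSEQ_const_iff)
    then show "(LINT x|HM. w x \<bullet> dfun \<zeta> x) = 0"
      using udiv[OF t] sqint_inner[OF su df] sqint_inner[OF v df] by (simp add: w_def inner_diff_left)
    show "(LINT x|HM. w x \<bullet> dperp \<zeta> x) = 0"
      unfolding w_def by (rule orth) (use t in \<open>auto simp: P_def\<close>)
  qed
  obtain F where F: "smooth_fun Hdisk F" "\<And>x. x \<in> Hdisk \<Longrightarrow> dfun F x = Wl.W x"
    using potential_exists[of Wl.W, OF Wl.smooth_W Wl.W_div_curl] by blast
  have AE: "AE x in HM. w x = dfun F x"
  proof -
    have "AE x in HM. x \<in> Hdisk" by (intro AE_I2) (simp add: space_HM)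
    with Wl.W_AE show ?thesis by eventually_elim (simp add: F(2))
  qed
  have Fm: "dfun F \<in> borel_measurable HM"
  proof (rule measurable_vec2I)
    show "(\<lambda>x. dfun F x $ i) \<in> borel_measurable HM" for i
      using continuous_HM_measurable[OF smooth_fun_continuous[OF smooth_fun_pd[OF F(1), of i]]] by (simp add: dfun_def)
  qed
  have sF: "sqint (dfun F)"
    unfolding sqint_def
  proof (intro conjI Fm)
    show "integrable HM (\<lambda>x. (norm (dfun F x))\<^sup>2)"
      by (rule integrable_cong_AE_imp[OF sqint_integrable_sq[OF sw]])
        (use AE Fm in \<open>auto elim: eventually_mono\<close>)
  qed
  have lapF: "pd 1 (pd 1 F) x + pd 2 (pd 2 F) x = 0" if x: "x \<in> Hdisk" for x
  proof -
    have "pd i (pd i F) x = pd i (\<lambda>x. Wl.W x $ i) x" for i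
    proof (rule pd_cong[OF open_Hdisk x])
      show "pd i F y = Wl.W y $ i" if "y \<in> Hdisk" for y
        unfolding F(2)[OF that, symmetric] by (simp add: dfun_def)
    qed
    then show ?thesis using Wl.W_div_curl(1)[OF x] by simp
  qed
  interpret hF: harmonic_gradient F by unfold_locales (fact F(1) lapF sF)+
  \<comment> \<open>\<open>w\<close> agrees with \<open>dfun F\<close> only almost everywhere, while
    the decomposition must hold at every point. Redefining \<open>v\<close> on the null set changes
    none of the integrals.\<close>
  define v' where "v' x = u x - dfun F x" for x
  have sv': "sqint v'" unfolding v'_def[abs_def] by (rule sqint_diff(1)[OF su sF])
  have lim': "(\<lambda>n. nsq (\<lambda>x. dperp (\<phi> n) x - v' x)) \<longlonglongrightarrow> 0"
  proof -
    have "nsq (\<lambda>x. dperp (\<phi> n) x - v' x) = nsq (\<lambda>x. s n x - v x)" for n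
      unfolding nsq_def
    proof (rule integral_cong_AE)
      show "(\<lambda>x. (norm (dperp (\<phi> n) x - v' x))\<^sup>2) \<in> borel_measurable HM"
        using sqint_integrable_sq[OF sqint_diff(1)[OF Ps[OF s] sv']] by (simp add: \<phi>(2) borel_measurable_integrable)
      show "(\<lambda>x. (norm (s n x - v x))\<^sup>2) \<in> borel_measurable HM"
        using sqint_integrable_sq[OF sqint_diff(1)[OF Ps[OF s] v]] by (simp add: borel_measurable_integrable)
      show "AE x in HM. (norm (dperp (\<phi> n) x - v' x))\<^sup>2 = (norm (s n x - v x))\<^sup>2"
        using AE
      proof eventually_elim
        case (elim x)
        then have "v' x = v x" unfolding v'_def w_def by (simp add: algebra_simps)
        then show ?case by (simp add: \<phi>(2))
      qed
    qed
    then show ?thesis using lim by simp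
  qed
  \<comment> \<open>Here the projection acquires its regularity: its symmetric gradient is the
    difference of the one of \<open>u\<close> and the classical one of the harmonic
    gradient.\<close>
  have w1: "weak_sym v' (\<lambda>x. S x - Sym (dfun F) x)"
    using weak_sym_add_scaleR[OF su S sF hF.sqint_Sym weak_sym_smooth[OF hF.smooth_nth], of "-1"] by (simp add: v'_def[abs_def])
  have w2: "sqint (\<lambda>x. dl x *\<^sub>R (S x - Sym (dfun F) x))"
    using sqint_diff(1)[OF S(1) hF.sqint_Sym] by (simp add: scaleR_diff_right)
  have "v' \<in> Vbold a"
    by (rule in_Vbold[OF a \<phi>(1) sv' lim' w2 w1])
  moreover have "dfun F \<in> Fharm a"
    unfolding Fharm_def harmonic_H_iff[OF a] L2_form_iff[OF a] using F(1) lapF sF by blast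
  moreover have "u = (\<lambda>x. v' x + dfun F x)" by (simp add: v'_def)
  ultimately show "u \<in> Vbb a" unfolding Vbb_def by blast
qed

theorem theorem1p7:
  fixes a :: real
  assumes "a > 0"
  shows "Vbb a = Vtilde a"
  using Vbb_subset[OF assms] Vtilde_subset[OF assms] by (rule subset_antisym)

end
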